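(* Fix $q_1,q_2\in\mathbb N$, a filter $b\in M_{q_1,q_2}(\mathbb R)$ with $b_{11}\neq 0$, and $\ell\in\mathbb N$, $\ell\ge1$. For positive integers $H,W,N$ with $HW\ge N$, let $H_e=H-1+q_1$, $W_e=W-1+q_2$, let $B$ be the $HW\times H_eW_e$ matrix with $$B_{(h-1)W+w,\ (h+i-2)W_e+j+w-1}=b_{i,j}\qquad(1\le h\le H,\ 1\le w\le W,\ 1\le i\le q_1,\ 1\le j\le q_2)$$ and all other entries zero, and let $\theta_N=(H_eW_e/N,\,B^TB)$. Then the law of the free deterministic equivalent Z-score $\mathcal Z^\Box_\ell(\theta_N\mid\theta_N)$ converges weakly to $\mathrm{Normal}(0,1)$ as $N\to\infty$ and $HW\to\infty$ with $HW\ge N$.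
   Context: Parameters: $\theta=(d/n,D)$ with $d,n\in\mathbb N$, $d\ge n$, and $D\in M_d(\mathbb R)$ symmetric positive semidefinite. Write $\lambda=d/n$. (For $\theta_N$: $d=H_eW_e$, $n=N$, $D=B^TB$.) Compound Wishart matrix: $\mathcal W_\theta=Z^TDZ$, where $Z$ is a $d\times n$ random matrix with independent centered Gaussian entries of variance $1/n$. Traces: $\operatorname{Tr}$ is the unnormalized trace, $\operatorname{tr}$ the normalized trace, $m_k(D)=\operatorname{tr}(D^k)$. $\mathbb V$ denotes variance. Amplification: for $\mathfrak a\in\mathbb N$, $\theta^{\mathfrak a}=(\lambda,D\otimes I_{\mathfrak a})$, i.e. $d,n$ are replaced by $\mathfrak a d,\mathfrak a n$. Premaps: let $[m]=\{1,\dots,m\}$ and $\pm[m]=[m]\cup(-[m])$. A premap is a permutation $\pi$ of $\pm[m]$ with $\pi(k)=-\pi^{-1}(-k)$ for all $k$ and such that no cycle contains both $k$ and $-k$. $\mathrm{PM}_m$ is the set of premaps of $\pm[m]$. A cycle of a premap is particular if its element of smallest absolute value is positive; $\pi/2$ denotes the permutation (of the set of elements appearing in particular cycles) formed by the particular cycles of $\pi$. $\#\sigma$ is the number of cycles of $\sigma$ (fixed points included). For a permutation $\sigma$ with cycles $c_1,\dots,c_p$, $\operatorname{tr}_\sigma[D]=\prod_{j=1}^p m_{|c_j|}(D)$, where $|c_j|$ is the length of $c_j$. For a permutation $\gamma$ of $[m]$, the permutation $\gamma_+$ of $\pm[m]$ equals $\gamma$ on $[m]$ and the identity on $-[m]$;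 $\gamma_-$ is the identity on $[m]$ and $\gamma_-(-k)=-\gamma(k)$ for $k\in[m]$. For $\pi\in\mathrm{PM}_m$, $$\chi(\gamma,\pi)=\#\big((\gamma_+\gamma_-^{-1})/2\big)+\#(\pi/2)+\#\big((\gamma_-^{-1}\pi\gamma_+)/2\big)-m .$$ FDE mean and variance: with $\gamma=(1,2,\dots,\ell)$, $$\mu^\Box_\ell(\theta)=n\alpha_\ell+\beta_\ell,\quad \alpha_\ell=\sum_{\pi\in\mathrm{PM}_\ell,\ \chi(\gamma,\pi)=2}\lambda^{\#(\pi/2)}\operatorname{tr}_{\pi/2}[D],\quad \beta_\ell=\sum_{\pi\in\mathrm{PM}_\ell,\ \chi(\gamma,\pi)=1}\lambda^{\#(\pi/2)}\operatorname{tr}_{\pi/2}[D],$$ $$\mathrm{Var}^\Box_\ell(\theta)=\lim_{\mathfrak a\to\infty}\mathbb V[\operatorname{Tr}(\mathcal W_{\theta^{\mathfrak a}}^\ell)]$$ (the limit exists). FDE Z-score: for parameters $\theta_0,\theta$, $$\mathcal Z^\Box_\ell(\theta_0\mid\theta)=\frac{\operatorname{Tr}(\mathcal W_{\theta_0}^\ell)-\mu^\Box_\ell(\theta)}{\sqrt{\mathrm{Var}^\Box_\ell(\theta)}} .$$ *)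

theory Defs
  imports
    "HOL-Probability.Probability"
    "HOL-Combinatorics.Orbits"
    "HOL-Combinatorics.Cycles"
    "Jordan_Normal_Form.Matrix"
begin

section \<open>Matrices of varying size\<close>

definition mat_trace :: "real mat \<Rightarrow> real" where
  "mat_trace A = (\<Sum>i<dim_row A. A $$ (i, i))"

definition moment :: "nat \<Rightarrow> real mat \<Rightarrow> real" where
  "moment k D = mat_trace (D ^\<^sub>m k) / real (dim_row D)"

definition kronecker :: "real mat \<Rightarrow> real mat \<Rightarrow> real mat" where
  "kronecker A B = mat (dim_row A * dim_row B) (dim_col A * dim_col B)
     (\<lambda>(r, c). A $$ (r div dim_row B, c div dim_col B) * B $$ (r mod dim_row B, c mod dim_col B))"

section \<open>Compound Wishart matrices\<close>

text \<open>
  A parameter \<open>\<theta> = (d/n, D)\<close> is given by \<open>n\<close> and the \<open>d \<times> d\<close> matrix \<open>D\<close>, so that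
  \<open>d = dim_row D\<close>. The entries of the Gaussian matrix \<open>Z\<close> are the coordinates of the product
  space; the second argument of \<open>normal_density\<close> is the standard deviation.
\<close>

definition gaussian_space :: "nat \<Rightarrow> nat \<Rightarrow> (nat \<times> nat \<Rightarrow> real) measure" where
  "gaussian_space d n =
     (\<Pi>\<^sub>M ij \<in> {..<d} \<times> {..<n}. density lborel (normal_density 0 (1 / sqrt (real n))))"

definition wishart :: "nat \<Rightarrow> real mat \<Rightarrow> (nat \<times> nat \<Rightarrow> real) \<Rightarrow> real mat" where
  "wishart n D \<omega> = (let Z = mat (dim_row D) n \<omega> in transpose_mat Z * D * Z)"

definition wishart_trace :: "nat \<Rightarrow> nat \<Rightarrow> real mat \<Rightarrow> (nat \<times> nat \<Rightarrow> real) \<Rightarrow> real" where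
  "wishart_trace l n D \<omega> = mat_trace (wishart n D \<omega> ^\<^sub>m l)"

section \<open>Premaps\<close>

text \<open>
  A permutation of a finite set of integers is a function on \<open>int\<close> that fixes everything outside
  the set; its number of cycles therefore depends on the set \<open>S\<close>, which is passed explicitly.
\<close>

definition cycle_sets :: "int set \<Rightarrow> (int \<Rightarrow> int) \<Rightarrow> int set set" where
  "cycle_sets S \<sigma> = orbit \<sigma> ` S"

definition num_cycles :: "int set \<Rightarrow> (int \<Rightarrow> int) \<Rightarrow> nat" where
  "num_cycles S \<sigma> = card (cycle_sets S \<sigma>)"

definition pm :: "nat \<Rightarrow> int set" where
  "pm m = {- int m..int m} - {0}"

definition premaps :: "nat \<Rightarrow> (int \<Rightarrow> int) set" where
  "premaps m = {\<pi>. \<pi> permutes pm m \<and> (\<forall>k\<in>pm m. \<pi> k = - inv_into UNIV \<pi> (- k)) \<and>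
                     (\<forall>c\<in>cycle_sets (pm m) \<pi>. \<forall>k. \<not> (k \<in> c \<and> - k \<in> c))}"

definition particular :: "int set \<Rightarrow> bool" where
  "particular c \<longleftrightarrow> (\<exists>k\<in>c. k > 0 \<and> (\<forall>j\<in>c. \<bar>k\<bar> \<le> \<bar>j\<bar>))"

text \<open>The permutation \<open>\<pi>/2\<close> is \<open>half_perm m \<pi>\<close>, as a permutation of \<open>half_set m \<pi>\<close>.\<close>

definition half_set :: "nat \<Rightarrow> (int \<Rightarrow> int) \<Rightarrow> int set" where
  "half_set m \<pi> = \<Union> {c \<in> cycle_sets (pm m) \<pi>. particular c}"

definition half_perm :: "nat \<Rightarrow> (int \<Rightarrow> int) \<Rightarrow> int \<Rightarrow> int" where
  "half_perm m \<pi> = perm_restrict \<pi> (half_set m \<pi>)"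

definition num_half :: "nat \<Rightarrow> (int \<Rightarrow> int) \<Rightarrow> nat" where
  "num_half m \<pi> = num_cycles (half_set m \<pi>) (half_perm m \<pi>)"

definition trace_perm :: "int set \<Rightarrow> (int \<Rightarrow> int) \<Rightarrow> real mat \<Rightarrow> real" where
  "trace_perm S \<sigma> D = (\<Prod>c\<in>cycle_sets S \<sigma>. moment (card c) D)"

definition perm_plus :: "(int \<Rightarrow> int) \<Rightarrow> int \<Rightarrow> int" where
  "perm_plus \<gamma> k = (if k > 0 then \<gamma> k else k)"

definition perm_minus :: "(int \<Rightarrow> int) \<Rightarrow> int \<Rightarrow> int" where
  "perm_minus \<gamma> k = (if k < 0 then - \<gamma> (- k) else k)"

definition euler_char :: "nat \<Rightarrow> (int \<Rightarrow> int) \<Rightarrow> (int \<Rightarrow> int) \<Rightarrow> int" where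
  "euler_char m \<gamma> \<pi> =
     int (num_half m (perm_plus \<gamma> \<circ> inv_into UNIV (perm_minus \<gamma>))) + int (num_half m \<pi>)
     + int (num_half m (inv_into UNIV (perm_minus \<gamma>) \<circ> \<pi> \<circ> perm_plus \<gamma>)) - int m"

section \<open>The free deterministic equivalent Z-score\<close>

definition full_cycle :: "nat \<Rightarrow> int \<Rightarrow> int" where
  "full_cycle l = cycle_of_list [1..int l]"

definition premap_sum :: "int \<Rightarrow> nat \<Rightarrow> nat \<Rightarrow> real mat \<Rightarrow> real" where
  "premap_sum x l n D =
     (\<Sum>\<pi> | \<pi> \<in> premaps l \<and> euler_char l (full_cycle l) \<pi> = x.
        (real (dim_row D) / real n) ^ num_half l \<pi> * trace_perm (half_set l \<pi>) (half_perm l \<pi>) D)"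

definition fde_mean :: "nat \<Rightarrow> nat \<Rightarrow> real mat \<Rightarrow> real" where
  "fde_mean l n D = real n * premap_sum 2 l n D + premap_sum 1 l n D"

definition wishart_trace_variance :: "nat \<Rightarrow> nat \<Rightarrow> real mat \<Rightarrow> real" where
  "wishart_trace_variance l n D =
     prob_space.variance (gaussian_space (dim_row D) n) (wishart_trace l n D)"

definition fde_variance :: "nat \<Rightarrow> nat \<Rightarrow> real mat \<Rightarrow> real" where
  "fde_variance l n D = lim (\<lambda>a. wishart_trace_variance l (a * n) (kronecker D (1\<^sub>m a)))"

definition fde_zscore ::
    "nat \<Rightarrow> nat \<Rightarrow> real mat \<Rightarrow> nat \<Rightarrow> real mat \<Rightarrow> (nat \<times> nat \<Rightarrow> real) \<Rightarrow> real" where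
  "fde_zscore l n0 D0 n D \<omega> =
     (wishart_trace l n0 D0 \<omega> - fde_mean l n D) / sqrt (fde_variance l n D)"

definition fde_zscore_law :: "nat \<Rightarrow> nat \<Rightarrow> real mat \<Rightarrow> nat \<Rightarrow> real mat \<Rightarrow> real measure" where
  "fde_zscore_law l n0 D0 n D =
     distr (gaussian_space (dim_row D0) n0) borel (fde_zscore l n0 D0 n D)"

section \<open>The matrix of a convolution\<close>

text \<open>
  Indices start at \<open>0\<close>, so the filter entry with (1-based) indices \<open>i, j\<close> is \<open>b $$ (i - 1, j - 1)\<close>.
  The entry is obtained by decoding a row as \<open>h * W + w\<close> and a column as
  \<open>(h + i) * (W - 1 + q2) + (w + j)\<close>; the two lemmas below state this explicitly.
\<close>

definition conv_matrix :: "real mat \<Rightarrow> nat \<Rightarrow> nat \<Rightarrow> real mat" where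
  "conv_matrix b H W =
    (let q1 = dim_row b; q2 = dim_col b; He = H - 1 + q1; We = W - 1 + q2 in
     mat (H * W) (He * We) (\<lambda>(r, c).
       let h = r div W; w = r mod W; p = c div We; s = c mod We in
       if h \<le> p \<and> p < h + q1 \<and> w \<le> s \<and> s < w + q2 then b $$ (p - h, s - w) else 0))"

lemma conv_matrix_index_less:
  fixes h w i j :: nat
  assumes "h < H" "w < W" "i < q1" "j < q2"
  shows "h * W + w < H * W" "(h + i) * (W - 1 + q2) + (w + j) < (H - 1 + q1) * (W - 1 + q2)"
proof -
  have aux: "x * n + y < m * n" if "x < m" "y < n" for x y m n :: nat
  proof -
    have "x * n + y < Suc x * n" using that by simp
    also have "\<dots> \<le> m * n" using that by (intro mult_le_mono1) simp
    finally show ?thesis .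
  qed
  show "h * W + w < H * W" using assms by (intro aux) auto
  show "(h + i) * (W - 1 + q2) + (w + j) < (H - 1 + q1) * (W - 1 + q2)"
    using assms by (intro aux) auto
qed

lemma conv_matrix_entry:
  assumes "b \<in> carrier_mat q1 q2" "h < H" "w < W" "i < q1" "j < q2"
  shows "conv_matrix b H W $$ (h * W + w, (h + i) * (W - 1 + q2) + (w + j)) = b $$ (i, j)"
proof -
  have dims: "dim_row b = q1" "dim_col b = q2" using assms by auto
  have div: "(x * n + y) div n = x" "(x * n + y) mod n = y" if "y < n" for x y n :: nat
    using that by auto
  have l: "w + j < W - 1 + q2" using assms by linarith
  have "(h * W + w) div W = h" "(h * W + w) mod W = w" using assms by auto
  moreover have "((h + i) * (W - 1 + q2) + (w + j)) div (W - 1 + q2) = h + i"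
    "((h + i) * (W - 1 + q2) + (w + j)) mod (W - 1 + q2) = w + j"
    by (rule div[OF l])+
  ultimately show ?thesis
    using conv_matrix_index_less[OF assms(2-5)] assms
    by (simp add: conv_matrix_def dims Let_def del: One_nat_def)
qed

lemma conv_matrix_entry_zero:
  assumes "b \<in> carrier_mat q1 q2" "r < H * W" "c < (H - 1 + q1) * (W - 1 + q2)"
    and "\<And>h w i j. h < H \<Longrightarrow> w < W \<Longrightarrow> i < q1 \<Longrightarrow> j < q2 \<Longrightarrow>
           \<not> (r = h * W + w \<and> c = (h + i) * (W - 1 + q2) + (w + j))"
  shows "conv_matrix b H W $$ (r, c) = 0"
proof -
  have dims: "dim_row b = q1" "dim_col b = q2" using assms by auto
  define We where "We = W - 1 + q2"
  have W: "0 < W" using assms(2) by (cases W) auto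
  have h: "r div W < H" using assms(2) by (simp add: less_mult_imp_div_less)
  have w: "r mod W < W" using W by simp
  have "\<not> (r div W \<le> c div We \<and> c div We < r div W + q1 \<and> r mod W \<le> c mod We \<and> c mod We < r mod W + q2)"
  proof
    assume a: "r div W \<le> c div We \<and> c div We < r div W + q1 \<and> r mod W \<le> c mod We \<and> c mod We < r mod W + q2"
    have "r = r div W * W + r mod W" by simp
    moreover have "c = (r div W + (c div We - r div W)) * We + (r mod W + (c mod We - r mod W))"
      using a by simp
    ultimately show False
      using assms(4)[OF h w, of "c div We - r div W" "c mod We - r mod W"] a
      unfolding We_def by linarith
  qed
  then show ?thesis
    using assms(2,3) unfolding conv_matrix_def dims Let_def We_def by auto
qed

text \<open>The parameter \<open>\<theta>\<^sub>N\<close> is \<open>(N, conv_gram b H W)\<close>, of dimension \<open>d = (H - 1 + q1) * (W - 1 + q2)\<close>.\<close>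

definition conv_gram :: "real mat \<Rightarrow> nat \<Rightarrow> nat \<Rightarrow> real mat" where
  "conv_gram b H W = transpose_mat (conv_matrix b H W) * conv_matrix b H W"

end

theory Submission
  imports Defs
begin

text \<open>
  Let \<open>X = Tr (W\<^sup>l)\<close> with \<open>W = Z\<^sup>T D Z\<close>, and \<open>\<lambda> = d / n\<close>. The proof is the method of moments, carried out
  with cumulants that are read off from Wick's formula.

  Expanding \<open>X\<^sup>k\<close> gives a sum over the row and column indices of \<open>2kl\<close> factors \<open>Z\<close>. These factors
  are the points of \<open>k\<close> circles; two fixed pairings of the points record the expression: \<open>\<delta>\<close> joins
  the two points that share a factor \<open>D\<close>, and \<open>\<epsilon>\<close> joins the two points that share a column index.
  Taking the expectation inserts a third pairing \<open>\<tau>\<close> and sums over it. Row indices are constrained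
  by \<open>\<delta>, \<tau>\<close> and column indices by \<open>\<epsilon>, \<tau>\<close>, so that \<open>\<tau>\<close> contributes
  \<open>n\<^bsup>c\<^sub>1 + c\<^sub>2 - kl\<^esup> \<lambda>\<^bsup>c\<^sub>1\<^esup>\<close> times a product of normalized traces of powers of \<open>D\<close>, where \<open>c\<^sub>1\<close> and \<open>c\<^sub>2\<close> count the
  components of the graphs \<open>\<delta> \<union> \<tau>\<close> and \<open>\<epsilon> \<union> \<tau>\<close> (\<open>genus_expansion\<close>, \<open>index_sum\<close>). Splitting off the
  component of one circle turns this into the recursion between moments and cumulants, where the
  \<open>k\<close>-th cumulant is the sum over those \<open>\<tau>\<close> that connect all \<open>k\<close> circles (\<open>moment_cumulant\<close>).

  For a connecting \<open>\<tau>\<close> two inequalities hold. Euler's inequality for the surface glued from \<open>\<delta>, \<epsilon>, \<tau>\<close>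
  gives \<open>c\<^sub>1 + c\<^sub>2 + k \<le> kl + 2\<close> (\<open>euler_inequality\<close>), and submodularity of the number of components
  gives \<open>c\<^sub>1 + k \<le> kl + 1\<close> (\<open>ncomp_submodular\<close>). Hence the \<open>k\<close>-th cumulant is at most a constant times
  \<open>n\<^bsup>2 - k\<^esup> \<lambda>\<^bsup>kl + 1 - k\<^esup>\<close>. The second inequality is what makes the argument uniform in \<open>\<lambda>\<close>, which need not
  stay bounded. The variance is of the exact order \<open>\<lambda>\<^bsup>2l - 1\<^esup>\<close>: the lower bound is the Cauchy-Schwarz
  inequality against the squared Euclidean norm of \<open>Z\<close>, whose covariance with \<open>X\<close> is explicit because
  \<open>X\<close> is homogeneous of degree \<open>2l\<close> (\<open>cum_2_ge\<close>). So the cumulants of order at least \<open>3\<close> of the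
  standardized variable are \<open>O(1/n)\<close>.

  The free deterministic equivalents are the leading terms of the same expansions. Premaps are the
  products \<open>\<delta>\<tau>\<close>, and their Euler characteristic is \<open>1 + c\<^sub>1 + c\<^sub>2 - l\<close> (\<open>euler_char_eq\<close>); thus the FDE mean
  collects the terms of order \<open>n\<close> and \<open>1\<close> of the mean of \<open>X\<close>. Amplification by \<open>a\<close> multiplies the term of
  \<open>\<tau>\<close> in the second cumulant by \<open>a\<^bsup>c\<^sub>1 + c\<^sub>2 - 2l\<^esup>\<close>, so the FDE variance collects the terms with
  \<open>c\<^sub>1 + c\<^sub>2 = 2l\<close> (\<open>fde_variance_lim\<close>). After standardization the first two cumulants are therefore
  \<open>O(1/n)\<close> and \<open>1 + O(1/n)\<close> (\<open>std_cum_error\<close>), all moments converge to those of the normal law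
  (\<open>moments_converge\<close>), and this implies weak convergence (\<open>moments_imp_weak_conv\<close>).

  Only two properties of the convolution enter: the moments of \<open>B\<^sup>T B\<close> are nonnegative and at most
  geometric in their order, and its normalized trace is bounded below by \<open>b\<^sub>1\<^sub>1\<^sup>2 / (q\<^sub>1 q\<^sub>2)\<close>, all uniformly in the
  image size (\<open>conv_gram_bounded_param\<close>, \<open>conv_gram_moment_1\<close>).
\<close>

section \<open>Components of finite graphs\<close>

definition eqcl :: "'a set \<Rightarrow> ('a \<times> 'a) set \<Rightarrow> ('a \<times> 'a) set" where
  "eqcl P E = (E \<union> E\<inverse>)\<^sup>* \<inter> P \<times> P"

definition ncomp :: "'a set \<Rightarrow> ('a \<times> 'a) set \<Rightarrow> nat" where
  "ncomp P E = card (P // eqcl P E)"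

definition graph_on :: "'a set \<Rightarrow> ('a \<Rightarrow> 'a) \<Rightarrow> ('a \<times> 'a) set" where
  "graph_on P f = (\<lambda>x. (x, f x)) ` P"

abbreviation ncomp2 :: "'a set \<Rightarrow> ('a \<Rightarrow> 'a) \<Rightarrow> ('a \<Rightarrow> 'a) \<Rightarrow> nat" where
  "ncomp2 P f g \<equiv> ncomp P (graph_on P f \<union> graph_on P g)"

lemma equiv_eqcl: "equiv P (eqcl P E)"
proof (rule equivI)
  show "eqcl P E \<subseteq> P \<times> P" by (auto simp: eqcl_def)
  show "refl_on P (eqcl P E)" by (auto simp: eqcl_def refl_on_def)
  have "sym ((E \<union> E\<inverse>)\<^sup>*)" by (intro sym_rtrancl) (auto simp: sym_def)
  then show "sym (eqcl P E)" by (auto simp: eqcl_def sym_def)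
  show "trans (eqcl P E)" by (auto simp: eqcl_def trans_def)
qed

lemma eqcl_refl: "x \<in> P \<Longrightarrow> (x, x) \<in> eqcl P E"
  by (auto simp: eqcl_def)

lemma eqcl_sym: "(x, y) \<in> eqcl P E \<Longrightarrow> (y, x) \<in> eqcl P E"
  using equiv_eqcl[of P E] by (auto simp: equiv_def sym_def)

lemma eqcl_trans: "(x, y) \<in> eqcl P E \<Longrightarrow> (y, z) \<in> eqcl P E \<Longrightarrow> (x, z) \<in> eqcl P E"
  using equiv_eqcl[of P E] by (auto simp: equiv_def trans_def)

lemma eqcl_edge: "(x, y) \<in> E \<Longrightarrow> x \<in> P \<Longrightarrow> y \<in> P \<Longrightarrow> (x, y) \<in> eqcl P E"
  by (auto simp: eqcl_def)

lemma eqcl_in: "(x, y) \<in> eqcl P E \<Longrightarrow> x \<in> P" "(x, y) \<in> eqcl P E \<Longrightarrow> y \<in> P"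
  by (auto simp: eqcl_def)

lemma eqcl_least:
  assumes "E \<subseteq> T" "equiv P T"
  shows "eqcl P E \<subseteq> T"
proof -
  have tr: "trans T" and sy: "sym T" and re: "refl_on P T"
    using assms(2) by (auto simp: equiv_def)
  have "(x, y) \<in> (E \<union> E\<inverse>)\<^sup>* \<Longrightarrow> x \<in> P \<Longrightarrow> (x, y) \<in> T" for x y
  proof (induction rule: rtrancl_induct)
    case base
    then show ?case using re by (auto simp: refl_on_def)
  next
    case (step y z)
    then have "(y, z) \<in> T" using assms(1) sy by (auto simp: sym_def)
    then show ?case using step tr by (auto simp: trans_def)
  qed
  then show ?thesis by (auto simp: eqcl_def)
qed

lemma eqcl_subset_eqcl: "E \<subseteq> eqcl P E' \<Longrightarrow> eqcl P E \<subseteq> eqcl P E'"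
  by (rule eqcl_least[OF _ equiv_eqcl])

lemma edges_subset_eqcl: "E \<subseteq> P \<times> P \<Longrightarrow> E \<subseteq> eqcl P E"
  by (auto intro: eqcl_edge)

lemma eqcl_mono: "E \<subseteq> E' \<Longrightarrow> eqcl P E \<subseteq> eqcl P E'"
  unfolding eqcl_def by (intro Int_mono rtrancl_mono) auto

lemma finite_quot: "finite P \<Longrightarrow> finite (P // eqcl P E)"
  by (rule finite_quotient) (auto simp: eqcl_def)

lemma ncomp_antimono:
  assumes "finite P" "E \<subseteq> eqcl P E'"
  shows "ncomp P E' \<le> ncomp P E"
  unfolding ncomp_def
  using finite_refines_card_le[OF finite_quot eqcl_subset_eqcl equiv_eqcl equiv_eqcl] assms by blast

text \<open>
  Adding edges that merge two classes removes at least one component. Together with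
  \<open>ncomp_antimono\<close> and \<open>ncomp_insert_ge\<close> this is all that is used about component counts in the
  inequalities below.
\<close>

lemma ncomp_strict:
  assumes fin: "finite P" and sub: "E \<subseteq> eqcl P E'"
    and ab: "(a, b) \<in> eqcl P E'" "(a, b) \<notin> eqcl P E"
  shows "ncomp P E' + 1 \<le> ncomp P E"
proof -
  let ?R = "eqcl P E" and ?S = "eqcl P E'"
  have RS: "?R \<subseteq> ?S" by (rule eqcl_subset_eqcl[OF sub])
  have aP: "a \<in> P" "b \<in> P" using eqcl_in[OF ab(1)] by auto
  have key: "?S `` (?R `` {x}) = ?S `` {x}" if "x \<in> P" for x
  proof -
    have "(x, x) \<in> ?R" using that by (rule eqcl_refl)
    then show ?thesis using RS eqcl_trans[of _ _ P E'] by blast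
  qed
  have "P // ?S \<subseteq> (\<lambda>C. ?S `` C) ` (P // ?R - {?R `` {a}})"
  proof
    fix X assume "X \<in> P // ?S"
    then obtain x where x: "x \<in> P" "X = ?S `` {x}" by (auto simp: quotient_def)
    show "X \<in> (\<lambda>C. ?S `` C) ` (P // ?R - {?R `` {a}})"
    proof (cases "?R `` {x} = ?R `` {a}")
      case False
      then show ?thesis using x key by (auto simp: quotient_def intro!: image_eqI[of _ _ "?R `` {x}"])
    next
      case True
      then have "(a, x) \<in> ?R" using eqcl_refl[OF x(1), of E] by auto
      then have "(x, b) \<in> ?S" using RS ab(1) eqcl_trans eqcl_sym by (metis subsetD)
      then have 1: "X = ?S `` {b}" using x equiv_class_eq[OF equiv_eqcl] by metis
      have "?R `` {b} \<noteq> ?R `` {a}" using ab(2) eqcl_refl[OF aP(2), of E] by auto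
      then show ?thesis using aP key 1 by (auto simp: quotient_def intro!: image_eqI[of _ _ "?R `` {b}"])
    qed
  qed
  then have "card (P // ?S) \<le> card (P // ?R - {?R `` {a}})"
    using finite_quot[OF fin] by (meson card_image_le card_mono finite_Diff finite_imageI le_trans)
  moreover have "?R `` {a} \<in> P // ?R" using aP by (auto simp: quotient_def)
  ultimately have "card (P // ?S) \<le> card (P // ?R) - 1" "card (P // ?R) > 0"
    using finite_quot[OF fin] by (auto simp: card_gt_0_iff)
  then show ?thesis unfolding ncomp_def by linarith
qed

text \<open>
  A path through the new edge can be cut at its first and last passage through it.
\<close>

lemma eqcl_insert:
  assumes "(a, b) \<in> P \<times> P" "(x, y) \<in> eqcl P (insert (a, b) E)"
  shows "(x, y) \<in> eqcl P E \<or> ((x, a) \<in> eqcl P E \<and> (b, y) \<in> eqcl P E)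
      \<or> ((x, b) \<in> eqcl P E \<and> (a, y) \<in> eqcl P E)"
proof -
  have "(x, y) \<in> (insert (a, b) E \<union> (insert (a, b) E)\<inverse>)\<^sup>*" "x \<in> P" "y \<in> P"
    using assms(2) by (auto simp: eqcl_def)
  let ?R = "(E \<union> E\<inverse>)\<^sup>*"
  have "(x, y) \<in> ?R \<or> ((x, a) \<in> ?R \<and> (b, y) \<in> ?R) \<or> ((x, b) \<in> ?R \<and> (a, y) \<in> ?R)"
    using \<open>(x, y) \<in> (insert (a, b) E \<union> (insert (a, b) E)\<inverse>)\<^sup>*\<close>
  proof (induction rule: rtrancl_induct)
    case (step y z)
    have "(y, z) \<in> E \<union> E\<inverse> \<or> (y = a \<and> z = b) \<or> (y = b \<and> z = a)" using step(2) by auto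
    then show ?case
    proof (elim disjE conjE)
      assume "(y, z) \<in> E \<union> E\<inverse>"
      then show ?thesis using step(3) by (meson rtrancl.rtrancl_into_rtrancl)
    qed (use step(3) in auto)
  qed auto
  then show ?thesis using \<open>x \<in> P\<close> \<open>y \<in> P\<close> assms(1) by (auto simp: eqcl_def)
qed

lemma ncomp_insert_ge:
  assumes fin: "finite P" and ab: "a \<in> P" "b \<in> P"
  shows "ncomp P E \<le> ncomp P (insert (a, b) E) + 1"
proof -
  let ?R = "eqcl P E" and ?S = "eqcl P (insert (a, b) E)"
  have RS: "?R \<subseteq> ?S" by (rule eqcl_mono) auto
  have key: "?S `` (?R `` {x}) = ?S `` {x}" if "x \<in> P" for x
  proof -
    have "(x, x) \<in> ?R" using that by (rule eqcl_refl)
    then show ?thesis using RS eqcl_trans[of _ _ P "insert (a, b) E"] by blast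
  qed
  have "inj_on (\<lambda>C. ?S `` C) (P // ?R - {?R `` {b}})"
  proof (rule inj_onI)
    fix X Y assume XY: "X \<in> P // ?R - {?R `` {b}}" "Y \<in> P // ?R - {?R `` {b}}" "?S `` X = ?S `` Y"
    then obtain x y where x: "x \<in> P" "X = ?R `` {x}" and y: "y \<in> P" "Y = ?R `` {y}"
      by (auto simp: quotient_def)
    have "(x, y) \<in> ?S" using XY(3) x y key eqcl_refl[OF y(1)] by auto
    moreover have "(x, b) \<notin> ?R" "(b, y) \<notin> ?R"
      using XY x y equiv_class_eq[OF equiv_eqcl] eqcl_sym by (metis Diff_iff singletonI)+
    ultimately have "(x, y) \<in> ?R" using eqcl_insert[of a b P x y E] ab by auto
    then show "X = Y" using x y equiv_class_eq[OF equiv_eqcl] by metis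
  qed
  moreover have "(\<lambda>C. ?S `` C) ` (P // ?R - {?R `` {b}}) \<subseteq> P // ?S"
    using key by (auto simp: quotient_def)
  ultimately have "card (P // ?R - {?R `` {b}}) \<le> card (P // ?S)"
    using card_inj_on_le finite_quot[OF fin] by metis
  then have "card (P // ?R) - 1 \<le> card (P // ?S)"
    using ab by (subst (asm) card_Diff_singleton) (auto simp: quotient_def)
  then show ?thesis unfolding ncomp_def by linarith
qed

text \<open>
  The function \<open>A \<mapsto> card P - ncomp P A\<close> is the rank function of the graphic matroid. The edges of
  \<open>B\<close> are added one at a time: an edge that joins two components of the larger graph
  \<open>A \<union> B \<union> C\<close> also joins two components of \<open>A \<union> B\<close>.
\<close>

lemma ncomp_submodular:
  assumes fin: "finite P" and B: "finite B" "B \<subseteq> P \<times> P"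
    and AC: "A \<subseteq> P \<times> P" "C \<subseteq> P \<times> P"
  shows "ncomp P (A \<union> B) + ncomp P (A \<union> C) \<le> ncomp P A + ncomp P (A \<union> B \<union> C)"
  using B
proof (induction B rule: finite_induct)
  case empty
  then show ?case by simp
next
  case (insert e B)
  obtain a b where e: "e = (a, b)" by (cases e)
  have ab: "a \<in> P" "b \<in> P" using insert.prems e by auto
  have sub: "A \<union> B \<subseteq> P \<times> P" "A \<union> B \<union> C \<subseteq> P \<times> P" using insert.prems AC by auto
  have IH: "ncomp P (A \<union> B) + ncomp P (A \<union> C) \<le> ncomp P A + ncomp P (A \<union> B \<union> C)"
    using insert by auto
  have mono: "A \<union> B \<subseteq> eqcl P (A \<union> insert e B)" "A \<union> insert e B \<subseteq> eqcl P (A \<union> insert e B)"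
    using edges_subset_eqcl[of "A \<union> insert e B" P] AC insert.prems by auto
  show ?case
  proof (cases "(a, b) \<in> eqcl P (A \<union> B)")
    case True
    then have "(a, b) \<in> eqcl P (A \<union> B \<union> C)" using eqcl_mono[of "A \<union> B" "A \<union> B \<union> C" P] by auto
    then have "ncomp P (A \<union> B \<union> C) \<le> ncomp P (A \<union> insert e B \<union> C)"
      using e edges_subset_eqcl[OF sub(2)] by (intro ncomp_antimono[OF fin]) auto
    moreover have "ncomp P (A \<union> insert e B) \<le> ncomp P (A \<union> B)"
      using mono by (intro ncomp_antimono[OF fin]) auto
    ultimately show ?thesis using IH by linarith
  next
    case False
    have "ncomp P (A \<union> insert e B) + 1 \<le> ncomp P (A \<union> B)"
      by (rule ncomp_strict[OF fin mono(1) _ False]) (use mono e in auto)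
    moreover have "ncomp P (A \<union> B \<union> C) \<le> ncomp P (insert (a, b) (A \<union> B \<union> C)) + 1"
      by (rule ncomp_insert_ge[OF fin ab])
    ultimately show ?thesis using IH e by simp
  qed
qed

text \<open>
  An index that is constant along the edges is one free choice per component. This is how powers of
  \<open>n\<close> and \<open>d\<close> arise in the index sums.
\<close>

lemma card_invariant_functions:
  assumes fin: "finite P" and E: "E \<subseteq> P \<times> P"
  shows "card {s \<in> P \<rightarrow>\<^sub>E A. \<forall>(x, y)\<in>E. s x = s y} = card A ^ ncomp P E"
proof -
  let ?R = "eqcl P E"
  let ?I = "{s \<in> P \<rightarrow>\<^sub>E A. \<forall>(x, y)\<in>E. s x = s y}"
  have const: "s x = s y" if s: "s \<in> ?I" and xy: "(x, y) \<in> ?R" for s x y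
  proof -
    have "(x, y) \<in> (E \<union> E\<inverse>)\<^sup>*" using xy by (auto simp: eqcl_def)
    then show ?thesis by (induction rule: rtrancl_induct) (use s in auto)
  qed
  have "bij_betw (\<lambda>f. \<lambda>x\<in>P. f (?R `` {x})) ((P // ?R) \<rightarrow>\<^sub>E A) ?I"
  proof (rule bij_betw_byWitness[where f' = "\<lambda>s. \<lambda>C\<in>P // ?R. s (SOME x. x \<in> C)"])
    show "\<forall>f\<in>(P // ?R) \<rightarrow>\<^sub>E A. (\<lambda>C\<in>P // ?R. (\<lambda>x\<in>P. f (?R `` {x})) (SOME x. x \<in> C)) = f"
    proof
      fix f assume f: "f \<in> (P // ?R) \<rightarrow>\<^sub>E A"
      show "(\<lambda>C\<in>P // ?R. (\<lambda>x\<in>P. f (?R `` {x})) (SOME x. x \<in> C)) = f"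
      proof
        fix C
        show "(\<lambda>C\<in>P // ?R. (\<lambda>x\<in>P. f (?R `` {x})) (SOME x. x \<in> C)) C = f C"
        proof (cases "C \<in> P // ?R")
          case True
          then obtain x where x: "x \<in> P" "C = ?R `` {x}" by (auto simp: quotient_def)
          then have "x \<in> C" by (auto intro: eqcl_refl)
          then have c: "(SOME x. x \<in> C) \<in> C" by (rule someI)
          then have "(x, SOME x. x \<in> C) \<in> ?R" using x by auto
          then have "?R `` {SOME x. x \<in> C} = C" "(SOME x. x \<in> C) \<in> P"
            using x equiv_class_eq[OF equiv_eqcl] eqcl_in by metis+
          then show ?thesis using True by simp
        next
          case False
          then show ?thesis using f by (auto simp: PiE_def extensional_def)
        qed
      qed
    qed
    show "\<forall>s\<in>?I. (\<lambda>x\<in>P. (\<lambda>C\<in>P // ?R. s (SOME x. x \<in> C)) (?R `` {x})) = s"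
    proof
      fix s assume s: "s \<in> ?I"
      show "(\<lambda>x\<in>P. (\<lambda>C\<in>P // ?R. s (SOME x. x \<in> C)) (?R `` {x})) = s"
      proof
        fix x
        show "(\<lambda>x\<in>P. (\<lambda>C\<in>P // ?R. s (SOME x. x \<in> C)) (?R `` {x})) x = s x"
        proof (cases "x \<in> P")
          case True
          then have "x \<in> ?R `` {x}" by (auto intro: eqcl_refl)
          then have "(SOME z. z \<in> ?R `` {x}) \<in> ?R `` {x}" by (rule someI)
          then have "s x = s (SOME z. z \<in> ?R `` {x})" using const[OF s] by blast
          then show ?thesis using True by (simp add: quotientI)
        next
          case False
          then show ?thesis using s by (auto simp: PiE_def extensional_def)
        qed
      qed
    qed
    show "(\<lambda>f. \<lambda>x\<in>P. f (?R `` {x})) ` ((P // ?R) \<rightarrow>\<^sub>E A) \<subseteq> ?I"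
    proof (rule image_subsetI)
      fix f assume f: "f \<in> (P // ?R) \<rightarrow>\<^sub>E A"
      have "(\<lambda>x\<in>P. f (?R `` {x})) x = (\<lambda>x\<in>P. f (?R `` {x})) y" if e: "(x, y) \<in> E" for x y
      proof -
        have xy: "x \<in> P" "y \<in> P" using e E by auto
        have "?R `` {x} = ?R `` {y}" by (rule equiv_class_eq[OF equiv_eqcl eqcl_edge[OF e xy]])
        then show ?thesis using xy by simp
      qed
      moreover have "(\<lambda>x\<in>P. f (?R `` {x})) \<in> P \<rightarrow>\<^sub>E A"
        using f by (intro restrict_PiE_iff[THEN iffD2] ballI) (auto intro: quotientI PiE_mem)
      ultimately show "(\<lambda>x\<in>P. f (?R `` {x})) \<in> ?I" by blast
    qed
    show "(\<lambda>s. \<lambda>C\<in>P // ?R. s (SOME x. x \<in> C)) ` ?I \<subseteq> (P // ?R) \<rightarrow>\<^sub>E A"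
    proof (rule image_subsetI)
      fix s assume s: "s \<in> ?I"
      have "(SOME x. x \<in> C) \<in> P" if C: "C \<in> P // ?R" for C
      proof -
        obtain x where x: "x \<in> P" "C = ?R `` {x}" using C by (auto simp: quotient_def)
        then have "x \<in> C" by (auto intro: eqcl_refl)
        then have "(SOME x. x \<in> C) \<in> C" by (rule someI)
        then show ?thesis using x eqcl_in by auto
      qed
      then show "(\<lambda>C\<in>P // ?R. s (SOME x. x \<in> C)) \<in> (P // ?R) \<rightarrow>\<^sub>E A"
        using s by (auto simp: PiE_def Pi_def)
    qed
  qed
  then have "card ?I = card ((P // ?R) \<rightarrow>\<^sub>E A)" by (simp add: bij_betw_same_card)
  also have "\<dots> = card A ^ ncomp P E"
    unfolding ncomp_def using finite_quot[OF fin] by (simp add: card_funcsetE)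
  finally show ?thesis .
qed

section \<open>The genus inequality\<close>

lemma graph_on_subset: "f permutes P \<Longrightarrow> graph_on P f \<subseteq> P \<times> P"
  by (auto simp: graph_on_def permutes_in_image)

lemma eqcl_graph_perm:
  assumes "finite P" "\<sigma> permutes P"
  shows "eqcl P (graph_on P \<sigma>) = {(x, y). x \<in> P \<and> y \<in> orbit \<sigma> x}"
proof -
  have perm: "permutation \<sigma>" using assms permutation_permutes by blast
  have 1: "y \<in> orbit \<sigma> x" if "(x, y) \<in> (graph_on P \<sigma> \<union> (graph_on P \<sigma>)\<inverse>)\<^sup>*" for x y
    using that
  proof (induction rule: rtrancl_induct)
    case base
    show ?case using perm by (rule permutation_self_in_orbit)
  next
    case (step y z)
    then consider "z = \<sigma> y" | "y = \<sigma> z" by (auto simp: graph_on_def)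
    then show ?case
    proof cases
      case 1
      then show ?thesis using step by (auto intro: orbit.step)
    next
      case 2
      have "z \<in> orbit \<sigma> z" using perm by (rule permutation_self_in_orbit)
      then have "z \<in> orbit \<sigma> y" using permutation_orbit_step[OF perm, of z] 2 by simp
      then show ?thesis using step orbit_trans by metis
    qed
  qed
  have 2: "(x, y) \<in> eqcl P (graph_on P \<sigma>)" if "x \<in> P" "y \<in> orbit \<sigma> x" for x y
    using that(2)
  proof induction
    case base
    then show ?case using that assms by (auto intro!: eqcl_edge simp: graph_on_def permutes_in_image)
  next
    case (step y)
    then have "(y, \<sigma> y) \<in> eqcl P (graph_on P \<sigma>)"
      using assms eqcl_in(2)[OF step(2)] by (auto intro!: eqcl_edge simp: graph_on_def permutes_in_image)
    then show ?case using step eqcl_trans by metis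
  qed
  show ?thesis using 1 2 by (auto simp: eqcl_def)
qed

lemma graph_comp_transposition:
  assumes "\<sigma> permutes P" "a \<in> P" "c \<in> P"
  shows "graph_on P (\<sigma> \<circ> Transposition.transpose a c) \<subseteq> eqcl P (insert (a, c) (graph_on P \<sigma>))"
proof
  fix e assume "e \<in> graph_on P (\<sigma> \<circ> Transposition.transpose a c)"
  then obtain x where x: "x \<in> P" "e = (x, \<sigma> (Transposition.transpose a c x))" by (auto simp: graph_on_def)
  let ?E = "insert (a, c) (graph_on P \<sigma>)"
  have "(a, c) \<in> eqcl P ?E" using assms by (auto intro: eqcl_edge)
  then have "(x, Transposition.transpose a c x) \<in> eqcl P ?E"
    using x eqcl_refl[OF x(1), of ?E] eqcl_sym[of a c]
    by (cases "x = a"; cases "x = c") (simp_all add: transpose_apply_other)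
  moreover have "Transposition.transpose a c x \<in> P"
    using assms x by (cases "x = a"; cases "x = c") (simp_all add: transpose_apply_other)
  then have "(Transposition.transpose a c x, \<sigma> (Transposition.transpose a c x)) \<in> eqcl P ?E"
    using assms(1) by (intro eqcl_edge) (simp_all add: graph_on_def permutes_in_image)
  ultimately show "e \<in> eqcl P ?E" using x eqcl_trans by metis
qed

text \<open>
  If \<open>a\<close> and \<open>c\<close> lie on different cycles of \<open>\<sigma>\<close>, then \<open>\<sigma> \<circ> (a c)\<close> sends \<open>a\<close> once around the cycle
  of \<open>c\<close>, so it has both on one cycle.
\<close>

lemma transposition_merges:
  assumes "finite P" "\<sigma> permutes P" "a \<in> P" "c \<in> P" "(a, c) \<notin> eqcl P (graph_on P \<sigma>)"
  shows "(a, c) \<in> eqcl P (graph_on P (\<sigma> \<circ> Transposition.transpose a c))"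
proof -
  let ?t = "\<sigma> \<circ> Transposition.transpose a c"
  have perm: "permutation \<sigma>" using assms permutation_permutes by blast
  have tp: "?t permutes P" using assms by (intro permutes_compose permutes_swap_id)
  have "(c, a) \<notin> eqcl P (graph_on P \<sigma>)" using assms(5) eqcl_sym[of c a] by auto
  then have ac: "a \<notin> orbit \<sigma> c" using assms(4) by (simp add: eqcl_graph_perm[OF assms(1,2)])
  have "y \<in> orbit ?t a" if "y \<in> orbit \<sigma> c" for y
    using that
  proof induction
    case base
    have "\<sigma> c = ?t a" by simp
    then show ?case by (metis orbit.base)
  next
    case (step y)
    then have "y \<noteq> a" using ac by auto
    show ?case
    proof (cases "y = c")
      case True
      then have "\<sigma> y = ?t a" by simp
      then show ?thesis by (metis orbit.base)
    next
      case False
      then have "\<sigma> y = ?t y" using \<open>y \<noteq> a\<close> by simp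
      then show ?thesis using step by (metis orbit.step)
    qed
  qed
  then have "c \<in> orbit ?t a" using permutation_self_in_orbit[OF perm] by auto
  then show ?thesis using assms eqcl_graph_perm[OF assms(1) tp] by auto
qed

lemma ncomp_id: "finite P \<Longrightarrow> ncomp P (graph_on P id) = card P"
proof -
  assume fin: "finite P"
  have "eqcl P (graph_on P id) = Id_on P"
    using eqcl_least[of "graph_on P id" "Id_on P" P] equiv_eqcl[of P "graph_on P id"]
    by (auto simp: graph_on_def equiv_def refl_on_def sym_def trans_def)
  then have "P // eqcl P (graph_on P id) = (\<lambda>x. {x}) ` P" by (auto simp: quotient_def)
  then show ?thesis by (simp add: ncomp_def card_image)
qed

text \<open>
  This is the nonnegativity of the genus of a constellation of three permutations with product \<open>1\<close>.
  The induction removes a point \<open>a\<close> from the support of \<open>\<beta>\<close> by cutting it out of its cycle with a transposition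
  \<open>(a c)\<close>. This gains a cycle of \<open>\<beta>\<close> and changes the number of cycles of \<open>\<alpha> \<circ> \<beta>\<close> by at most one. If the cut
  disconnects \<open>a\<close> from \<open>c\<close>, one more component appears on the right, but then \<open>a\<close> and \<open>c\<close> are also on
  different cycles of the new product, so that its number of cycles has grown as well.
\<close>

theorem genus_inequality:
  assumes fin: "finite P" and \<alpha>: "\<alpha> permutes P" and "\<beta> permutes P"
  shows "ncomp P (graph_on P \<alpha>) + ncomp P (graph_on P \<beta>) + ncomp P (graph_on P (\<alpha> \<circ> \<beta>))
      \<le> card P + 2 * ncomp2 P \<alpha> \<beta>"
  using assms(3)
proof (induction "card {x \<in> P. \<beta> x \<noteq> x}" arbitrary: \<beta> rule: less_induct)
  case less
  show ?case
  proof (cases "\<forall>x\<in>P. \<beta> x = x")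
    case True
    then have id: "\<beta> = id" using less.prems by (auto simp: permutes_def fun_eq_iff)
    have "graph_on P id \<subseteq> eqcl P (graph_on P \<alpha>)" by (auto simp: graph_on_def eqcl_refl)
    then have "ncomp P (graph_on P \<alpha>) \<le> ncomp2 P \<alpha> \<beta>"
      using id edges_subset_eqcl[OF graph_on_subset[OF \<alpha>]]
      by (intro ncomp_antimono[OF fin]) auto
    then show ?thesis using id ncomp_id[OF fin] by simp
  next
    case False
    then obtain a where a: "a \<in> P" "\<beta> a \<noteq> a" by auto
    \<comment> \<open>Composing with \<open>(a c)\<close> makes \<open>a\<close> a fixed point, since \<open>\<beta> c = a\<close>.\<close>
    define c where "c = inv_into UNIV \<beta> a"
    have bc: "\<beta> c = a" using less.prems permutes_inverses(1) c_def by metis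
    have cP: "c \<in> P" using bc a less.prems permutes_in_image by metis
    have ca: "c \<noteq> a" using bc a by auto
    define \<beta>' where "\<beta>' = \<beta> \<circ> Transposition.transpose a c"
    have bk: "\<beta> = \<beta>' \<circ> Transposition.transpose a c" "\<alpha> \<circ> \<beta> = (\<alpha> \<circ> \<beta>') \<circ> Transposition.transpose a c"
        "\<alpha> \<circ> \<beta>' = (\<alpha> \<circ> \<beta>) \<circ> Transposition.transpose a c"
      by (auto simp: \<beta>'_def fun_eq_iff)
    have p': "\<beta>' permutes P" unfolding \<beta>'_def
      using less.prems a cP by (intro permutes_compose permutes_swap_id)
    have fixa: "\<beta>' a = a" using bc by (simp add: \<beta>'_def)
    have "{x \<in> P. \<beta>' x \<noteq> x} \<subset> {x \<in> P. \<beta> x \<noteq> x}"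
    proof
      show "{x \<in> P. \<beta>' x \<noteq> x} \<subseteq> {x \<in> P. \<beta> x \<noteq> x}"
      proof
        fix x assume x: "x \<in> {x \<in> P. \<beta>' x \<noteq> x}"
        then have "x \<noteq> a" using fixa by auto
        then show "x \<in> {x \<in> P. \<beta> x \<noteq> x}"
          using x bc ca by (cases "x = c") (auto simp: \<beta>'_def transpose_apply_other)
      qed
      show "{x \<in> P. \<beta>' x \<noteq> x} \<noteq> {x \<in> P. \<beta> x \<noteq> x}" using fixa a by auto
    qed
    then have "card {x \<in> P. \<beta>' x \<noteq> x} < card {x \<in> P. \<beta> x \<noteq> x}"
      using fin by (intro psubset_card_mono) auto
    from less.hyps[OF this p']
    have IH: "ncomp P (graph_on P \<alpha>) + ncomp P (graph_on P \<beta>') + ncomp P (graph_on P (\<alpha> \<circ> \<beta>'))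
      \<le> card P + 2 * ncomp2 P \<alpha> \<beta>'" .
    have gs: "graph_on P \<alpha> \<subseteq> P \<times> P" "graph_on P \<beta> \<subseteq> P \<times> P" "graph_on P \<beta>' \<subseteq> P \<times> P"
      using \<alpha> less.prems p' by (auto dest: graph_on_subset)
    have ab: "\<alpha> \<circ> \<beta> permutes P" "\<alpha> \<circ> \<beta>' permutes P"
      using \<alpha> less.prems p' by (auto intro: permutes_compose)
    have ac_b: "(a, c) \<in> eqcl P (graph_on P \<beta>)"
      using bc cP a by (intro eqcl_sym[OF eqcl_edge]) (auto simp: graph_on_def)
    have "orbit \<beta>' a = {a}" using fixa orbit_eq_singleton_iff by metis
    then have ac_b': "(a, c) \<notin> eqcl P (graph_on P \<beta>')"
      using ca by (simp add: eqcl_graph_perm[OF fin p'])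
    have b'b: "graph_on P \<beta>' \<subseteq> eqcl P (graph_on P \<beta>)"
      using graph_comp_transposition[OF less.prems a(1) cP]
        eqcl_subset_eqcl[of "insert (a, c) (graph_on P \<beta>)" P "graph_on P \<beta>"]
        ac_b edges_subset_eqcl[OF gs(2)] unfolding \<beta>'_def by blast
    have c1: "ncomp P (graph_on P \<beta>) + 1 \<le> ncomp P (graph_on P \<beta>')"
      by (rule ncomp_strict[OF fin b'b ac_b ac_b'])
    let ?G = "graph_on P \<alpha> \<union> graph_on P \<beta>" and ?G' = "graph_on P \<alpha> \<union> graph_on P \<beta>'"
    show ?thesis
    proof (cases "(a, c) \<in> eqcl P ?G'")
      case True
      have "graph_on P \<beta> \<subseteq> eqcl P (insert (a, c) (graph_on P \<beta>'))"
        using graph_comp_transposition[OF p' a(1) cP] bk by simp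
      also have "\<dots> \<subseteq> eqcl P ?G'"
        using True edges_subset_eqcl[of ?G' P] gs by (intro eqcl_subset_eqcl) auto
      finally have "ncomp P ?G' \<le> ncomp P ?G"
        using edges_subset_eqcl[of ?G' P] gs by (intro ncomp_antimono[OF fin]) auto
      moreover have "ncomp P (insert (a, c) (graph_on P (\<alpha> \<circ> \<beta>))) \<le> ncomp P (graph_on P (\<alpha> \<circ> \<beta>'))"
        using graph_comp_transposition[OF ab(1) a(1) cP] bk by (intro ncomp_antimono[OF fin]) simp
      moreover have "ncomp P (graph_on P (\<alpha> \<circ> \<beta>)) \<le> ncomp P (insert (a, c) (graph_on P (\<alpha> \<circ> \<beta>))) + 1"
        by (rule ncomp_insert_ge[OF fin a(1) cP])
      ultimately show ?thesis using IH c1 by linarith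
    next
      case False
      have "graph_on P (\<alpha> \<circ> \<beta>') \<subseteq> eqcl P ?G'"
      proof
        fix e assume "e \<in> graph_on P (\<alpha> \<circ> \<beta>')"
        then obtain x where x: "x \<in> P" "e = (x, \<alpha> (\<beta>' x))" by (auto simp: graph_on_def)
        have "(x, \<beta>' x) \<in> eqcl P ?G'" "(\<beta>' x, \<alpha> (\<beta>' x)) \<in> eqcl P ?G'"
          using x \<alpha> p' by (auto intro!: eqcl_edge simp: graph_on_def permutes_in_image)
        then show "e \<in> eqcl P ?G'" using x eqcl_trans by metis
      qed
      then have nac: "(a, c) \<notin> eqcl P (graph_on P (\<alpha> \<circ> \<beta>'))"
        using False eqcl_subset_eqcl by blast
      have ac: "(a, c) \<in> eqcl P (graph_on P (\<alpha> \<circ> \<beta>))"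
        using transposition_merges[OF fin ab(2) a(1) cP nac] bk by simp
      have "graph_on P (\<alpha> \<circ> \<beta>') \<subseteq> eqcl P (insert (a, c) (graph_on P (\<alpha> \<circ> \<beta>)))"
        using graph_comp_transposition[OF ab(1) a(1) cP] bk by simp
      also have "\<dots> \<subseteq> eqcl P (graph_on P (\<alpha> \<circ> \<beta>))"
        using ac edges_subset_eqcl[OF graph_on_subset[OF ab(1)]] by (intro eqcl_subset_eqcl) auto
      finally have "ncomp P (graph_on P (\<alpha> \<circ> \<beta>)) + 1 \<le> ncomp P (graph_on P (\<alpha> \<circ> \<beta>'))"
        by (rule ncomp_strict[OF fin _ ac nac])
      moreover have "ncomp P ?G' \<le> ncomp P (insert (a, c) ?G') + 1"
        by (rule ncomp_insert_ge[OF fin a(1) cP])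
      moreover have "ncomp P (insert (a, c) ?G') \<le> ncomp P ?G"
      proof (rule ncomp_antimono[OF fin])
        have "graph_on P \<beta> \<subseteq> eqcl P (insert (a, c) (graph_on P \<beta>'))"
          using graph_comp_transposition[OF p' a(1) cP] bk by simp
        also have "\<dots> \<subseteq> eqcl P (insert (a, c) ?G')" by (rule eqcl_mono) auto
        finally show "?G \<subseteq> eqcl P (insert (a, c) ?G')"
          using edges_subset_eqcl[of "insert (a, c) ?G'" P] gs a cP by auto
      qed
      ultimately show ?thesis using IH c1 by linarith
    qed
  qed
qed

section \<open>Pairings\<close>

text \<open>
  Pairings are encoded as fixed-point free involutions of \<open>P\<close>, extended by the identity outside \<open>P\<close>;
  this makes each of them a unique function and a permutation.
\<close>

definition pairings :: "'a set \<Rightarrow> ('a \<Rightarrow> 'a) set" where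
  "pairings P = {\<tau>. \<tau> permutes P \<and> (\<forall>x\<in>P. \<tau> x \<noteq> x \<and> \<tau> (\<tau> x) = x)}"

lemma pairingsD:
  assumes "\<tau> \<in> pairings P"
  shows "\<tau> permutes P" "x \<in> P \<Longrightarrow> \<tau> x \<in> P" "x \<in> P \<Longrightarrow> \<tau> x \<noteq> x" "\<tau> (\<tau> x) = x"
    "x \<notin> P \<Longrightarrow> \<tau> x = x" "\<tau> x \<in> P \<longleftrightarrow> x \<in> P"
proof -
  show p: "\<tau> permutes P" using assms by (auto simp: pairings_def)
  show "x \<in> P \<Longrightarrow> \<tau> x \<in> P" "\<tau> x \<in> P \<longleftrightarrow> x \<in> P" using p by (auto simp: permutes_in_image)
  show "x \<in> P \<Longrightarrow> \<tau> x \<noteq> x" using assms by (auto simp: pairings_def)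
  show o: "x \<notin> P \<Longrightarrow> \<tau> x = x" using p by (auto simp: permutes_def)
  show "\<tau> (\<tau> x) = x" using assms o by (cases "x \<in> P") (auto simp: pairings_def)
qed

lemma finite_pairings: "finite P \<Longrightarrow> finite (pairings P)"
  by (rule finite_subset[OF _ finite_permutations]) (auto simp: pairings_def)

lemma ncomp_pairing:
  assumes "finite P" "\<tau> \<in> pairings P"
  shows "2 * ncomp P (graph_on P \<tau>) = card P"
proof -
  note t = pairingsD[OF assms(2)]
  let ?R = "{(x, y) \<in> P \<times> P. y = x \<or> y = \<tau> x}"
  have "equiv P ?R" by (rule equivI) (auto simp: refl_on_def sym_def trans_def t(4))
  then have "eqcl P (graph_on P \<tau>) \<subseteq> ?R"
    by (rule eqcl_least[rotated]) (auto simp: graph_on_def t(2))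
  moreover have "?R \<subseteq> eqcl P (graph_on P \<tau>)"
    using eqcl_refl[of _ P "graph_on P \<tau>"] eqcl_edge[of _ "\<tau> _" "graph_on P \<tau>" P] t(2)
    by (fastforce simp: graph_on_def)
  ultimately have R: "eqcl P (graph_on P \<tau>) = ?R" by auto
  have cl: "?R `` {x} = {x, \<tau> x}" if "x \<in> P" for x using that t by auto
  have un: "\<Union> (P // ?R) = P" by (rule Union_quotient) (rule \<open>equiv P ?R\<close>)
  have "2 * card (P // ?R) = card (\<Union> (P // ?R))"
  proof (rule card_partition)
    show "finite (P // ?R)" using finite_quot[OF assms(1)] R by metis
    show "finite (\<Union> (P // ?R))" using un assms(1) by simp
    show "card c = 2" if c: "c \<in> P // ?R" for c
    proof -
      obtain x where x: "x \<in> P" "c = ?R `` {x}" using c by (rule quotientE)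
      have "c = {x, \<tau> x}" using x cl by simp
      then show ?thesis using t(3)[OF x(1)] by simp
    qed
    show "c1 \<inter> c2 = {}" if "c1 \<in> P // ?R" "c2 \<in> P // ?R" "c1 \<noteq> c2" for c1 c2
      using quotient_disj[OF \<open>equiv P ?R\<close> that(1,2)] that(3) by auto
  qed
  then show ?thesis unfolding ncomp_def R un by simp
qed

lemma card_quotient_le_twice:
  assumes fin: "finite P" and R: "equiv P R" and S: "equiv P S"
    and cov: "\<And>x y. (x, y) \<in> S \<Longrightarrow> (x, y) \<in> R \<or> (f x, y) \<in> R"
  shows "card (P // R) \<le> 2 * card (P // S)"
proof -
  define r where "r C = (SOME x. x \<in> C)" for C :: "'a set"
  have r: "r C \<in> C" "C = S `` {r C}" if "C \<in> P // S" for C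
  proof -
    have "C \<noteq> {}" using that S by (metis in_quotient_imp_non_empty)
    then show 1: "r C \<in> C" unfolding r_def by (meson ex_in_conv someI_ex)
    obtain x where x: "x \<in> P" "C = S `` {x}" using \<open>C \<in> P // S\<close> by (rule quotientE)
    then have "(x, r C) \<in> S" using 1 by auto
    from equiv_class_eq[OF S this] show "C = S `` {r C}" using x(2) by simp
  qed
  have "P // R \<subseteq> (\<Union>C\<in>P // S. {R `` {r C}, R `` {f (r C)}})"
  proof
    fix X assume "X \<in> P // R"
    then obtain x where x: "x \<in> P" "X = R `` {x}" by (rule quotientE)
    let ?C = "S `` {x}"
    have C: "?C \<in> P // S" using x by (auto simp: quotient_def)
    have "x \<in> ?C" using S x by (auto simp: equiv_def refl_on_def)
    then have "(r ?C, x) \<in> S" using r(2)[OF C] by auto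
    from cov[OF this] have "X = R `` {r ?C} \<or> X = R `` {f (r ?C)}"
      using x equiv_class_eq[OF R] by metis
    then show "X \<in> (\<Union>C\<in>P // S. {R `` {r C}, R `` {f (r C)}})" using C by blast
  qed
  moreover have finS: "finite (P // S)" using fin S by (metis equivE finite_quotient)
  ultimately have "card (P // R) \<le> card (\<Union>C\<in>P // S. {R `` {r C}, R `` {f (r C)}})"
    by (intro card_mono) auto
  also have "\<dots> \<le> (\<Sum>C\<in>P // S. card {R `` {r C}, R `` {f (r C)}})"
    by (rule card_UN_le[OF finS])
  also have "\<dots> \<le> (\<Sum>C\<in>P // S. 2)"
    by (intro sum_mono) (simp add: card_insert_if)
  finally show ?thesis by simp
qed

lemma twice_card_quotient_le:
  assumes fin: "finite P" and R: "equiv P R" and S: "equiv P S" and RS: "R \<subseteq> S"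
    and f: "\<And>x. x \<in> P \<Longrightarrow> (x, f x) \<in> S \<and> (x, f x) \<notin> R"
  shows "2 * card (P // S) \<le> card (P // R)"
proof -
  define r where "r C = (SOME x. x \<in> C)" for C :: "'a set"
  have r: "r C \<in> P" "C = S `` {r C}" if "C \<in> P // S" for C
  proof -
    have "C \<noteq> {}" using that S by (metis in_quotient_imp_non_empty)
    then have 1: "r C \<in> C" unfolding r_def by (meson ex_in_conv someI_ex)
    obtain x where x: "x \<in> P" "C = S `` {x}" using \<open>C \<in> P // S\<close> by (rule quotientE)
    then have "(x, r C) \<in> S" using 1 by auto
    from equiv_class_eq[OF S this] show "C = S `` {r C}" using x(2) by simp
    show "r C \<in> P" using 1 that S by (meson in_quotient_imp_subset subsetD)
  qed
  define g where "g = (\<lambda>(C, b). R `` {if b then r C else f (r C)})"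
  have fP: "f x \<in> P" if "x \<in> P" for x using f[OF that] S by (auto simp: equiv_def)
  have "inj_on g ((P // S) \<times> UNIV)"
  proof (rule inj_onI)
    fix p q :: "'a set \<times> bool"
    assume pq: "p \<in> (P // S) \<times> UNIV" "q \<in> (P // S) \<times> UNIV" "g p = g q"
    obtain C b D c where p: "p = (C, b)" "q = (D, c)" by (cases p, cases q) auto
    have CD: "C \<in> P // S" "D \<in> P // S" using pq p by auto
    let ?x = "if b then r C else f (r C)" and ?y = "if c then r D else f (r D)"
    have xy: "?x \<in> P" "?y \<in> P" using r CD fP by auto
    have "(?x, ?y) \<in> R" using pq(3) p xy eq_equiv_class_iff[OF R] unfolding g_def by auto
    then have xyR: "(?x, ?y) \<in> R" "(?x, ?y) \<in> S" using RS by auto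
    have "(r C, ?x) \<in> S" "(r D, ?y) \<in> S"
      using f[OF r(1)[OF CD(1)]] f[OF r(1)[OF CD(2)]] equiv_class_self[OF S r(1)[OF CD(1)]]
        equiv_class_self[OF S r(1)[OF CD(2)]] by auto
    then have "(r C, r D) \<in> S" using xyR S by (meson equivE symE transE)
    then have "C = D" using r CD equiv_class_eq[OF S] by metis
    moreover have "b = c"
    proof (rule ccontr)
      assume "b \<noteq> c"
      then have "(r C, f (r C)) \<in> R \<or> (f (r C), r C) \<in> R"
        using xyR(1) \<open>C = D\<close> by (cases b; cases c) simp_all
      then have "(r C, f (r C)) \<in> R" using R by (meson equivE symE)
      then show False using f r CD by blast
    qed
    ultimately show "p = q" using p by simp
  qed
  moreover have "g ` ((P // S) \<times> UNIV) \<subseteq> P // R" 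
    by (auto simp: g_def intro!: quotientI r(1) fP)
  moreover have "finite (P // R)" using fin R by (metis equivE finite_quotient)
  ultimately have "card ((P // S) \<times> (UNIV :: bool set)) \<le> card (P // R)" by (rule card_inj_on_le)
  then show ?thesis by (simp add: card_cartesian_product)
qed

text \<open>
  Conjugation by \<open>\<delta>\<close> inverts \<open>\<delta> \<circ> \<tau>\<close>. If \<open>(\<delta> \<circ> \<tau>)\<^sup>n x = \<delta> x\<close>, then peeling off one factor
  at both ends gives the same equation with \<open>n - 2\<close> for \<open>\<delta> (\<tau> x)\<close>, and finally a
  fixed point of \<open>\<delta>\<close> or \<open>\<tau>\<close>. So every component of \<open>\<delta> \<union> \<tau>\<close> is made of two distinct cycles of
  \<open>\<delta> \<circ> \<tau>\<close>, which \<open>\<delta>\<close> interchanges.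
\<close>

lemma pairing_not_in_orbit:
  assumes "\<delta> \<in> pairings P" "\<tau> \<in> pairings P" "x \<in> P"
  shows "\<delta> x \<notin> orbit (\<delta> \<circ> \<tau>) x"
proof -
  note d = pairingsD[OF assms(1)] and t = pairingsD[OF assms(2)]
  have "((\<delta> \<circ> \<tau>) ^^ n) x \<noteq> \<delta> x" if "x \<in> P" for n x
    using that
  proof (induction n arbitrary: x rule: induct_nat_012)
    case 0
    then show ?case using d(3) by (metis funpow_0)
  next
    case 1
    then show ?case using t(3) d(4) by (metis comp_apply funpow_0 funpow_simps_right(2) o_apply)
  next
    case (ge2 n)
    show ?case
    proof
      assume a: "((\<delta> \<circ> \<tau>) ^^ Suc (Suc n)) x = \<delta> x"
      define w where "w = ((\<delta> \<circ> \<tau>) ^^ n) (\<delta> (\<tau> x))"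
      have "((\<delta> \<circ> \<tau>) ^^ Suc (Suc n)) x = \<delta> (\<tau> w)"
        unfolding w_def by (metis comp_apply funpow.simps(2) funpow_swap1)
      then have "\<tau> w = x" using a d(4) by metis
      then have "w = \<tau> x" using t(4) by metis
      then have "((\<delta> \<circ> \<tau>) ^^ n) (\<delta> (\<tau> x)) = \<delta> (\<delta> (\<tau> x))" using w_def d(4) by simp
      then show False using ge2(1)[of "\<delta> (\<tau> x)"] ge2(3) d(2) t(2) by auto
    qed
  qed
  note ne = this[OF assms(3)]
  show ?thesis
  proof
    assume "\<delta> x \<in> orbit (\<delta> \<circ> \<tau>) x"
    then obtain n where "\<delta> x = ((\<delta> \<circ> \<tau>) ^^ n) x" unfolding orbit_altdef by blast
    then show False using ne[of n] by simp
  qed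
qed

lemma ncomp_two_pairings:
  assumes "finite P" "\<delta> \<in> pairings P" "\<tau> \<in> pairings P"
  shows "2 * ncomp2 P \<delta> \<tau> \<le> ncomp P (graph_on P (\<delta> \<circ> \<tau>))"
  unfolding ncomp_def
proof (rule twice_card_quotient_le[OF assms(1) equiv_eqcl equiv_eqcl])
  note d = pairingsD[OF assms(2)] and t = pairingsD[OF assms(3)]
  let ?G = "graph_on P \<delta> \<union> graph_on P \<tau>"
  show "eqcl P (graph_on P (\<delta> \<circ> \<tau>)) \<subseteq> eqcl P ?G"
  proof (rule eqcl_subset_eqcl, rule subsetI)
    fix e assume "e \<in> graph_on P (\<delta> \<circ> \<tau>)"
    then obtain x where x: "x \<in> P" "e = (x, \<delta> (\<tau> x))" by (auto simp: graph_on_def)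
    have "(x, \<tau> x) \<in> eqcl P ?G" "(\<tau> x, \<delta> (\<tau> x)) \<in> eqcl P ?G"
      using x d t by (auto intro!: eqcl_edge simp: graph_on_def)
    then show "e \<in> eqcl P ?G" using x eqcl_trans by metis
  qed
  fix x assume x: "x \<in> P"
  have "\<delta> \<circ> \<tau> permutes P" using d t by (auto intro: permutes_compose)
  then have "(x, \<delta> x) \<notin> eqcl P (graph_on P (\<delta> \<circ> \<tau>))"
    using x pairing_not_in_orbit[OF assms(2,3) x] by (simp add: eqcl_graph_perm[OF assms(1)])
  moreover have "(x, \<delta> x) \<in> eqcl P ?G"
    using x d(2)[OF x] by (intro eqcl_edge) (simp_all add: graph_on_def)
  ultimately show "(x, \<delta> x) \<in> eqcl P ?G \<and> (x, \<delta> x) \<notin> eqcl P (graph_on P (\<delta> \<circ> \<tau>))" by simp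
qed

text \<open>
  The points and the pairs of the three pairings form a cubic graph. Gluing a disc onto every component of two
  of the pairings gives a closed surface, orientable or not, whose Euler characteristic is the sum of the three
  counts minus \<open>card P / 2\<close>; so this says that it is at most \<open>2\<close> on each component.
  The proof passes to the orientation cover: \<open>genus_inequality\<close> applies to the permutations \<open>\<delta> \<circ> \<tau>\<close> and
  \<open>\<tau> \<circ> \<epsilon>\<close>, whose product is \<open>\<delta> \<circ> \<epsilon>\<close>. Passing from pairings to these permutations doubles
  the counts on the left and at most doubles the number of components.
\<close>

theorem euler_inequality:
  assumes fin: "finite P" and "\<delta> \<in> pairings P" "\<epsilon> \<in> pairings P" "\<tau> \<in> pairings P"
  shows "2 * (ncomp2 P \<delta> \<tau> + ncomp2 P \<epsilon> \<tau>
      + ncomp2 P \<delta> \<epsilon>)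
    \<le> card P + 4 * ncomp P (graph_on P \<delta> \<union> graph_on P \<epsilon> \<union> graph_on P \<tau>)"
proof -
  note d = pairingsD[OF assms(2)] and e = pairingsD[OF assms(3)] and t = pairingsD[OF assms(4)]
  let ?S = "graph_on P \<delta> \<union> graph_on P \<epsilon> \<union> graph_on P \<tau>"
  let ?R = "graph_on P (\<delta> \<circ> \<tau>) \<union> graph_on P (\<tau> \<circ> \<epsilon>)"
  have R1: "(x, \<delta> (\<tau> x)) \<in> eqcl P ?R" "(x, \<tau> (\<epsilon> x)) \<in> eqcl P ?R" if "x \<in> P" for x
    using that by (auto intro!: eqcl_edge simp: graph_on_def d(2) e(2) t(2))
  have R2: "(x, \<tau> (\<delta> x)) \<in> eqcl P ?R" if "x \<in> P" for x
    using eqcl_sym[OF R1(1)[of "\<tau> (\<delta> x)"]] that by (simp add: d t)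
  have R2': "(x, \<epsilon> (\<tau> x)) \<in> eqcl P ?R" if "x \<in> P" for x
    using eqcl_sym[OF R1(2)[of "\<epsilon> (\<tau> x)"]] that by (simp add: e t)
  have R3: "(x, \<delta> (\<epsilon> x)) \<in> eqcl P ?R" if "x \<in> P" for x
    using eqcl_trans[OF R1(2)[OF that] R1(1)[of "\<tau> (\<epsilon> x)"]] that by (simp add: e t)
  have R3': "(x, \<epsilon> (\<delta> x)) \<in> eqcl P ?R" if "x \<in> P" for x
    using eqcl_trans[OF R2[OF that] R2'[of "\<tau> (\<delta> x)"]] that by (simp add: d t)
  \<comment> \<open>The cover \<open>?R\<close> is invariant under \<open>\<delta>\<close>, so a component below lifts to the classes of \<open>x\<close> and \<open>\<delta> x\<close>.\<close>
  have conj: "(\<delta> x, \<delta> y) \<in> eqcl P ?R" if "(x, y) \<in> eqcl P ?R" for x y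
  proof -
    have "eqcl P ?R \<subseteq> {(x, y) \<in> P \<times> P. (\<delta> x, \<delta> y) \<in> eqcl P ?R}"
    proof (rule eqcl_least)
      show "equiv P {(x, y) \<in> P \<times> P. (\<delta> x, \<delta> y) \<in> eqcl P ?R}"
        by (rule equivI) (auto simp: refl_on_def sym_def trans_def d(2) eqcl_refl
            intro: eqcl_sym eqcl_trans)
      have "(\<delta> x, \<tau> x) \<in> eqcl P ?R" if "x \<in> P" for x
        using R2[of "\<delta> x"] that by (simp add: d)
      moreover have "(\<delta> x, \<delta> (\<tau> (\<epsilon> x))) \<in> eqcl P ?R" if "x \<in> P" for x
        using eqcl_trans[of "\<delta> x" "\<epsilon> x" P ?R] R3'[of "\<delta> x"] R1(1)[of "\<epsilon> x"] that
        by (simp add: d e t)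
      ultimately show "?R \<subseteq> {(x, y) \<in> P \<times> P. (\<delta> x, \<delta> y) \<in> eqcl P ?R}"
        using d e t by (auto simp: graph_on_def)
    qed
    then show ?thesis using that by auto
  qed
  have "ncomp P ?R \<le> 2 * ncomp P ?S" unfolding ncomp_def
  proof (rule card_quotient_le_twice[OF fin equiv_eqcl equiv_eqcl])
    fix x y assume xy: "(x, y) \<in> eqcl P ?S"
    let ?A = "\<lambda>x y. (x, y) \<in> eqcl P ?R \<or> (\<delta> x, y) \<in> eqcl P ?R"
    have flip: "?A x (\<delta> y)" if "?A x y" for x y
      using that conj[of x y] conj[of "\<delta> x" y] d(4) by auto
    have "(x, y) \<in> (?S \<union> ?S\<inverse>)\<^sup>*" "x \<in> P" using xy by (auto simp: eqcl_def)
    then have "?A x y"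
    proof (induction rule: rtrancl_induct)
      case base
      then show ?case by (auto intro: eqcl_refl)
    next
      case (step y z)
      have A: "?A x y" using step.IH step.prems by blast
      have y: "y \<in> P" using A eqcl_in(2)[of _ y P ?R] by blast
      have z: "z = \<delta> y \<or> z = \<epsilon> y \<or> z = \<tau> y" using step(2) d e t by (auto simp: graph_on_def)
      have Ae: "?A x (\<epsilon> y)"
        using flip[OF A] R3'[of "\<delta> y"] y eqcl_trans[of _ "\<delta> y" P ?R "\<epsilon> y"] by (auto simp: d)
      have At: "?A x (\<tau> y)"
        using flip[OF A] R2[of "\<delta> y"] y eqcl_trans[of _ "\<delta> y" P ?R "\<tau> y"] by (auto simp: d)
      show ?case using z flip[OF A] Ae At by metis
    qed
    then show "(x, y) \<in> eqcl P ?R \<or> (\<delta> x, y) \<in> eqcl P ?R" .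
  qed
  moreover have "ncomp P (graph_on P (\<delta> \<circ> \<tau>)) + ncomp P (graph_on P (\<tau> \<circ> \<epsilon>))
      + ncomp P (graph_on P ((\<delta> \<circ> \<tau>) \<circ> (\<tau> \<circ> \<epsilon>))) \<le> card P + 2 * ncomp P ?R"
    using d e t by (intro genus_inequality[OF fin] permutes_compose)
  moreover have "(\<delta> \<circ> \<tau>) \<circ> (\<tau> \<circ> \<epsilon>) = \<delta> \<circ> \<epsilon>" using t(4) by (auto simp: fun_eq_iff)
  moreover note ncomp_two_pairings[OF fin assms(2,4)] ncomp_two_pairings[OF fin assms(2,3)]
    ncomp_two_pairings[OF fin assms(4,3)]
  ultimately show ?thesis by (simp add: Un_commute)
qed

section \<open>Gaussian moments and Wick's formula\<close>

text \<open>
  The moments of a centered Gaussian variable of variance \<open>v\<close>, by the recursion that integration by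
  parts gives. This form fits the induction for Wick's formula.
\<close>

fun gauss_moment :: "real \<Rightarrow> nat \<Rightarrow> real" where
  "gauss_moment v 0 = 1"
| "gauss_moment v (Suc 0) = 0"
| "gauss_moment v (Suc (Suc k)) = real (Suc k) * v * gauss_moment v k"

lemma gauss_moment_odd: "gauss_moment v (2 * k + 1) = 0"
  by (induction k) auto

lemma gauss_moment_even: "gauss_moment v (2 * k) = fact (2 * k) * v ^ k / (2 ^ k * fact k)"
proof -
  have "gauss_moment v (2 * k) * (2 ^ k * fact k) = fact (2 * k) * v ^ k"
  proof (induction k)
    case (Suc k)
    have "gauss_moment v (2 * Suc k) * (2 ^ Suc k * fact (Suc k))
        = real (Suc (2 * k)) * v * (2 * real (Suc k)) * (gauss_moment v (2 * k) * (2 ^ k * fact k))"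
      by (simp add: algebra_simps)
    also have "\<dots> = fact (2 * Suc k) * v ^ Suc k" unfolding Suc by (simp add: algebra_simps)
    finally show ?case .
  qed auto
  then show ?thesis by (simp add: eq_divide_eq)
qed

lemma has_integral_gauss_moment:
  assumes "\<sigma> > 0"
  shows "has_bochner_integral (density lborel (normal_density 0 \<sigma>)) (\<lambda>x. x ^ k) (gauss_moment (\<sigma>\<^sup>2) k)"
proof (rule has_bochner_integral_density)
  show "has_bochner_integral lborel (\<lambda>x. normal_density 0 \<sigma> x *\<^sub>R x ^ k) (gauss_moment (\<sigma>\<^sup>2) k)"
  proof (cases "even k")
    case True
    then obtain j where j: "k = 2 * j" by (elim evenE)
    have "fact (2 * j) / ((2 / \<sigma>\<^sup>2) ^ j * fact j) = gauss_moment (\<sigma>\<^sup>2) k"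
      using assms unfolding j gauss_moment_even by (simp add: power_divide field_simps)
    then show ?thesis using normal_moment_even[OF assms, of 0 j] by (simp add: j)
  next
    case False
    then obtain j where j: "k = 2 * j + 1" by (elim oddE)
    then show ?thesis using normal_moment_odd[OF assms, of 0 j] gauss_moment_odd[of "\<sigma>\<^sup>2" j] by simp
  qed
qed (auto simp: normal_density_nonneg)

lemma prob_space_gaussian: "n \<ge> 1 \<Longrightarrow> prob_space (gaussian_space d n)"
  unfolding gaussian_space_def by (intro prob_space_PiM prob_space_normal_density) auto

lemma gaussian_space_monomial:
  assumes "n \<ge> 1"
  shows "has_bochner_integral (gaussian_space d n) (\<lambda>\<omega>. \<Prod>q\<in>{..<d} \<times> {..<n}. \<omega> q ^ c q)
    (\<Prod>q\<in>{..<d} \<times> {..<n}. gauss_moment (1 / n) (c q))"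
proof -
  let ?N = "\<lambda>_ :: nat \<times> nat. density lborel (normal_density 0 (1 / sqrt (real n)))"
  have s: "0 < 1 / sqrt (real n)" using assms by simp
  interpret product_sigma_finite ?N
    unfolding product_sigma_finite_def
    by (intro allI prob_space_imp_sigma_finite prob_space_normal_density s)
  have v: "(1 / sqrt (real n))\<^sup>2 = 1 / n" using assms by (simp add: power_divide)
  note m = has_integral_gauss_moment[OF s, unfolded v]
  show ?thesis unfolding has_bochner_integral_iff gaussian_space_def
  proof
    show "integrable (Pi\<^sub>M ({..<d} \<times> {..<n}) ?N) (\<lambda>\<omega>. \<Prod>q\<in>{..<d} \<times> {..<n}. \<omega> q ^ c q)"
      by (rule product_integrable_prod) (use m in \<open>auto simp: has_bochner_integral_iff\<close>)
    have "integral\<^sup>L (Pi\<^sub>M ({..<d} \<times> {..<n}) ?N) (\<lambda>\<omega>. \<Prod>q\<in>{..<d} \<times> {..<n}. \<omega> q ^ c q)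
        = (\<Prod>q\<in>{..<d} \<times> {..<n}. integral\<^sup>L (?N q) (\<lambda>x. x ^ c q))"
      by (rule product_integral_prod) (use m in \<open>auto simp: has_bochner_integral_iff\<close>)
    then show "integral\<^sup>L (Pi\<^sub>M ({..<d} \<times> {..<n}) ?N) (\<lambda>\<omega>. \<Prod>q\<in>{..<d} \<times> {..<n}. \<omega> q ^ c q)
        = (\<Prod>q\<in>{..<d} \<times> {..<n}. gauss_moment (1 / n) (c q))"
      using m by (simp add: has_bochner_integral_iff)
  qed
qed

lemma prod_as_monomial:
  assumes "finite P" "finite I" "u ` P \<subseteq> I"
  shows "(\<Prod>x\<in>P. \<omega> (u x)) = (\<Prod>q\<in>I. (\<omega> q :: real) ^ card {x \<in> P. u x = q})"
proof -
  have "(\<Prod>x\<in>P. \<omega> (u x)) = (\<Prod>q\<in>I. \<Prod>x\<in>{x. x \<in> P \<and> u x = q}. \<omega> (u x))"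
    using prod.group[OF assms, of "\<lambda>x. \<omega> (u x)"] by simp
  also have "\<dots> = (\<Prod>q\<in>I. \<omega> q ^ card {x \<in> P. u x = q})"
    by (intro prod.cong refl) simp
  finally show ?thesis .
qed

lemma finite_inv_pairings: "finite P \<Longrightarrow> finite {\<tau> \<in> pairings P. Q \<tau>}"
  using finite_pairings[of P] by simp

lemma pairings_empty: "pairings {} = {id}"
  by (auto simp: pairings_def permutes_def fun_eq_iff)

text \<open>
  Deleting the pair \<open>{x0, y}\<close> and restoring it are inverse to each other.
\<close>

lemma card_pairings_with_pair:
  assumes "x0 \<in> P" "y \<in> P" "y \<noteq> x0" "u y = u x0"
  shows "card {\<tau> \<in> pairings P. \<tau> x0 = y \<and> (\<forall>x\<in>P. u (\<tau> x) = u x)}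
       = card {\<tau> \<in> pairings (P - {x0, y}). \<forall>x\<in>P - {x0, y}. u (\<tau> x) = u x}"
proof -
  let ?A = "{\<tau> \<in> pairings P. \<tau> x0 = y \<and> (\<forall>x\<in>P. u (\<tau> x) = u x)}"
  let ?B = "{\<tau> \<in> pairings (P - {x0, y}). \<forall>x\<in>P - {x0, y}. u (\<tau> x) = u x}"
  let ?f = "\<lambda>\<tau> x. if x = x0 \<or> x = y then x else \<tau> x"
  let ?g = "\<lambda>\<tau> x. if x = x0 then y else if x = y then x0 else \<tau> x"
  have perm: "\<tau> permutes S" if "\<And>x. \<tau> (\<tau> x) = x" "\<And>x. x \<notin> S \<Longrightarrow> \<tau> x = x"
    for \<tau> and S :: "'a set"
    unfolding permutes_def using that by metis
  have "bij_betw ?f ?A ?B"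
  proof (rule bij_betw_byWitness[where f' = ?g])
    show "\<forall>\<tau>\<in>?A. ?g (?f \<tau>) = \<tau>"
    proof
      fix \<tau> assume t: "\<tau> \<in> ?A"
      then have "\<tau> x0 = y" "\<tau> y = x0" using pairingsD(4)[of \<tau> P x0] by auto
      then show "?g (?f \<tau>) = \<tau>" by (auto simp: fun_eq_iff)
    qed
    show "\<forall>\<tau>\<in>?B. ?f (?g \<tau>) = \<tau>"
    proof
      fix \<tau> assume t: "\<tau> \<in> ?B"
      then have "\<tau> x0 = x0" "\<tau> y = y" using pairingsD(5)[of \<tau> "P - {x0, y}"] by auto
      then show "?f (?g \<tau>) = \<tau>" by (auto simp: fun_eq_iff)
    qed
    show "?f ` ?A \<subseteq> ?B"
    proof (rule image_subsetI)
      fix \<tau> assume t: "\<tau> \<in> ?A"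
      then have tp: "\<tau> \<in> pairings P" and tx: "\<tau> x0 = y" by auto
      note d = pairingsD[OF tp]
      have ty: "\<tau> y = x0" using tx d(4)[of x0] by simp
      have ne: "\<tau> x \<noteq> x0 \<and> \<tau> x \<noteq> y" if "x \<noteq> x0" "x \<noteq> y" for x
        using that tx ty d(4) by metis
      have "?f \<tau> permutes P - {x0, y}" by (rule perm) (use ne d in auto)
      then show "?f \<tau> \<in> ?B" using t ne d by (auto simp: pairings_def)
    qed
    show "?g ` ?B \<subseteq> ?A"
    proof (rule image_subsetI)
      fix \<tau> assume t: "\<tau> \<in> ?B"
      then have tp: "\<tau> \<in> pairings (P - {x0, y})" by auto
      note d = pairingsD[OF tp]
      have ne: "\<tau> x \<noteq> x0 \<and> \<tau> x \<noteq> y" if "x \<noteq> x0" "x \<noteq> y" for x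
        using that d(4)[of x] d(5)[of x0] d(5)[of y] by auto
      have "?g \<tau> permutes P" by (rule perm) (use ne d assms in auto)
      then show "?g \<tau> \<in> ?A" using t ne d assms by (auto simp: pairings_def)
    qed
  qed
  then show ?thesis by (rule bij_betw_same_card)
qed

text \<open>
  The left side is the moment of a monomial in independent Gaussian variables. Both sides satisfy the same recursion:
  on the right, a point \<open>x0\<close> is paired with one of the \<open>k\<close> other points that carry its index; on the left, these
  are the factor \<open>k v\<close> in the recursion for \<open>gauss_moment\<close>.
\<close>

theorem wick_formula:
  assumes "finite P" "finite I" "u ` P \<subseteq> I"
  shows "(\<Prod>q\<in>I. gauss_moment v (card {x \<in> P. u x = q}))
     = v ^ (card P div 2) * real (card {\<tau> \<in> pairings P. \<forall>x\<in>P. u (\<tau> x) = u x})"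
  using assms(1,3)
proof (induction "card P" arbitrary: P rule: less_induct)
  case less
  show ?case
  proof (cases "P = {}")
    case True
    then show ?thesis by (simp add: pairings_empty)
  next
    case False
    then obtain x0 where x0: "x0 \<in> P" by auto
    define q0 where "q0 = u x0"
    define Y where "Y = {y \<in> P - {x0}. u y = q0}"
    let ?B = "\<lambda>P. {\<tau> \<in> pairings P. \<forall>x\<in>P. u (\<tau> x) = u x}"
    have finY: "finite Y" using less.prems by (simp add: Y_def)
    have "?B P = (\<Union>y\<in>Y. {\<tau> \<in> pairings P. \<tau> x0 = y \<and> (\<forall>x\<in>P. u (\<tau> x) = u x)})"
      using x0 pairingsD(2,3)[of _ P x0] by (auto simp: Y_def q0_def)
    then have "card (?B P) = (\<Sum>y\<in>Y. card {\<tau> \<in> pairings P. \<tau> x0 = y \<and> (\<forall>x\<in>P. u (\<tau> x) = u x)})"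
      using less.prems finY by (simp, subst card_UN_disjoint) (auto intro: finite_inv_pairings)
    also have "\<dots> = (\<Sum>y\<in>Y. card (?B (P - {x0, y})))"
      using x0 by (intro sum.cong refl card_pairings_with_pair) (auto simp: Y_def q0_def)
    finally have cardB: "card (?B P) = (\<Sum>y\<in>Y. card (?B (P - {x0, y})))" .
    have q0I: "q0 \<in> I" using less.prems x0 q0_def by auto
    have set0: "{x \<in> P. u x = q0} = insert x0 Y" using x0 by (auto simp: Y_def q0_def)
    have c0: "card {x \<in> P. u x = q0} = Suc (card Y)" unfolding set0
      using finY by (subst card_insert_disjoint) (auto simp: Y_def)
    define R where "R = (\<Prod>q\<in>I - {q0}. gauss_moment v (card {x \<in> P. u x = q}))"
    have L: "(\<Prod>q\<in>I. gauss_moment v (card {x \<in> P. u x = q})) = gauss_moment v (Suc (card Y)) * R"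
      using prod.remove[OF assms(2) q0I, of "\<lambda>q. gauss_moment v (card {x \<in> P. u x = q})"] c0
      by (simp add: R_def)
    show ?thesis
    proof (cases "Y = {}")
      case True
      then show ?thesis using L cardB by simp
    next
      case False
      then obtain k where k: "card Y = Suc k" using finY by (metis card_0_eq not0_implies_Suc)
      have each: "gauss_moment v k * R = v ^ (card P div 2 - 1) * real (card (?B (P - {x0, y})))"
        "v * v ^ (card P div 2 - 1) = v ^ (card P div 2)" if y: "y \<in> Y" for y
      proof -
        have yP: "y \<in> P" "y \<noteq> x0" "u y = q0" using y by (auto simp: Y_def)
        have sub: "{x0, y} \<subseteq> P" using x0 yP by auto
        have cP: "card (P - {x0, y}) = card P - 2" "card P \<ge> 2"
          using sub less.prems(1) yP card_mono[OF less.prems(1) sub] by (simp_all add: card_Diff_subset)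
        have "{x \<in> P - {x0, y}. u x = q0} = Y - {y}" by (auto simp: Y_def)
        then have a: "card {x \<in> P - {x0, y}. u x = q0} = k" using y k finY by simp
        have b: "{x \<in> P - {x0, y}. u x = q} = {x \<in> P. u x = q}" if "q \<noteq> q0" for q
          using that yP q0_def by auto
        have "(\<Prod>q\<in>I. gauss_moment v (card {x \<in> P - {x0, y}. u x = q})) = gauss_moment v k * R"
          using prod.remove[OF assms(2) q0I, of "\<lambda>q. gauss_moment v (card {x \<in> P - {x0, y}. u x = q})"]
            a b by (simp add: R_def)
        moreover have "(\<Prod>q\<in>I. gauss_moment v (card {x \<in> P - {x0, y}. u x = q}))
          = v ^ (card (P - {x0, y}) div 2) * real (card (?B (P - {x0, y})))"
          using less.prems cP by (intro less.hyps) auto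
        moreover have "card (P - {x0, y}) div 2 = card P div 2 - 1" using cP by simp
        ultimately show "gauss_moment v k * R = v ^ (card P div 2 - 1) * real (card (?B (P - {x0, y})))"
          by simp
        have "card P div 2 = Suc (card P div 2 - 1)" using cP by simp
        then show "v * v ^ (card P div 2 - 1) = v ^ (card P div 2)" by (metis power_Suc)
      qed
      have "gauss_moment v (Suc (card Y)) * R = (\<Sum>y\<in>Y. v * (gauss_moment v k * R))"
        by (simp add: k)
      also have "\<dots> = (\<Sum>y\<in>Y. v ^ (card P div 2) * real (card (?B (P - {x0, y}))))"
      proof (rule sum.cong[OF refl])
        fix y assume y: "y \<in> Y"
        show "v * (gauss_moment v k * R) = v ^ (card P div 2) * real (card (?B (P - {x0, y})))"
          unfolding each(1)[OF y] each(2)[OF y, symmetric] by simp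
      qed
      also have "\<dots> = v ^ (card P div 2) * real (card (?B P))"
        unfolding cardB by (simp add: sum_distrib_left)
      finally show ?thesis using L by simp
    qed
  qed
qed

lemma gaussian_product:
  assumes "n \<ge> 1" "finite P" "u ` P \<subseteq> {..<d} \<times> {..<n}"
  shows "has_bochner_integral (gaussian_space d n) (\<lambda>\<omega>. \<Prod>x\<in>P. \<omega> (u x))
    ((1 / n) ^ (card P div 2) * real (card {\<tau> \<in> pairings P. \<forall>x\<in>P. u (\<tau> x) = u x}))"
  using gaussian_space_monomial[OF assms(1), of d "\<lambda>q. card {x \<in> P. u x = q}"]
    wick_formula[OF assms(2) _ assms(3), of "1 / n"] assms(2,3)
  by (simp add: prod_as_monomial[OF assms(2) _ assms(3)])

text \<open>
  Raising the exponent \<open>c\<close> of one variable by \<open>2\<close> multiplies its moment by \<open>(c + 1) / n\<close>; summed over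
  all variables the factors \<open>c\<close> give the degree. So the covariance of a polynomial with the squared norm sees only
  the degree.
\<close>

lemma gaussian_product_times_norm:
  assumes "n \<ge> 1" "finite P" "u ` P \<subseteq> {..<d} \<times> {..<n}"
  shows "has_bochner_integral (gaussian_space d n)
     (\<lambda>\<omega>. (\<Sum>q\<in>{..<d} \<times> {..<n}. n * (\<omega> q)\<^sup>2) * (\<Prod>x\<in>P. \<omega> (u x)))
     ((d * n + card P) * (\<integral>\<omega>. (\<Prod>x\<in>P. \<omega> (u x)) \<partial>gaussian_space d n))"
proof -
  let ?I = "{..<d} \<times> {..<n}"
  define c where "c q = card {x \<in> P. u x = q}" for q
  define G where "G = (\<Prod>q\<in>?I. gauss_moment (1 / n) (c q))"
  have m: "(\<Prod>x\<in>P. \<omega> (u x)) = (\<Prod>q\<in>?I. \<omega> q ^ c q)" for \<omega> :: "nat \<times> nat \<Rightarrow> real"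
    unfolding c_def by (rule prod_as_monomial[OF assms(2) _ assms(3)]) simp
  have int: "(\<integral>\<omega>. (\<Prod>x\<in>P. \<omega> (u x)) \<partial>gaussian_space d n) = G"
    unfolding m G_def using gaussian_space_monomial[OF assms(1)] by (rule has_bochner_integral_integral_eq)
  have one: "has_bochner_integral (gaussian_space d n) (\<lambda>\<omega>. n * (\<omega> q)\<^sup>2 * (\<Prod>x\<in>P. \<omega> (u x))) (real (Suc (c q)) * G)"
    if q: "q \<in> ?I" for q
  proof -
    define c' where "c' = c(q := c q + 2)"
    have "(\<omega> q)\<^sup>2 * (\<Prod>x\<in>P. \<omega> (u x)) = (\<Prod>q\<in>?I. \<omega> q ^ c' q)" for \<omega> :: "nat \<times> nat \<Rightarrow> real"
    proof -
      have "(\<Prod>q\<in>?I. \<omega> q ^ c' q) = \<omega> q ^ (c q + 2) * (\<Prod>p\<in>?I - {q}. \<omega> p ^ c p)"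
        using prod.remove[of ?I q "\<lambda>q. \<omega> q ^ c' q"] q by (simp add: c'_def)
      moreover have "(\<Prod>q\<in>?I. \<omega> q ^ c q) = \<omega> q ^ c q * (\<Prod>p\<in>?I - {q}. \<omega> p ^ c p)"
        using prod.remove[of ?I q "\<lambda>q. \<omega> q ^ c q"] q by simp
      ultimately show ?thesis unfolding m by (simp add: power2_eq_square)
    qed
    moreover have "(\<Prod>q\<in>?I. gauss_moment (1 / n) (c' q)) = real (Suc (c q)) / n * G"
    proof -
      have "(\<Prod>q\<in>?I. gauss_moment (1 / n) (c' q))
          = gauss_moment (1 / n) (Suc (Suc (c q))) * (\<Prod>p\<in>?I - {q}. gauss_moment (1 / n) (c p))"
        using prod.remove[of ?I q "\<lambda>q. gauss_moment (1 / n) (c' q)"] q by (simp add: c'_def)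
      moreover have "G = gauss_moment (1 / n) (c q) * (\<Prod>p\<in>?I - {q}. gauss_moment (1 / n) (c p))"
        using prod.remove[of ?I q "\<lambda>q. gauss_moment (1 / n) (c q)"] q by (simp add: G_def)
      ultimately show ?thesis by simp
    qed
    ultimately have "has_bochner_integral (gaussian_space d n) (\<lambda>\<omega>. (\<omega> q)\<^sup>2 * (\<Prod>x\<in>P. \<omega> (u x))) (real (Suc (c q)) / n * G)"
      using gaussian_space_monomial[OF assms(1), of d c'] by simp
    from has_bochner_integral_mult_right[OF this, of "real n"] show ?thesis
      using assms(1) by (simp add: mult.assoc)
  qed
  have "has_bochner_integral (gaussian_space d n)
     (\<lambda>\<omega>. \<Sum>q\<in>?I. n * (\<omega> q)\<^sup>2 * (\<Prod>x\<in>P. \<omega> (u x))) (\<Sum>q\<in>?I. real (Suc (c q)) * G)"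
    by (intro has_bochner_integral_sum one)
  moreover have "(\<Sum>q\<in>?I. real (Suc (c q)) * G) = (d * n + card P) * G"
  proof -
    have "(\<Sum>q\<in>?I. c q) = card P"
      unfolding c_def using sum.group[OF assms(2) _ assms(3), of "\<lambda>_. 1::nat"] by simp
    then have "(\<Sum>q\<in>?I. Suc (c q)) = d * n + card P"
      using sum.distrib[of "\<lambda>_. 1" c ?I] by simp
    then show ?thesis by (metis of_nat_sum sum_distrib_right)
  qed
  ultimately show ?thesis unfolding int by (simp add: sum_distrib_right)
qed

section \<open>Traces along the cycles of a permutation\<close>

text \<open>
  A function on a disjoint union is a pair of functions, so a sum of products that separate
  factorizes.
\<close>

lemma sum_PiE_Un:
  fixes g h :: "('a \<Rightarrow> 'b) \<Rightarrow> 'c :: comm_semiring_1"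
  assumes disj: "A \<inter> B = {}"
    and g: "\<And>r. g (restrict r A) = g r" and h: "\<And>r. h (restrict r B) = h r"
  shows "(\<Sum>r\<in>(A \<union> B) \<rightarrow>\<^sub>E F. g r * h r) = (\<Sum>r\<in>A \<rightarrow>\<^sub>E F. g r) * (\<Sum>r\<in>B \<rightarrow>\<^sub>E F. h r)"
proof -
  have "(\<Sum>r\<in>A \<rightarrow>\<^sub>E F. g r) * (\<Sum>r\<in>B \<rightarrow>\<^sub>E F. h r)
      = (\<Sum>(r, s)\<in>(A \<rightarrow>\<^sub>E F) \<times> (B \<rightarrow>\<^sub>E F). g r * h s)"
    by (simp add: sum_product sum.cartesian_product)
  also have "\<dots> = (\<Sum>r\<in>(A \<union> B) \<rightarrow>\<^sub>E F. g r * h r)"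
  proof (rule sum.reindex_bij_witness[where i = "\<lambda>r. (restrict r A, restrict r B)"
        and j = "\<lambda>(r, s) x. if x \<in> A then r x else s x"])
    fix p assume "p \<in> (A \<rightarrow>\<^sub>E F) \<times> (B \<rightarrow>\<^sub>E F)"
    then obtain r s where p: "p = (r, s)" "r \<in> A \<rightarrow>\<^sub>E F" "s \<in> B \<rightarrow>\<^sub>E F" by auto
    let ?j = "\<lambda>x. if x \<in> A then r x else s x"
    have 1: "restrict ?j A = r" using p by (auto simp: fun_eq_iff PiE_def extensional_def)
    have 2: "restrict ?j B = s" using p disj by (auto simp: fun_eq_iff PiE_def extensional_def)
    show "(restrict ((\<lambda>(r, s) x. if x \<in> A then r x else s x) p) A, restrict ((\<lambda>(r, s) x. if x \<in> A then r x else s x) p) B) = p"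
      using 1 2 p by simp
    show "(\<lambda>(r, s) x. if x \<in> A then r x else s x) p \<in> (A \<union> B) \<rightarrow>\<^sub>E F"
      using p by (auto simp: PiE_def extensional_def)
    have "g ?j = g r" "h ?j = h s" using g[of ?j] h[of ?j] 1 2 by simp_all
    then show "g ((\<lambda>(r, s) x. if x \<in> A then r x else s x) p) * h ((\<lambda>(r, s) x. if x \<in> A then r x else s x) p)
        = (case p of (r, s) \<Rightarrow> g r * h s)" using p by simp
  next
    fix r assume r: "r \<in> (A \<union> B) \<rightarrow>\<^sub>E F"
    show "(\<lambda>(r, s) x. if x \<in> A then r x else s x) (restrict r A, restrict r B) = r"
      using r by (auto simp: fun_eq_iff PiE_def extensional_def)
    show "(restrict r A, restrict r B) \<in> (A \<rightarrow>\<^sub>E F) \<times> (B \<rightarrow>\<^sub>E F)"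
      using r by (auto simp: PiE_def Pi_def)
  qed
  finally show ?thesis by simp
qed

lemma sum_PiE_Union:
  fixes g :: "'a set \<Rightarrow> ('a \<Rightarrow> 'b) \<Rightarrow> 'c :: comm_semiring_1"
  assumes "finite C" and "\<And>c c'. c \<in> C \<Longrightarrow> c' \<in> C \<Longrightarrow> c \<noteq> c' \<Longrightarrow> c \<inter> c' = {}"
    and g: "\<And>c r. g c (restrict r c) = g c r"
  shows "(\<Sum>r\<in>(\<Union>C) \<rightarrow>\<^sub>E F. \<Prod>c\<in>C. g c r) = (\<Prod>c\<in>C. \<Sum>r\<in>c \<rightarrow>\<^sub>E F. g c r)"
  using assms(1,2)
proof (induction C rule: finite_induct)
  case empty
  then show ?case by simp
next
  case (insert c C)
  have disj: "c \<inter> \<Union>C = {}" using insert.prems insert.hyps by blast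
  have h: "(\<Prod>c\<in>C. g c (restrict r (\<Union>C))) = (\<Prod>c\<in>C. g c r)" for r
  proof (rule prod.cong[OF refl])
    fix c assume c: "c \<in> C"
    have "restrict (restrict r (\<Union>C)) c = restrict r c" using c by (auto simp: fun_eq_iff)
    then show "g c (restrict r (\<Union>C)) = g c r" using g by metis
  qed
  have "(\<Sum>r\<in>(\<Union>(insert c C)) \<rightarrow>\<^sub>E F. \<Prod>c\<in>insert c C. g c r)
      = (\<Sum>r\<in>(c \<union> \<Union>C) \<rightarrow>\<^sub>E F. g c r * (\<Prod>c\<in>C. g c r))"
    using insert by simp
  also have "\<dots> = (\<Sum>r\<in>c \<rightarrow>\<^sub>E F. g c r) * (\<Sum>r\<in>(\<Union>C) \<rightarrow>\<^sub>E F. \<Prod>c\<in>C. g c r)"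
    by (rule sum_PiE_Un[OF disj, of "g c" "\<lambda>r. \<Prod>c\<in>C. g c r"]) (rule g, rule h)
  also have "\<dots> = (\<Prod>c\<in>insert c C. \<Sum>r\<in>c \<rightarrow>\<^sub>E F. g c r)"
    using insert by simp
  finally show ?case .
qed

lemma sum_PiE_reindex:
  assumes "bij_betw e S T"
  shows "(\<Sum>r\<in>T \<rightarrow>\<^sub>E F. \<phi> (\<lambda>x\<in>S. r (e x))) = (\<Sum>r\<in>S \<rightarrow>\<^sub>E F. \<phi> r)"
proof -
  have inv: "inv_into S e y \<in> S" "e (inv_into S e y) = y" if "y \<in> T" for y
    using assms that by (auto simp: bij_betw_def inv_into_into f_inv_into_f)
  have inv2: "inv_into S e (e x) = x" "e x \<in> T" if "x \<in> S" for x
    using assms that by (auto simp: bij_betw_def)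
  show ?thesis
  proof (rule sum.reindex_bij_witness[where j = "\<lambda>r. \<lambda>x\<in>S. r (e x)" and i = "\<lambda>r. \<lambda>y\<in>T. r (inv_into S e y)"])
    fix r assume "r \<in> T \<rightarrow>\<^sub>E F"
    then show "(\<lambda>y\<in>T. (\<lambda>x\<in>S. r (e x)) (inv_into S e y)) = r" "(\<lambda>x\<in>S. r (e x)) \<in> S \<rightarrow>\<^sub>E F"
      using inv inv2 by (auto simp: fun_eq_iff PiE_def extensional_def)
  next
    fix r assume "r \<in> S \<rightarrow>\<^sub>E F"
    then show "(\<lambda>x\<in>S. (\<lambda>y\<in>T. r (inv_into S e y)) (e x)) = r" "(\<lambda>y\<in>T. r (inv_into S e y)) \<in> T \<rightarrow>\<^sub>E F"
      using inv inv2 by (auto simp: fun_eq_iff PiE_def extensional_def)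
  qed simp
qed

lemma sum_PiE_insert:
  assumes "a \<notin> S"
  shows "(\<Sum>r\<in>insert a S \<rightarrow>\<^sub>E F. \<phi> r) = (\<Sum>r\<in>S \<rightarrow>\<^sub>E F. \<Sum>c\<in>F. \<phi> (r(a := c)))"
proof -
  have "(\<Sum>r\<in>S \<rightarrow>\<^sub>E F. \<Sum>c\<in>F. \<phi> (r(a := c))) = (\<Sum>(r, c)\<in>(S \<rightarrow>\<^sub>E F) \<times> F. \<phi> (r(a := c)))"
    by (simp add: sum.cartesian_product)
  also have "\<dots> = (\<Sum>r\<in>insert a S \<rightarrow>\<^sub>E F. \<phi> r)"
  proof (rule sum.reindex_bij_witness[where j = "\<lambda>(r, c). r(a := c)" and i = "\<lambda>r. (restrict r S, r a)"])
    fix p assume "p \<in> (S \<rightarrow>\<^sub>E F) \<times> F"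
    then obtain r c where p: "p = (r, c)" "r \<in> S \<rightarrow>\<^sub>E F" "c \<in> F" by auto
    have "restrict (r(a := c)) S = r" using p assms by (auto simp: fun_eq_iff PiE_def extensional_def)
    then show "(restrict ((\<lambda>(r, c). r(a := c)) p) S, (\<lambda>(r, c). r(a := c)) p a) = p" using p by simp
    show "(\<lambda>(r, c). r(a := c)) p \<in> insert a S \<rightarrow>\<^sub>E F" using p by (auto simp: PiE_def extensional_def)
  next
    fix r assume "r \<in> insert a S \<rightarrow>\<^sub>E F"
    then show "(\<lambda>(r, c). r(a := c)) (restrict r S, r a) = r" "(restrict r S, r a) \<in> (S \<rightarrow>\<^sub>E F) \<times> F"
      using assms by (auto simp: fun_eq_iff PiE_def extensional_def)
  qed auto
  finally show ?thesis by simp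
qed

lemma sum_walks:
  assumes A: "A \<in> carrier_mat d d"
  shows "(\<Sum>r\<in>{..<Suc k} \<rightarrow>\<^sub>E {..<d}. (\<Prod>i<k. A $$ (r i, r (Suc i))) * f (r 0) (r k))
       = (\<Sum>a<d. \<Sum>b<d. (A ^\<^sub>m k) $$ (a, b) * (f a b :: real))"
proof (induction k arbitrary: f)
  case 0
  have "(\<Sum>r\<in>{..<Suc 0} \<rightarrow>\<^sub>E {..<d}. (\<Prod>i<0. A $$ (r i, r (Suc i))) * f (r 0) (r 0))
      = (\<Sum>r\<in>insert (0::nat) {} \<rightarrow>\<^sub>E {..<d}. f (r 0) (r 0))" by (simp add: lessThan_Suc)
  also have "\<dots> = (\<Sum>a<d. f a a)" by (subst sum_PiE_insert) auto
  also have "\<dots> = (\<Sum>a<d. \<Sum>b<d. (A ^\<^sub>m 0) $$ (a, b) * f a b)"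
    using A by (intro sum.cong refl) (simp add: one_mat_def if_distrib[of "\<lambda>x. x * _"] cong: if_cong)
  finally show ?case .
next
  case (Suc k)
  have Ak: "A ^\<^sub>m k \<in> carrier_mat d d" using A by (simp add: pow_carrier_mat)
  have "(\<Sum>r\<in>{..<Suc (Suc k)} \<rightarrow>\<^sub>E {..<d}. (\<Prod>i<Suc k. A $$ (r i, r (Suc i))) * f (r 0) (r (Suc k)))
    = (\<Sum>r\<in>insert (Suc k) {..<Suc k} \<rightarrow>\<^sub>E {..<d}. (\<Prod>i<Suc k. A $$ (r i, r (Suc i))) * f (r 0) (r (Suc k)))"
    by (simp add: lessThan_Suc)
  also have "\<dots> = (\<Sum>r\<in>{..<Suc k} \<rightarrow>\<^sub>E {..<d}. \<Sum>c<d. (\<Prod>i<Suc k. A $$ ((r(Suc k := c)) i, (r(Suc k := c)) (Suc i))) * f (r 0) c)"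
    by (subst sum_PiE_insert) auto
  also have "\<dots> = (\<Sum>r\<in>{..<Suc k} \<rightarrow>\<^sub>E {..<d}. (\<Prod>i<k. A $$ (r i, r (Suc i))) * (\<Sum>c<d. A $$ (r k, c) * f (r 0) c))"
    by (intro sum.cong refl) (simp add: sum_distrib_left mult.assoc)
  also have "\<dots> = (\<Sum>a<d. \<Sum>b<d. (A ^\<^sub>m k) $$ (a, b) * (\<Sum>c<d. A $$ (b, c) * f a c))"
    by (rule Suc.IH)
  also have "\<dots> = (\<Sum>a<d. \<Sum>c<d. \<Sum>b<d. (A ^\<^sub>m k) $$ (a, b) * A $$ (b, c) * f a c)"
  proof (rule sum.cong[OF refl])
    fix a
    have "(\<Sum>b<d. (A ^\<^sub>m k) $$ (a, b) * (\<Sum>c<d. A $$ (b, c) * f a c))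
        = (\<Sum>b<d. \<Sum>c<d. (A ^\<^sub>m k) $$ (a, b) * A $$ (b, c) * f a c)"
      by (simp add: sum_distrib_left mult.assoc)
    also have "\<dots> = (\<Sum>c<d. \<Sum>b<d. (A ^\<^sub>m k) $$ (a, b) * A $$ (b, c) * f a c)"
      by (rule sum.swap)
    finally show "(\<Sum>b<d. (A ^\<^sub>m k) $$ (a, b) * (\<Sum>c<d. A $$ (b, c) * f a c))
        = (\<Sum>c<d. \<Sum>b<d. (A ^\<^sub>m k) $$ (a, b) * A $$ (b, c) * f a c)" .
  qed
  also have "\<dots> = (\<Sum>a<d. \<Sum>c<d. (A ^\<^sub>m Suc k) $$ (a, c) * f a c)"
    using A Ak by (intro sum.cong refl) (simp add: scalar_prod_def sum_distrib_right atLeast0LessThan)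
  finally show ?case .
qed

lemma trace_power_as_sum:
  assumes A: "A \<in> carrier_mat d d" and "k \<ge> 1"
  shows "mat_trace (A ^\<^sub>m k) = (\<Sum>r\<in>{..<k} \<rightarrow>\<^sub>E {..<d}. \<Prod>i<k. A $$ (r i, r (Suc i mod k)))"
proof -
  obtain j where k: "k = Suc j" using assms(2) by (cases k) auto
  have Aj: "A ^\<^sub>m j \<in> carrier_mat d d" using A by (simp add: pow_carrier_mat)
  have "(\<Sum>r\<in>{..<k} \<rightarrow>\<^sub>E {..<d}. \<Prod>i<k. A $$ (r i, r (Suc i mod k)))
      = (\<Sum>r\<in>{..<Suc j} \<rightarrow>\<^sub>E {..<d}. (\<Prod>i<j. A $$ (r i, r (Suc i))) * A $$ (r j, r 0))"
    unfolding k by (intro sum.cong refl) simp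
  also have "\<dots> = (\<Sum>a<d. \<Sum>b<d. (A ^\<^sub>m j) $$ (a, b) * A $$ (b, a))"
    by (rule sum_walks[OF A])
  also have "\<dots> = mat_trace (A ^\<^sub>m k)"
    using A Aj unfolding k mat_trace_def
    by (auto intro!: sum.cong simp: scalar_prod_def atLeast0LessThan)
  finally show ?thesis by simp
qed

lemma cycle_trace:
  assumes A: "A \<in> carrier_mat d d" and \<sigma>: "permutation \<sigma>"
  shows "(\<Sum>r\<in>orbit \<sigma> x \<rightarrow>\<^sub>E {..<d}. \<Prod>y\<in>orbit \<sigma> x. A $$ (r y, r (\<sigma> y)))
       = mat_trace (A ^\<^sub>m card (orbit \<sigma> x))"
proof -
  define k where "k = funpow_dist1 \<sigma> x x"
  define e where "e i = (\<sigma> ^^ i) x" for i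
  have x: "x \<in> orbit \<sigma> x" using \<sigma> by (rule permutation_self_in_orbit)
  have im: "orbit \<sigma> x = e ` {..<k}"
    using orbit_conv_funpow_dist1[OF x] by (simp add: k_def e_def atLeast0LessThan)
  have inj: "inj_on e {..<k}"
    using inj_on_funpow_dist1[OF x] by (simp add: k_def e_def[abs_def] atLeast0LessThan)
  have k1: "k \<ge> 1" by (simp add: k_def)
  have ck: "card (orbit \<sigma> x) = k" unfolding im using inj by (simp add: card_image)
  have bij: "bij_betw e {..<k} (orbit \<sigma> x)" using im inj by (simp add: bij_betw_def)
  have ek: "e k = e 0" using funpow_dist1_prop[OF x] by (simp add: k_def e_def del: funpow.simps)
  have step: "\<sigma> (e i) = e (Suc i mod k)" if "i < k" for i
  proof (cases "Suc i = k")
    case True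
    then have "\<sigma> (e i) = e k" by (auto simp: e_def)
    then show ?thesis using True ek by simp
  next
    case False
    then show ?thesis using that by (simp add: e_def)
  qed
  have "(\<Sum>r\<in>orbit \<sigma> x \<rightarrow>\<^sub>E {..<d}. \<Prod>y\<in>orbit \<sigma> x. A $$ (r y, r (\<sigma> y)))
      = (\<Sum>r\<in>orbit \<sigma> x \<rightarrow>\<^sub>E {..<d}. \<Prod>i<k. A $$ ((\<lambda>i\<in>{..<k}. r (e i)) i, (\<lambda>i\<in>{..<k}. r (e i)) (Suc i mod k)))"
  proof (rule sum.cong[OF refl])
    fix r
    have "(\<Prod>y\<in>orbit \<sigma> x. A $$ (r y, r (\<sigma> y))) = (\<Prod>i<k. A $$ (r (e i), r (\<sigma> (e i))))"
      using prod.reindex_bij_betw[OF bij, of "\<lambda>y. A $$ (r y, r (\<sigma> y))"] by simp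
    also have "\<dots> = (\<Prod>i<k. A $$ ((\<lambda>i\<in>{..<k}. r (e i)) i, (\<lambda>i\<in>{..<k}. r (e i)) (Suc i mod k)))"
      using k1 by (intro prod.cong refl) (simp add: step)
    finally show "(\<Prod>y\<in>orbit \<sigma> x. A $$ (r y, r (\<sigma> y)))
      = (\<Prod>i<k. A $$ ((\<lambda>i\<in>{..<k}. r (e i)) i, (\<lambda>i\<in>{..<k}. r (e i)) (Suc i mod k)))" .
  qed
  also have "\<dots> = (\<Sum>r\<in>{..<k} \<rightarrow>\<^sub>E {..<d}. \<Prod>i<k. A $$ (r i, r (Suc i mod k)))"
    by (rule sum_PiE_reindex[OF bij, of "\<lambda>r. \<Prod>i<k. A $$ (r i, r (Suc i mod k))"])
  also have "\<dots> = mat_trace (A ^\<^sub>m k)" using trace_power_as_sum[OF A k1] by simp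
  finally show ?thesis unfolding ck .
qed

lemma orbits_disjoint:
  assumes "permutation \<sigma>" "c \<in> orbit \<sigma> ` H" "c' \<in> orbit \<sigma> ` H" "c \<noteq> c'"
  shows "c \<inter> c' = {}"
proof -
  obtain x y where xy: "c = orbit \<sigma> x" "c' = orbit \<sigma> y" using assms by auto
  have "orbit \<sigma> x = orbit \<sigma> y" if "z \<in> orbit \<sigma> x" "z \<in> orbit \<sigma> y" for z
    using that cyclic_on_orbit'[OF assms(1)] orbit_cyclic_eq3 by metis
  then show ?thesis using xy assms(4) by auto
qed

text \<open>
  The index sum factorizes over the cycles of \<open>\<sigma>\<close>, and the sum along a cycle of length \<open>k\<close> is
  \<open>Tr (A\<^sup>k)\<close>.
\<close>

theorem permutation_trace:
  assumes A: "A \<in> carrier_mat d d" and \<sigma>: "permutation \<sigma>" and H: "finite H" "\<sigma> ` H \<subseteq> H"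
  shows "(\<Sum>r\<in>H \<rightarrow>\<^sub>E {..<d}. \<Prod>y\<in>H. A $$ (r y, r (\<sigma> y)))
       = (\<Prod>c\<in>orbit \<sigma> ` H. mat_trace (A ^\<^sub>m card c))"
proof -
  let ?C = "orbit \<sigma> ` H"
  have sub: "orbit \<sigma> x \<subseteq> H" if "x \<in> H" for x
  proof
    fix y assume "y \<in> orbit \<sigma> x"
    then show "y \<in> H" by induction (use that H in auto)
  qed
  have HU: "H = \<Union>?C" using sub permutation_self_in_orbit[OF \<sigma>] by blast
  have fin: "finite ?C" "\<And>c. c \<in> ?C \<Longrightarrow> finite c"
    using H(1) finite_subset[OF sub H(1)] by auto
  note disj = orbits_disjoint[OF \<sigma>, of _ H]
  have "(\<Prod>y\<in>H. A $$ (r y, r (\<sigma> y))) = (\<Prod>c\<in>?C. \<Prod>y\<in>c. A $$ (r y, r (\<sigma> y)))" for r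
    by (subst HU, rule prod.Union_disjoint[unfolded comp_def id_def]) (use fin disj in auto)
  then have "(\<Sum>r\<in>H \<rightarrow>\<^sub>E {..<d}. \<Prod>y\<in>H. A $$ (r y, r (\<sigma> y)))
      = (\<Sum>r\<in>\<Union>?C \<rightarrow>\<^sub>E {..<d}. \<Prod>c\<in>?C. \<Prod>y\<in>c. A $$ (r y, r (\<sigma> y)))"
    using HU by simp
  also have "\<dots> = (\<Sum>r\<in>\<Union>?C \<rightarrow>\<^sub>E {..<d}. \<Prod>c\<in>?C. \<Prod>y\<in>c. A $$ (r y, (if \<sigma> y \<in> c then r (\<sigma> y) else undefined)))"
    by (intro sum.cong prod.cong refl) (auto intro: orbit.step)
  also have "\<dots> = (\<Prod>c\<in>?C. \<Sum>r\<in>c \<rightarrow>\<^sub>E {..<d}. \<Prod>y\<in>c. A $$ (r y, (if \<sigma> y \<in> c then r (\<sigma> y) else undefined)))"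
    by (rule sum_PiE_Union[OF fin(1) disj]) (auto intro!: prod.cong)
  also have "\<dots> = (\<Prod>c\<in>?C. \<Sum>r\<in>c \<rightarrow>\<^sub>E {..<d}. \<Prod>y\<in>c. A $$ (r y, r (\<sigma> y)))"
    by (intro sum.cong prod.cong refl) (auto intro: orbit.step)
  also have "\<dots> = (\<Prod>c\<in>?C. mat_trace (A ^\<^sub>m card c))"
    by (intro prod.cong refl) (use cycle_trace[OF A \<sigma>] in auto)
  finally show ?thesis .
qed

section \<open>Index sums over a pair of pairings\<close>

lemma invariant_iff:
  "(\<forall>(x, y)\<in>graph_on P f \<union> graph_on P g. s x = s y) \<longleftrightarrow> (\<forall>x\<in>P. s x = s (f x)) \<and> (\<forall>x\<in>P. s x = s (g x))"
  by (simp add: graph_on_def ball_Un)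

text \<open>
  One point from each pair of \<open>\<delta>\<close>: products over pairs are written as products over such a set.
\<close>

definition transversal :: "'a set \<Rightarrow> ('a \<Rightarrow> 'a) \<Rightarrow> 'a set \<Rightarrow> bool" where
  "transversal P \<delta> H \<longleftrightarrow> H \<union> \<delta> ` H = P \<and> H \<inter> \<delta> ` H = {}"

lemma transversalD:
  assumes "transversal P \<delta> H" "\<delta> \<in> pairings P"
  shows "H \<subseteq> P" "x \<in> P \<Longrightarrow> \<delta> x \<in> H \<longleftrightarrow> x \<notin> H"
proof -
  note d = pairingsD[OF assms(2)]
  show "H \<subseteq> P" using assms by (auto simp: transversal_def)
  show "\<delta> x \<in> H \<longleftrightarrow> x \<notin> H" if x: "x \<in> P"
  proof
    assume "\<delta> x \<in> H"
    then have "\<delta> (\<delta> x) \<in> \<delta> ` H" by blast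
    then show "x \<notin> H" using assms(1) d(4) by (auto simp: transversal_def)
  next
    assume "x \<notin> H"
    then have "x \<in> \<delta> ` H" using x assms(1) by (auto simp: transversal_def)
    then show "\<delta> x \<in> H" using d(4) by auto
  qed
qed

lemma prod_transversal:
  assumes "\<delta> \<in> pairings P" "transversal P \<delta> H" "transversal P \<delta> H'"
    and g: "\<And>x. x \<in> P \<Longrightarrow> g (\<delta> x) = g x"
  shows "prod g H = prod g H'"
proof (rule prod.reindex_bij_witness[where i = "\<lambda>x. if x \<in> H then x else \<delta> x"
      and j = "\<lambda>x. if x \<in> H' then x else \<delta> x"])
  note d = pairingsD[OF assms(1)] and h = transversalD[OF assms(2,1)] and h' = transversalD[OF assms(3,1)]
  fix a
  show "a \<in> H \<Longrightarrow> (if (if a \<in> H' then a else \<delta> a) \<in> H then (if a \<in> H' then a else \<delta> a) else \<delta> (if a \<in> H' then a else \<delta> a)) = a"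
    "a \<in> H \<Longrightarrow> (if a \<in> H' then a else \<delta> a) \<in> H'"
    "a \<in> H' \<Longrightarrow> (if (if a \<in> H then a else \<delta> a) \<in> H' then (if a \<in> H then a else \<delta> a) else \<delta> (if a \<in> H then a else \<delta> a)) = a"
    "a \<in> H' \<Longrightarrow> (if a \<in> H then a else \<delta> a) \<in> H"
    "a \<in> H \<Longrightarrow> g (if a \<in> H' then a else \<delta> a) = g a"
    using h h' d g by auto
qed

text \<open>
  The cycles of \<open>\<delta> \<circ> \<tau>\<close> come in couples interchanged by \<open>\<delta>\<close>
  (\<open>pairing_not_in_orbit\<close>); \<open>H\<close> consists of one cycle from each couple. A maximal invariant
  set that avoids its \<open>\<delta>\<close>-image is such an \<open>H\<close>, because a further cycle could be added to any
  smaller one. The particular cycles of a premap are one such choice.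
\<close>

lemma ex_cycle_transversal:
  assumes fin: "finite P" and \<delta>: "\<delta> \<in> pairings P" and \<tau>: "\<tau> \<in> pairings P"
  shows "\<exists>H. transversal P \<delta> H \<and> (\<delta> \<circ> \<tau>) ` H \<subseteq> H"
proof -
  note d = pairingsD[OF \<delta>] and t = pairingsD[OF \<tau>]
  let ?p = "\<delta> \<circ> \<tau>"
  let ?good = "\<lambda>H. H \<subseteq> P \<and> ?p ` H \<subseteq> H \<and> H \<inter> \<delta> ` H = {}"
  have pp: "?p permutes P" using d(1) t(1) by (intro permutes_compose)
  have perm: "permutation ?p" using pp fin permutation_permutes by blast
  define G where "G = {H. ?good H}"
  have "finite G" unfolding G_def by (rule finite_subset[of _ "Pow P"]) (use fin in auto)
  moreover have "G \<noteq> {}" unfolding G_def by blast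
  ultimately have "\<exists>H\<in>G. \<forall>H'\<in>G. H \<subseteq> H' \<longrightarrow> H = H'" by (rule finite_has_maximal)
  then obtain H where HG: "H \<in> G" and m: "\<forall>H'\<in>G. H \<subseteq> H' \<longrightarrow> H = H'" by (elim bexE)
  have H: "?good H" using HG unfolding G_def by (rule CollectD)
  have max: "H = H'" if "?good H'" "H \<subseteq> H'" for H'
  proof -
    have "H' \<in> G" unfolding G_def by (rule CollectI[of ?good, OF that(1)])
    then show ?thesis using m that(2) by metis
  qed
  have bij: "?p ` H = H"
    using H fin finite_subset[of H P] permutes_inj[OF pp] by (intro endo_inj_surj) (auto intro: inj_on_subset)
  have "P \<subseteq> H \<union> \<delta> ` H"
  proof (rule ccontr)
    assume "\<not> P \<subseteq> H \<union> \<delta> ` H"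
    then obtain x where x: "x \<in> P" "x \<notin> H" "x \<notin> \<delta> ` H" by auto
    let ?O = "orbit ?p x"
    have OP: "?O \<subseteq> P" using permutes_orbit_subset[OF pp x(1)] .
    have dinv: "?p ` (\<delta> ` H) \<subseteq> \<delta> ` H"
    proof clarify
      fix h assume "h \<in> H"
      then obtain k where k: "k \<in> H" "h = ?p k" using bij by blast
      then have "?p (\<delta> h) = \<delta> (\<tau> (\<tau> k))" by (simp add: d t)
      also have "\<dots> = \<delta> k" by (simp add: t)
      finally show "?p (\<delta> h) \<in> \<delta> ` H" using k by auto
    qed
    have reaches_x: "x \<in> S" if "?p ` S \<subseteq> S" "y \<in> ?O" "y \<in> S" for S y
    proof -
      have "x \<in> orbit ?p y" using that(2) permutation_self_in_orbit[OF perm] orbit_swap by metis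
      then show ?thesis by induction (use that in auto)
    qed
    have 1: "?O \<inter> \<delta> ` H = {}" "?O \<inter> H = {}" using reaches_x[OF dinv] reaches_x[of H] H x by auto
    have 2: "?O \<inter> \<delta> ` ?O = {}"
    proof (rule ccontr)
      assume "?O \<inter> \<delta> ` ?O \<noteq> {}"
      then obtain z where z: "z \<in> ?O" "\<delta> z \<in> ?O" by auto
      then have "orbit ?p z = ?O" using cyclic_on_orbit'[OF perm] orbit_cyclic_eq3 by metis
      then show False using pairing_not_in_orbit[OF \<delta> \<tau>, of z] z OP by auto
    qed
    have "H \<inter> \<delta> ` ?O = {}" 
    proof -
      have False if "h \<in> H" "y \<in> ?O" "h = \<delta> y" for h y
      proof -
        have "y = \<delta> h" using that(3) d(4) by simp
        then show False using 1(1) that(1,2) by blast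
      qed
      then show ?thesis by blast
    qed

    moreover have "?p ` (H \<union> ?O) \<subseteq> H \<union> ?O" using H orbit.step[of _ ?p x] by blast
    ultimately have "?good (H \<union> ?O)" using H OP 1 2 by (simp add: image_Un Int_Un_distrib Int_Un_distrib2)
    from max[OF this] have "?O \<subseteq> H" by auto
    then show False using x permutation_self_in_orbit[OF perm, of x] by auto
  qed
  moreover have "\<delta> ` H \<subseteq> P" using H d(2) by auto
  ultimately show ?thesis using H by (auto simp: transversal_def intro!: exI[of _ H])
qed

lemma symmetric_entry:
  assumes "D \<in> carrier_mat d d" "transpose_mat D = D" "a < d" "b < d"
  shows "D $$ (a, b) = D $$ (b, a)"
  using assms by (metis carrier_matD index_transpose_mat(1))

text \<open>
  The factors \<open>D\<close> of the expanded trace: one for each pair of \<open>\<delta>\<close>, evaluated at the row indices \<open>r\<close>.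
\<close>

definition edge_prod :: "real mat \<Rightarrow> ('a \<Rightarrow> 'a) \<Rightarrow> 'a set \<Rightarrow> ('a \<Rightarrow> nat) \<Rightarrow> real" where
  "edge_prod D \<delta> T r = (\<Prod>x\<in>T. D $$ (r x, r (\<delta> x)))"

text \<open>
  A row index that is constant on the pairs of \<open>\<tau>\<close> is determined by its values on \<open>H\<close>, since \<open>\<tau>\<close>
  interchanges \<open>H\<close> with its complement. On \<open>H\<close> the product of the entries of \<open>D\<close> runs along the cycles of
  \<open>\<delta> \<circ> \<tau>\<close>. The symmetry of \<open>D\<close> is what allows to choose the representatives of the pairs of
  \<open>\<delta>\<close> freely.
\<close>

lemma sum_edge_prod:
  assumes fin: "finite P" and \<delta>: "\<delta> \<in> pairings P" and \<tau>: "\<tau> \<in> pairings P"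
    and T: "transversal P \<delta> T" and H: "transversal P \<delta> H" and inv: "(\<delta> \<circ> \<tau>) ` H \<subseteq> H"
    and D: "D \<in> carrier_mat d d" "transpose_mat D = D"
  shows "(\<Sum>r | r \<in> P \<rightarrow>\<^sub>E {..<d} \<and> (\<forall>x\<in>P. r (\<tau> x) = r x). edge_prod D \<delta> T r)
     = (\<Prod>c\<in>orbit (\<delta> \<circ> \<tau>) ` H. mat_trace (D ^\<^sub>m card c))"
proof -
  note d = pairingsD[OF \<delta>] and t = pairingsD[OF \<tau>] and h = transversalD[OF H \<delta>]
  let ?p = "\<delta> \<circ> \<tau>"
  have pp: "?p permutes P" using d(1) t(1) by (intro permutes_compose)
  have perm: "permutation ?p" using pp fin permutation_permutes by blast
  have finH: "finite H" using h(1) fin finite_subset by auto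
  have bij: "?p ` H = H" using inv finH permutes_inj[OF pp] by (intro endo_inj_surj) (auto intro: inj_on_subset)
  have bijb: "bij_betw ?p H H" using bij permutes_inj[OF pp] by (auto simp: bij_betw_def intro: inj_on_subset)
  have tauH: "\<tau> x \<in> H" if "x \<in> P" "x \<notin> H" for x
  proof -
    have "\<delta> x \<in> H" using h that by auto
    then obtain k where k: "k \<in> H" "\<delta> x = \<delta> (\<tau> k)" using bij by auto
    then have "x = \<tau> k" using d(4) by metis
    then show ?thesis using k t(4) by simp
  qed
  have tauH': "\<tau> x \<notin> H" if "x \<in> H" for x
    using inv that h(2)[of "\<tau> x"] h(1) t(2) by auto
  have "(\<Sum>r | r \<in> P \<rightarrow>\<^sub>E {..<d} \<and> (\<forall>x\<in>P. r (\<tau> x) = r x). edge_prod D \<delta> T r)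
      = (\<Sum>r\<in>H \<rightarrow>\<^sub>E {..<d}. \<Prod>y\<in>H. D $$ (r y, r (?p y)))"
  proof (rule sum.reindex_bij_witness[where j = "\<lambda>r. restrict r H" and
        i = "\<lambda>r. \<lambda>x\<in>P. if x \<in> H then r x else r (\<tau> x)"])
    fix r assume "r \<in> {r. r \<in> P \<rightarrow>\<^sub>E {..<d} \<and> (\<forall>x\<in>P. r (\<tau> x) = r x)}"
    then have r: "r \<in> P \<rightarrow>\<^sub>E {..<d}" "\<And>x. x \<in> P \<Longrightarrow> r (\<tau> x) = r x" by auto
    show "(\<lambda>x\<in>P. if x \<in> H then restrict r H x else restrict r H (\<tau> x)) = r"
      using r tauH by (auto simp: fun_eq_iff PiE_def extensional_def)
    show "restrict r H \<in> H \<rightarrow>\<^sub>E {..<d}" using r h by auto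
    have rd: "r x < d" if "x \<in> P" for x using r that by auto
    have "edge_prod D \<delta> T r = (\<Prod>x\<in>H. D $$ (r x, r (\<delta> x)))" unfolding edge_prod_def
    proof (rule prod_transversal[OF \<delta> T H])
      fix x assume x: "x \<in> P"
      show "D $$ (r (\<delta> x), r (\<delta> (\<delta> x))) = D $$ (r x, r (\<delta> x))"
        unfolding d(4) by (rule symmetric_entry[OF D rd[OF d(2)[OF x]] rd[OF x]])
    qed
    also have "\<dots> = (\<Prod>y\<in>H. D $$ (r (?p y), r (\<delta> (?p y))))"
      using prod.reindex_bij_betw[OF bijb, of "\<lambda>x. D $$ (r x, r (\<delta> x))"] by simp
    also have "\<dots> = (\<Prod>y\<in>H. D $$ (restrict r H y, restrict r H (?p y)))"
    proof (rule prod.cong[OF refl])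
      fix y assume y: "y \<in> H"
      then have yP: "y \<in> P" "?p y \<in> H" using h inv by auto
      then have "r (\<delta> (?p y)) = r y" using r d(4) by simp
      moreover have "D $$ (r (?p y), r y) = D $$ (r y, r (?p y))"
        using yP h by (intro symmetric_entry[OF D] rd) auto
      ultimately show "D $$ (r (?p y), r (\<delta> (?p y))) = D $$ (restrict r H y, restrict r H (?p y))"
        using y yP by simp
    qed
    finally show "(\<Prod>y\<in>H. D $$ (restrict r H y, restrict r H (?p y))) = edge_prod D \<delta> T r" by simp
  next
    fix r assume r: "r \<in> H \<rightarrow>\<^sub>E {..<d}"
    show "restrict (\<lambda>x\<in>P. if x \<in> H then r x else r (\<tau> x)) H = r"
      using r h by (auto simp: fun_eq_iff PiE_def extensional_def)
    show "(\<lambda>x\<in>P. if x \<in> H then r x else r (\<tau> x)) \<in> {r. r \<in> P \<rightarrow>\<^sub>E {..<d} \<and> (\<forall>x\<in>P. r (\<tau> x) = r x)}"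
      using r tauH tauH' t(2,4) by (auto simp: PiE_def Pi_def)
  qed
  also have "\<dots> = (\<Prod>c\<in>orbit ?p ` H. mat_trace (D ^\<^sub>m card c))"
    by (rule permutation_trace[OF D(1) perm finH inv])
  finally show ?thesis .
qed

lemma one_mat_pow: "1\<^sub>m d ^\<^sub>m k = (1\<^sub>m d :: real mat)"
  by (induction k) auto

text \<open>
  Both numbers are the exponent of \<open>2\<close> in the index sum for \<open>D = 1\<close> of size \<open>2\<close>: it counts the index functions
  that are constant on components, and it is a product of one factor \<open>Tr 1 = 2\<close> per cycle.
\<close>

lemma card_cycles_transversal:
  assumes fin: "finite P" and \<delta>: "\<delta> \<in> pairings P" and \<tau>: "\<tau> \<in> pairings P"
    and H: "transversal P \<delta> H" and inv: "(\<delta> \<circ> \<tau>) ` H \<subseteq> H"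
  shows "card (orbit (\<delta> \<circ> \<tau>) ` H) = ncomp2 P \<delta> \<tau>"
proof -
  note d = pairingsD[OF \<delta>] and t = pairingsD[OF \<tau>] and h = transversalD[OF H \<delta>]
  have finH: "finite H" using h(1) fin finite_subset by auto
  let ?I = "1\<^sub>m 2 :: real mat"
  let ?G = "graph_on P \<delta> \<union> graph_on P \<tau>"
  have D: "?I \<in> carrier_mat 2 2" "transpose_mat ?I = ?I" by auto
  let ?R = "{r. r \<in> P \<rightarrow>\<^sub>E {..<2} \<and> (\<forall>x\<in>P. r (\<tau> x) = r x)}"
  let ?R' = "{r \<in> P \<rightarrow>\<^sub>E {..<2::nat}. \<forall>(x, y)\<in>?G. r x = r y}"
  have "edge_prod ?I \<delta> H r = (if r \<in> ?R' then 1 else 0)" if r: "r \<in> ?R" for r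
  proof -
    have rd: "r x < 2" if "x \<in> P" for x using r that by auto
    have "edge_prod ?I \<delta> H r = (\<Prod>x\<in>H. if r x = r (\<delta> x) then 1 else 0)"
      unfolding edge_prod_def
    proof (rule prod.cong[OF refl])
      fix x assume "x \<in> H"
      then have "r x < 2" "r (\<delta> x) < 2" using h(1) d(2) rd by auto
      then show "?I $$ (r x, r (\<delta> x)) = (if r x = r (\<delta> x) then 1 else 0)" by simp
    qed
    also have "\<dots> = (if \<forall>x\<in>H. r x = r (\<delta> x) then 1 else 0)"
      using finH by (auto intro!: prod_zero prod.neutral)
    also have "(\<forall>x\<in>H. r x = r (\<delta> x)) \<longleftrightarrow> (\<forall>x\<in>P. r x = r (\<delta> x))"
    proof (intro iffI ballI)
      fix x assume a: "\<forall>x\<in>H. r x = r (\<delta> x)" and x: "x \<in> P"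
      show "r x = r (\<delta> x)"
      proof (cases "x \<in> H")
        case False
        then have "r (\<delta> x) = r (\<delta> (\<delta> x))" using a h(2)[OF x] by blast
        then show ?thesis by (simp add: d(4))
      qed (use a in blast)
    qed (use h(1) in blast)
    also have "\<dots> \<longleftrightarrow> r \<in> ?R'"
    proof -
      have "r \<in> P \<rightarrow>\<^sub>E {..<2}" "\<forall>x\<in>P. r x = r (\<tau> x)" using r by auto
      then show ?thesis unfolding mem_Collect_eq invariant_iff by blast
    qed
    finally show ?thesis .
  qed
  then have "(\<Sum>r\<in>?R. edge_prod ?I \<delta> H r) = (\<Sum>r\<in>?R. if r \<in> ?R' then 1 else 0)"
    by (intro sum.cong refl) auto
  also have "\<dots> = real (card (?R \<inter> ?R'))"
    using fin by (subst sum.inter_restrict[symmetric]) (auto intro: finite_subset[OF _ finite_PiE[of P "\<lambda>_. {..<2}"]])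
  also have "?R \<inter> ?R' = ?R'"
  proof -
    have "r \<in> ?R" if "r \<in> ?R'" for r
      using that unfolding mem_Collect_eq invariant_iff by (metis (no_types))
    then show ?thesis by blast
  qed
  also have "card ?R' = 2 ^ ncomp P ?G"
    using graph_on_subset[OF d(1)] graph_on_subset[OF t(1)] card_invariant_functions[OF fin, of ?G "{..<2::nat}"] by simp
  finally have L: "(\<Sum>r\<in>?R. edge_prod ?I \<delta> H r) = 2 ^ ncomp P ?G" by simp
  have "mat_trace ?I = 2" by (simp add: mat_trace_def)
  then have "(\<Sum>r\<in>?R. edge_prod ?I \<delta> H r) = 2 ^ card (orbit (\<delta> \<circ> \<tau>) ` H)"
    unfolding sum_edge_prod[OF fin \<delta> \<tau> H H inv D] by (simp add: one_mat_pow)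
  then have "(2::real) ^ card (orbit (\<delta> \<circ> \<tau>) ` H) = 2 ^ ncomp P ?G" using L by simp
  then show ?thesis by simp
qed

text \<open>
  The half that represents the components of \<open>\<delta> \<union> \<tau>\<close> is chosen before \<open>D\<close> is known, so that
  \<open>norm_trace\<close> depends on \<open>D\<close> only through its moments. In particular it is unchanged by
  amplification.
\<close>

definition cycle_half :: "'a set \<Rightarrow> ('a \<Rightarrow> 'a) \<Rightarrow> ('a \<Rightarrow> 'a) \<Rightarrow> 'a set" where
  "cycle_half P \<delta> \<tau> = (SOME H. transversal P \<delta> H \<and> (\<delta> \<circ> \<tau>) ` H \<subseteq> H)"

definition norm_trace :: "'a set \<Rightarrow> ('a \<Rightarrow> 'a) \<Rightarrow> ('a \<Rightarrow> 'a) \<Rightarrow> real mat \<Rightarrow> real" where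
  "norm_trace P \<delta> \<tau> D = (\<Prod>c\<in>orbit (\<delta> \<circ> \<tau>) ` cycle_half P \<delta> \<tau>. moment (card c) D)"

lemma cycle_half:
  assumes "finite P" "\<delta> \<in> pairings P" "\<tau> \<in> pairings P"
  shows "transversal P \<delta> (cycle_half P \<delta> \<tau>)" "(\<delta> \<circ> \<tau>) ` cycle_half P \<delta> \<tau> \<subseteq> cycle_half P \<delta> \<tau>"
  using someI_ex[OF ex_cycle_transversal[OF assms]] unfolding cycle_half_def by auto

lemma prod_mat_trace:
  assumes "D \<in> carrier_mat d d" "d \<ge> 1"
  shows "(\<Prod>c\<in>C. mat_trace (D ^\<^sub>m card c)) = real d ^ card C * (\<Prod>c\<in>C. moment (card c) D)"
proof -
  have "(\<Prod>c\<in>C. mat_trace (D ^\<^sub>m card c)) = (\<Prod>c\<in>C. real d * moment (card c) D)"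
    using assms by (intro prod.cong refl) (auto simp: moment_def)
  then show ?thesis by (simp add: prod.distrib)
qed

lemma norm_trace_transversal:
  assumes fin: "finite P" and \<delta>: "\<delta> \<in> pairings P" and \<tau>: "\<tau> \<in> pairings P"
    and H: "transversal P \<delta> H" and inv: "(\<delta> \<circ> \<tau>) ` H \<subseteq> H"
    and D: "D \<in> carrier_mat d d" "transpose_mat D = D" "d \<ge> 1"
  shows "(\<Prod>c\<in>orbit (\<delta> \<circ> \<tau>) ` H. moment (card c) D) = norm_trace P \<delta> \<tau> D"
proof -
  let ?n = "ncomp2 P \<delta> \<tau>"
  note ch = cycle_half[OF fin \<delta> \<tau>]
  let ?L = "\<Sum>r | r \<in> P \<rightarrow>\<^sub>E {..<d} \<and> (\<forall>x\<in>P. r (\<tau> x) = r x). edge_prod D \<delta> H r"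
  have "?L = real d ^ ?n * (\<Prod>c\<in>orbit (\<delta> \<circ> \<tau>) ` H. moment (card c) D)"
    unfolding sum_edge_prod[OF fin \<delta> \<tau> H H inv D(1,2)] prod_mat_trace[OF D(1,3)]
      card_cycles_transversal[OF fin \<delta> \<tau> H inv] ..
  moreover have "?L = real d ^ ?n * norm_trace P \<delta> \<tau> D"
    unfolding sum_edge_prod[OF fin \<delta> \<tau> H ch D(1,2)] prod_mat_trace[OF D(1,3)]
      card_cycles_transversal[OF fin \<delta> \<tau> ch] norm_trace_def ..
  ultimately have "real d ^ ?n * (\<Prod>c\<in>orbit (\<delta> \<circ> \<tau>) ` H. moment (card c) D) = real d ^ ?n * norm_trace P \<delta> \<tau> D"
    by (rule trans[OF sym])
  then show ?thesis using D(3) by simp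
qed

text \<open>
  Row and column indices are summed independently: the former gives traces along the components of
  \<open>\<delta> \<union> \<tau>\<close>, the latter only counts the components of \<open>\<epsilon> \<union> \<tau>\<close>.
\<close>

theorem index_sum:
  assumes fin: "finite P" and \<delta>: "\<delta> \<in> pairings P" and \<epsilon>: "\<epsilon> \<in> pairings P" and \<tau>: "\<tau> \<in> pairings P"
    and T: "transversal P \<delta> T" and D: "D \<in> carrier_mat d d" "transpose_mat D = D" "d \<ge> 1"
  shows "(\<Sum>u | u \<in> P \<rightarrow>\<^sub>E {..<d} \<times> {..<n} \<and> (\<forall>x\<in>P. snd (u (\<epsilon> x)) = snd (u x)) \<and> (\<forall>x\<in>P. u (\<tau> x) = u x).
        edge_prod D \<delta> T (\<lambda>x. fst (u x)))
     = real n ^ ncomp2 P \<epsilon> \<tau> * real d ^ ncomp2 P \<delta> \<tau>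
        * norm_trace P \<delta> \<tau> D"
proof -
  note d = pairingsD[OF \<delta>] and t = pairingsD[OF \<tau>] and e = pairingsD[OF \<epsilon>] and tt = transversalD[OF T \<delta>]
  let ?U = "{u. u \<in> P \<rightarrow>\<^sub>E {..<d} \<times> {..<n} \<and> (\<forall>x\<in>P. snd (u (\<epsilon> x)) = snd (u x)) \<and> (\<forall>x\<in>P. u (\<tau> x) = u x)}"
  let ?R = "{r. r \<in> P \<rightarrow>\<^sub>E {..<d} \<and> (\<forall>x\<in>P. r (\<tau> x) = r x)}"
  let ?G = "graph_on P \<epsilon> \<union> graph_on P \<tau>"
  let ?S = "{s \<in> P \<rightarrow>\<^sub>E {..<n}. \<forall>(x, y)\<in>?G. s x = s y}"
  have "(\<Sum>u\<in>?U. edge_prod D \<delta> T (\<lambda>x. fst (u x))) = (\<Sum>(r, s)\<in>?R \<times> ?S. edge_prod D \<delta> T r)"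
  proof (rule sum.reindex_bij_witness[where i = "\<lambda>(r, s). \<lambda>x\<in>P. (r x, s x)"
        and j = "\<lambda>u. (\<lambda>x\<in>P. fst (u x), \<lambda>x\<in>P. snd (u x))"])
    fix u assume u: "u \<in> ?U"
    show "(case (\<lambda>x\<in>P. fst (u x), \<lambda>x\<in>P. snd (u x)) of (r, s) \<Rightarrow> \<lambda>x\<in>P. (r x, s x)) = u"
      using u by (auto simp: fun_eq_iff PiE_def extensional_def)
    show "(\<lambda>x\<in>P. fst (u x), \<lambda>x\<in>P. snd (u x)) \<in> ?R \<times> ?S"
      using u t(2) e(2) unfolding mem_Times_iff mem_Collect_eq invariant_iff by (auto simp: PiE_def Pi_def mem_Times_iff)
    show "(case (\<lambda>x\<in>P. fst (u x), \<lambda>x\<in>P. snd (u x)) of (r, s) \<Rightarrow> edge_prod D \<delta> T r) = edge_prod D \<delta> T (\<lambda>x. fst (u x))"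
      unfolding edge_prod_def prod.case using tt(1) d(2) by (intro prod.cong refl) auto
  next
    fix p assume p: "p \<in> ?R \<times> ?S"
    then obtain r s where rs: "p = (r, s)" "r \<in> ?R" "s \<in> ?S" by auto
    show "(\<lambda>x\<in>P. fst ((case p of (r, s) \<Rightarrow> \<lambda>x\<in>P. (r x, s x)) x), \<lambda>x\<in>P. snd ((case p of (r, s) \<Rightarrow> \<lambda>x\<in>P. (r x, s x)) x)) = p"
      using rs by (auto simp: fun_eq_iff PiE_def extensional_def)
    have "s (\<epsilon> x) = s x" "s (\<tau> x) = s x" if "x \<in> P" for x
      using rs(3) that unfolding mem_Collect_eq invariant_iff by auto
    then show "(case p of (r, s) \<Rightarrow> \<lambda>x\<in>P. (r x, s x)) \<in> ?U"
      using rs t(2) e(2) by (auto simp: PiE_def Pi_def)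
  qed
  also have "\<dots> = (\<Sum>r\<in>?R. edge_prod D \<delta> T r) * real (card ?S)"
    by (simp add: sum.cartesian_product[symmetric] sum_distrib_left sum_distrib_right mult.commute)
  also have "card ?S = n ^ ncomp P ?G"
    using graph_on_subset[OF e(1)] graph_on_subset[OF t(1)] card_invariant_functions[OF fin, of ?G "{..<n}"] by simp
  also have "(\<Sum>r\<in>?R. edge_prod D \<delta> T r) = real d ^ ncomp2 P \<delta> \<tau> * norm_trace P \<delta> \<tau> D"
    unfolding sum_edge_prod[OF fin \<delta> \<tau> T cycle_half[OF fin \<delta> \<tau>] D(1,2)] norm_trace_def
      prod_mat_trace[OF D(1,3)] card_cycles_transversal[OF fin \<delta> \<tau> cycle_half[OF fin \<delta> \<tau>]] by simp
  finally show ?thesis by (simp add: mult_ac)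
qed

section \<open>Traces of Wishart matrices as Gaussian polynomials\<close>

text \<open>
  A polynomial in the entries of \<open>Z\<close>, indexed by functions \<open>u\<close> that attach a row and a column index
  to each point; points paired by \<open>\<epsilon>\<close> share their column index. For circles it is a power of
  \<open>Tr (W\<^sup>l)\<close>; see \<open>wishart_trace_eq_trace_sum\<close> and \<open>trace_sum_family\<close>.
\<close>

definition trace_sum :: "nat \<Rightarrow> real mat \<Rightarrow> 'a set \<Rightarrow> ('a \<Rightarrow> 'a) \<Rightarrow> ('a \<Rightarrow> 'a) \<Rightarrow> 'a set \<Rightarrow> (nat \<times> nat \<Rightarrow> real) \<Rightarrow> real" where
  "trace_sum n D P \<delta> \<epsilon> T \<omega> =
    (\<Sum>u | u \<in> P \<rightarrow>\<^sub>E {..<dim_row D} \<times> {..<n} \<and> (\<forall>x\<in>P. snd (u (\<epsilon> x)) = snd (u x)).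
        edge_prod D \<delta> T (\<lambda>x. fst (u x)) * (\<Prod>x\<in>P. \<omega> (u x)))"

definition pairing_weight :: "nat \<Rightarrow> real mat \<Rightarrow> 'a set \<Rightarrow> ('a \<Rightarrow> 'a) \<Rightarrow> ('a \<Rightarrow> 'a) \<Rightarrow> ('a \<Rightarrow> 'a) \<Rightarrow> real" where
  "pairing_weight n D P \<delta> \<epsilon> \<tau> = (1 / real n) ^ (card P div 2)
     * (real n ^ ncomp2 P \<epsilon> \<tau>
     * real (dim_row D) ^ ncomp2 P \<delta> \<tau> * norm_trace P \<delta> \<tau> D)"

lemma PiE_image_subset: "u \<in> P \<rightarrow>\<^sub>E F \<Longrightarrow> u ` P \<subseteq> F"
  by (rule image_subsetI) (rule PiE_mem)

lemma finite_index_functions: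
  "finite P \<Longrightarrow> finite {u. u \<in> P \<rightarrow>\<^sub>E {..<d::nat} \<times> {..<n::nat} \<and> Q u}"
  by (rule finite_subset[of _ "P \<rightarrow>\<^sub>E {..<d} \<times> {..<n}"]) (auto intro: finite_PiE)

text \<open>
  Wick's formula for each monomial, followed by exchanging the sums over indices and pairings.
\<close>

theorem genus_expansion:
  assumes n: "n \<ge> 1" and fin: "finite P" and \<delta>: "\<delta> \<in> pairings P" and \<epsilon>: "\<epsilon> \<in> pairings P"
    and T: "transversal P \<delta> T" and D: "D \<in> carrier_mat d d" "transpose_mat D = D" "d \<ge> 1"
  shows "has_bochner_integral (gaussian_space d n) (trace_sum n D P \<delta> \<epsilon> T)
    (\<Sum>\<tau>\<in>pairings P. pairing_weight n D P \<delta> \<epsilon> \<tau>)"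
proof -
  let ?U = "{u. u \<in> P \<rightarrow>\<^sub>E {..<d} \<times> {..<n} \<and> (\<forall>x\<in>P. snd (u (\<epsilon> x)) = snd (u x))}"
  let ?c = "(1 / real n) ^ (card P div 2)"
  let ?A = "\<lambda>u. edge_prod D \<delta> T (\<lambda>x. fst (u x))"
  have dr: "dim_row D = d" using D by auto
  have finU: "finite ?U" by (rule finite_index_functions[OF fin])
  have "has_bochner_integral (gaussian_space d n)
      (\<lambda>\<omega>. \<Sum>u\<in>?U. ?A u * (\<Prod>x\<in>P. \<omega> (u x)))
      (\<Sum>u\<in>?U. ?A u * (?c * real (card {\<tau> \<in> pairings P. \<forall>x\<in>P. u (\<tau> x) = u x})))"
    by (intro has_bochner_integral_sum has_bochner_integral_mult_right gaussian_product n fin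
        PiE_image_subset) blast
  also have "(\<Sum>u\<in>?U. ?A u * (?c * real (card {\<tau> \<in> pairings P. \<forall>x\<in>P. u (\<tau> x) = u x})))
      = (\<Sum>u\<in>?U. \<Sum>\<tau>\<in>pairings P. if \<forall>x\<in>P. u (\<tau> x) = u x then ?c * ?A u else 0)"
    using finite_pairings[OF fin]
    by (intro sum.cong refl) (simp add: sum.inter_filter[symmetric] mult_ac)
  also have "\<dots> = (\<Sum>\<tau>\<in>pairings P. \<Sum>u\<in>?U. if \<forall>x\<in>P. u (\<tau> x) = u x then ?c * ?A u else 0)"
    by (rule sum.swap)
  also have "\<dots> = (\<Sum>\<tau>\<in>pairings P. pairing_weight n D P \<delta> \<epsilon> \<tau>)"
  proof (rule sum.cong[OF refl])
    fix \<tau> assume \<tau>: "\<tau> \<in> pairings P"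
    have "(\<Sum>u\<in>?U. if \<forall>x\<in>P. u (\<tau> x) = u x then ?c * ?A u else 0)
        = ?c * (\<Sum>u | u \<in> P \<rightarrow>\<^sub>E {..<d} \<times> {..<n} \<and> (\<forall>x\<in>P. snd (u (\<epsilon> x)) = snd (u x)) \<and> (\<forall>x\<in>P. u (\<tau> x) = u x). ?A u)"
      unfolding sum.inter_filter[OF finU, symmetric] sum_distrib_left by (intro sum.cong) auto
    also have "\<dots> = pairing_weight n D P \<delta> \<epsilon> \<tau>"
      unfolding index_sum[OF fin \<delta> \<epsilon> \<tau> T D] pairing_weight_def dr ..
    finally show "(\<Sum>u\<in>?U. if \<forall>x\<in>P. u (\<tau> x) = u x then ?c * ?A u else 0) = pairing_weight n D P \<delta> \<epsilon> \<tau>" .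
  qed
  finally show ?thesis unfolding trace_sum_def[abs_def] dr .
qed

lemma trace_sum_times_norm:
  assumes n: "n \<ge> 1" and fin: "finite P" and dr: "dim_row D = d"
  shows "has_bochner_integral (gaussian_space d n)
    (\<lambda>\<omega>. (\<Sum>q\<in>{..<d} \<times> {..<n}. n * (\<omega> q)\<^sup>2) * trace_sum n D P \<delta> \<epsilon> T \<omega>)
    ((d * n + card P) * (\<integral>\<omega>. trace_sum n D P \<delta> \<epsilon> T \<omega> \<partial>gaussian_space d n))"
proof -
  let ?U = "{u. u \<in> P \<rightarrow>\<^sub>E {..<d} \<times> {..<n} \<and> (\<forall>x\<in>P. snd (u (\<epsilon> x)) = snd (u x))}"
  let ?A = "\<lambda>u. edge_prod D \<delta> T (\<lambda>x. fst (u x))"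
  let ?N = "\<lambda>\<omega>. \<Sum>q\<in>{..<d} \<times> {..<n}. real n * (\<omega> q :: real)\<^sup>2"
  let ?E = "\<lambda>u. \<integral>\<omega>. (\<Prod>x\<in>P. \<omega> (u x)) \<partial>gaussian_space d n"
  have finU: "finite ?U" by (rule finite_index_functions[OF fin])
  have im: "u ` P \<subseteq> {..<d} \<times> {..<n}" if "u \<in> ?U" for u
    using that by (intro PiE_image_subset) blast
  have "has_bochner_integral (gaussian_space d n)
    (\<lambda>\<omega>. \<Sum>u\<in>?U. ?A u * (?N \<omega> * (\<Prod>x\<in>P. \<omega> (u x)))) (\<Sum>u\<in>?U. ?A u * ((d * n + card P) * ?E u))"
    by (intro has_bochner_integral_sum has_bochner_integral_mult_right gaussian_product_times_norm n fin im)
  moreover have "(\<integral>\<omega>. trace_sum n D P \<delta> \<epsilon> T \<omega> \<partial>gaussian_space d n) = (\<Sum>u\<in>?U. ?A u * ?E u)"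
  proof (rule has_bochner_integral_integral_eq)
    have "has_bochner_integral (gaussian_space d n) (\<lambda>\<omega>. \<Sum>u\<in>?U. ?A u * (\<Prod>x\<in>P. \<omega> (u x))) (\<Sum>u\<in>?U. ?A u * ?E u)"
    proof (intro has_bochner_integral_sum has_bochner_integral_mult_right has_bochner_integral_integrable)
      fix u assume "u \<in> ?U"
      from gaussian_product[OF n fin im[OF this]]
      show "integrable (gaussian_space d n) (\<lambda>\<omega>. \<Prod>x\<in>P. \<omega> (u x))" by (rule integrable.intros)
    qed
    then show "has_bochner_integral (gaussian_space d n) (trace_sum n D P \<delta> \<epsilon> T) (\<Sum>u\<in>?U. ?A u * ?E u)"
      unfolding trace_sum_def[abs_def] dr .
  qed
  ultimately show ?thesis
    unfolding trace_sum_def dr by (simp add: sum_distrib_left mult_ac)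
qed

lemma sum_filter_PiE:
  "finite P \<Longrightarrow> (\<Sum>u | u \<in> P \<rightarrow>\<^sub>E {..<d::nat} \<times> {..<n::nat} \<and> Q u. f u)
    = (\<Sum>u\<in>P \<rightarrow>\<^sub>E {..<d} \<times> {..<n}. if Q u then f u else (0::real))"
  by (subst sum.inter_filter[symmetric]) (auto intro: finite_PiE)

lemma edge_prod_restrict:
  assumes "T \<subseteq> P" "\<delta> ` P \<subseteq> P"
  shows "edge_prod D \<delta> T (\<lambda>x. fst (restrict u P x)) = edge_prod D \<delta> T (\<lambda>x. fst (u x))"
  unfolding edge_prod_def using assms by (intro prod.cong refl) auto

lemma trace_sum_Un:
  assumes fin: "finite A" "finite B" and disj: "A \<inter> B = {}"
    and cl: "\<delta> ` A \<subseteq> A" "\<delta> ` B \<subseteq> B" "\<epsilon> ` A \<subseteq> A" "\<epsilon> ` B \<subseteq> B" and T: "TA \<subseteq> A" "TB \<subseteq> B"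
  shows "trace_sum n D (A \<union> B) \<delta> \<epsilon> (TA \<union> TB) \<omega> = trace_sum n D A \<delta> \<epsilon> TA \<omega> * trace_sum n D B \<delta> \<epsilon> TB \<omega>"
proof -
  let ?C = "\<lambda>P u. \<forall>x\<in>P. snd (u (\<epsilon> x)) = snd (u x)"
  let ?f = "\<lambda>P T u. if ?C P u then edge_prod D \<delta> T (\<lambda>x. fst (u x)) * (\<Prod>x\<in>P. \<omega> (u x)) else 0"
  have res: "?f P T (restrict u P) = ?f P T u" if "T \<subseteq> P" "\<delta> ` P \<subseteq> P" "\<epsilon> ` P \<subseteq> P" for P T u
  proof -
    have "?C P (restrict u P) = ?C P u" using that by auto
    then show ?thesis unfolding edge_prod_restrict[OF that(1,2)] by simp
  qed
  have "?f (A \<union> B) (TA \<union> TB) u = ?f A TA u * ?f B TB u" for u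
  proof -
    have "edge_prod D \<delta> (TA \<union> TB) (\<lambda>x. fst (u x)) = edge_prod D \<delta> TA (\<lambda>x. fst (u x)) * edge_prod D \<delta> TB (\<lambda>x. fst (u x))"
      unfolding edge_prod_def using T disj finite_subset[OF T(1) fin(1)] finite_subset[OF T(2) fin(2)]
      by (intro prod.union_disjoint) auto
    moreover have "(\<Prod>x\<in>A \<union> B. \<omega> (u x)) = (\<Prod>x\<in>A. \<omega> (u x)) * (\<Prod>x\<in>B. \<omega> (u x))"
      by (rule prod.union_disjoint[OF fin disj])
    ultimately show ?thesis by (simp add: ball_Un)
  qed
  then show ?thesis
    unfolding trace_sum_def using fin
    by (simp add: sum_filter_PiE sum_PiE_Un[OF disj, where g = "?f A TA" and h = "?f B TB", OF res res, OF T(1) cl(1,3) T(2) cl(2,4)])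
qed

lemma trace_sum_cong:
  assumes "\<And>x. x \<in> P \<Longrightarrow> \<delta> x = \<delta>' x" "\<And>x. x \<in> P \<Longrightarrow> \<epsilon> x = \<epsilon>' x" "T \<subseteq> P"
  shows "trace_sum n D P \<delta> \<epsilon> T = trace_sum n D P \<delta>' \<epsilon>' T"
proof -
  have "edge_prod D \<delta> T r = edge_prod D \<delta>' T r" for r
    unfolding edge_prod_def using assms by (intro prod.cong refl) auto
  then show ?thesis unfolding trace_sum_def[abs_def] using assms by (simp cong: ball_cong)
qed

lemma trace_sum_reindex:
  fixes e :: "'a \<Rightarrow> 'b"
  assumes e: "bij_betw e P P'" and finP: "finite P" and T: "T \<subseteq> P" and cl: "\<delta> ` P \<subseteq> P" "\<epsilon> ` P \<subseteq> P"
    and c: "\<And>x. x \<in> P \<Longrightarrow> e (\<delta> x) = \<delta>' (e x)" "\<And>x. x \<in> P \<Longrightarrow> e (\<epsilon> x) = \<epsilon>' (e x)"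
  shows "trace_sum n D P' \<delta>' \<epsilon>' (e ` T) \<omega> = trace_sum n D P \<delta> \<epsilon> T \<omega>"
proof -
  let ?I = "{..<dim_row D} \<times> {..<n}"
  let ?f = "\<lambda>u. if \<forall>x\<in>P. snd (u (\<epsilon> x)) = snd (u x) then edge_prod D \<delta> T (\<lambda>x. fst (u x)) * (\<Prod>x\<in>P. \<omega> (u x)) else 0"
  have inj: "inj_on e P" and im: "P' = e ` P" using e by (auto simp: bij_betw_def)
  have finP': "finite P'" using im finP by simp
  have "trace_sum n D P' \<delta>' \<epsilon>' (e ` T) \<omega> = (\<Sum>u\<in>P' \<rightarrow>\<^sub>E ?I. ?f (\<lambda>x\<in>P. u (e x)))"
    unfolding trace_sum_def sum_filter_PiE[OF finP']
  proof (rule sum.cong[OF refl])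
    fix u :: "'b \<Rightarrow> nat \<times> nat"
    have 1: "(\<forall>x\<in>P'. snd (u (\<epsilon>' x)) = snd (u x)) \<longleftrightarrow> (\<forall>x\<in>P. snd ((\<lambda>x\<in>P. u (e x)) (\<epsilon> x)) = snd ((\<lambda>x\<in>P. u (e x)) x))"
      unfolding im using c(2) cl(2) by (auto simp: image_subset_iff)
    have 2: "edge_prod D \<delta>' (e ` T) (\<lambda>x. fst (u x)) = edge_prod D \<delta> T (\<lambda>x. fst ((\<lambda>x\<in>P. u (e x)) x))"
      unfolding edge_prod_def prod.reindex[OF inj_on_subset[OF inj T]]
      using T c(1) cl(1) by (intro prod.cong refl) (auto simp: image_subset_iff subset_iff)
    have 3: "(\<Prod>x\<in>P'. \<omega> (u x)) = (\<Prod>x\<in>P. \<omega> ((\<lambda>x\<in>P. u (e x)) x))"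
      unfolding im prod.reindex[OF inj] by (intro prod.cong refl) simp
    show "(if \<forall>x\<in>P'. snd (u (\<epsilon>' x)) = snd (u x) then edge_prod D \<delta>' (e ` T) (\<lambda>x. fst (u x)) * (\<Prod>x\<in>P'. \<omega> (u x)) else 0)
        = ?f (\<lambda>x\<in>P. u (e x))"
      unfolding 1 2 3 ..
  qed
  also have "\<dots> = (\<Sum>u\<in>P \<rightarrow>\<^sub>E ?I. ?f u)" by (rule sum_PiE_reindex[OF e])
  also have "\<dots> = trace_sum n D P \<delta> \<epsilon> T \<omega>" unfolding trace_sum_def sum_filter_PiE[OF finP] ..
  finally show ?thesis .
qed

text \<open>
  The \<open>k\<close>-th factor of \<open>Tr (W\<^sup>l)\<close> is \<open>\<Sum> Z\<^sub>p\<^sub>i D\<^sub>p\<^sub>q Z\<^sub>q\<^sub>j\<close>. Its left factor \<open>Z\<close> is the point \<open>k\<close>, its right one the point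
  \<open>-k\<close>; the column index of \<open>-k\<close> is that of the next point \<open>k + 1\<close>, cyclically. So
  \<open>circ_eps\<close> joins \<open>-k\<close> with \<open>k + 1\<close>, and \<open>-l\<close> with \<open>1\<close>.
\<close>

definition circ_delta :: "nat \<Rightarrow> int \<Rightarrow> int" where
  "circ_delta l k = (if k \<in> pm l then - k else k)"

definition circ_eps :: "nat \<Rightarrow> int \<Rightarrow> int" where
  "circ_eps l k = (if k \<notin> pm l then k else if k = - int l then 1 else if k = 1 then - int l else 1 - k)"

lemma finite_pm: "finite (pm l)" and card_pm: "card (pm l) = 2 * l"
  by (auto simp: pm_def)

lemma pairings_by_involution:
  assumes "\<And>x. x \<in> P \<Longrightarrow> f x \<in> P" "\<And>x. x \<in> P \<Longrightarrow> f x \<noteq> x" "\<And>x. x \<in> P \<Longrightarrow> f (f x) = x" "\<And>x. x \<notin> P \<Longrightarrow> f x = x"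
  shows "f \<in> pairings P"
proof -
  have "f (f x) = x" for x using assms(3,4) by (cases "x \<in> P") auto
  then have "f permutes P" unfolding permutes_def using assms(4) by metis
  then show ?thesis using assms by (auto simp: pairings_def)
qed

lemma circ_delta_pairing: "circ_delta l \<in> pairings (pm l)"
  by (rule pairings_by_involution) (auto simp: circ_delta_def pm_def)

lemma circ_eps_pairing: "circ_eps l \<in> pairings (pm l)"
  by (rule pairings_by_involution) (auto simp: circ_eps_def pm_def split: if_splits)

lemma circ_transversal: "transversal (pm l) (circ_delta l) {1..int l}"
proof -
  have "circ_delta l ` {1..int l} = {- int l..-1}"
  proof
    show "{- int l..-1} \<subseteq> circ_delta l ` {1..int l}"
    proof
      fix x assume "x \<in> {- int l..-1}"
      then have "x = circ_delta l (- x)" "- x \<in> {1..int l}" by (auto simp: circ_delta_def pm_def)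
      then show "x \<in> circ_delta l ` {1..int l}" by blast
    qed
  qed (auto simp: circ_delta_def pm_def)
  then show ?thesis by (auto simp: transversal_def pm_def)
qed

text \<open>
  The column indices \<open>t\<close> of the cyclic product of entries of \<open>W\<close> and the pairs \<open>q\<close> of row indices of each entry
  are encoded in one function on the points; \<open>enc\<close> and \<open>dec\<close> translate between the two.
\<close>

theorem wishart_trace_eq_trace_sum:
  assumes l: "l \<ge> 1" and D: "D \<in> carrier_mat d d"
  shows "wishart_trace l n D \<omega> = trace_sum n D (pm l) (circ_delta l) (circ_eps l) {1..int l} \<omega>"
proof -
  let ?M = "wishart n D \<omega>"
  let ?P = "pm l"
  let ?L = "{..<l}"
  define p where "p i = int i + 1" for i
  define m where "m i = - (int i + 1)" for i
  have dr: "dim_row D = d" using D by auto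
  have M: "?M \<in> carrier_mat n n" using D by (auto simp: wishart_def Let_def)
  have pmp: "p i \<in> ?P" "m i \<in> ?P" if "i < l" for i using that by (auto simp: p_def m_def pm_def)
  have P: "?P = p ` ?L \<union> m ` ?L"
  proof (intro subset_antisym subsetI)
    fix x assume x: "x \<in> ?P"
    show "x \<in> p ` ?L \<union> m ` ?L"
    proof (cases "x > 0")
      case True
      then have "x = p (nat (x - 1))" "nat (x - 1) < l" using x by (auto simp: p_def pm_def)
      then show ?thesis by blast
    next
      case False
      then have "x = m (nat (- x - 1))" "nat (- x - 1) < l" using x by (auto simp: m_def pm_def)
      then show ?thesis by blast
    qed
  qed (use pmp in auto)
  have T: "{1..int l} = p ` ?L"
  proof (intro subset_antisym subsetI)
    fix x assume "x \<in> {1..int l}"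
    then have "x = p (nat (x - 1))" "nat (x - 1) < l" by (auto simp: p_def)
    then show "x \<in> p ` ?L" by blast
  qed (auto simp: p_def)
  have inj: "inj_on p ?L" "inj_on m ?L" and disj: "p ` ?L \<inter> m ` ?L = {}"
    by (auto simp: inj_on_def p_def m_def)
  have dp: "circ_delta l (p i) = m i" if "i < l" for i
    using pmp[OF that] by (simp add: circ_delta_def p_def m_def)
  have em: "circ_eps l (m i) = p (Suc i mod l)" if "i < l" for i
    using pmp[OF that] that by (cases "Suc i = l") (auto simp: circ_eps_def p_def m_def)
  note e = pairingsD[OF circ_eps_pairing[of l]]
  define enc where "enc t q = (\<lambda>x\<in>?P. if x > 0 then (fst (q (nat (x - 1))), t (nat (x - 1)))
      else (snd (q (nat (- x - 1))), t (Suc (nat (- x - 1)) mod l)))" for t :: "nat \<Rightarrow> nat" and q :: "nat \<Rightarrow> nat \<times> nat"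
  define dec where "dec u = (\<lambda>i\<in>?L. snd (u (p i)), \<lambda>i\<in>?L. (fst (u (p i)), fst (u (m i))))" for u :: "int \<Rightarrow> nat \<times> nat"
  let ?Q = "?L \<rightarrow>\<^sub>E {..<d} \<times> {..<d}"
  let ?F = "\<lambda>t q. \<Prod>i<l. \<omega> (fst (q i), t i) * D $$ (fst (q i), snd (q i)) * \<omega> (snd (q i), t (Suc i mod l))"
  have entry: "?M $$ (a, b) = (\<Sum>q\<in>{..<d} \<times> {..<d}. \<omega> (fst q, a) * D $$ (fst q, snd q) * \<omega> (snd q, b))"
    if "a < n" "b < n" for a b
  proof -
    have "?M $$ (a, b) = (\<Sum>k<d. (\<Sum>j<d. \<omega> (j, a) * D $$ (j, k)) * \<omega> (k, b))"
      using that D unfolding wishart_def Let_def dr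
      by (simp add: scalar_prod_def atLeast0LessThan)
    also have "\<dots> = (\<Sum>k<d. \<Sum>j<d. \<omega> (j, a) * D $$ (j, k) * \<omega> (k, b))"
      by (simp add: sum_distrib_right)
    also have "\<dots> = (\<Sum>j<d. \<Sum>k<d. \<omega> (j, a) * D $$ (j, k) * \<omega> (k, b))" by (rule sum.swap)
    also have "\<dots> = (\<Sum>q\<in>{..<d} \<times> {..<d}. \<omega> (fst q, a) * D $$ (fst q, snd q) * \<omega> (snd q, b))"
      by (simp add: sum.cartesian_product case_prod_unfold)
    finally show ?thesis .
  qed
  have "wishart_trace l n D \<omega> = (\<Sum>t\<in>?L \<rightarrow>\<^sub>E {..<n}. \<Prod>i<l. ?M $$ (t i, t (Suc i mod l)))"
    unfolding wishart_trace_def by (rule trace_power_as_sum[OF M l])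
  also have "\<dots> = (\<Sum>t\<in>?L \<rightarrow>\<^sub>E {..<n}. \<Prod>i<l. \<Sum>q\<in>{..<d} \<times> {..<d}. \<omega> (fst q, t i) * D $$ (fst q, snd q) * \<omega> (snd q, t (Suc i mod l)))"
  proof (rule sum.cong[OF refl], rule prod.cong[OF refl])
    fix t i assume t: "t \<in> ?L \<rightarrow>\<^sub>E {..<n}" and i: "i \<in> ?L"
    have "t i < n" "t (Suc i mod l) < n"
      using PiE_mem[OF t i] PiE_mem[OF t, of "Suc i mod l"] l by auto
    then show "?M $$ (t i, t (Suc i mod l)) = (\<Sum>q\<in>{..<d} \<times> {..<d}. \<omega> (fst q, t i) * D $$ (fst q, snd q) * \<omega> (snd q, t (Suc i mod l)))"
      by (rule entry)
  qed
  also have "\<dots> = (\<Sum>t\<in>?L \<rightarrow>\<^sub>E {..<n}. \<Sum>q\<in>?Q. ?F t q)"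
    by (rule sum.cong[OF refl], rule prod_sum_PiE) auto
  also have "\<dots> = (\<Sum>(t, q)\<in>(?L \<rightarrow>\<^sub>E {..<n}) \<times> ?Q. ?F t q)"
    by (simp add: sum.cartesian_product)
  also have "\<dots> = trace_sum n D ?P (circ_delta l) (circ_eps l) {1..int l} \<omega>"
    unfolding trace_sum_def dr
  proof (rule sum.reindex_bij_witness[where i = dec and j = "\<lambda>(t, q). enc t q"])
    fix a assume a: "a \<in> (?L \<rightarrow>\<^sub>E {..<n}) \<times> ?Q"
    then obtain t q where tq: "a = (t, q)" "t \<in> ?L \<rightarrow>\<^sub>E {..<n}" "q \<in> ?Q" by auto
    let ?u = "enc t q"
    have up: "?u (p i) = (fst (q i), t i)" if "i < l" for i
      using pmp(1)[OF that] by (simp add: enc_def p_def)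
    have um: "?u (m i) = (snd (q i), t (Suc i mod l))" if "i < l" for i
      using pmp(2)[OF that] by (simp add: enc_def m_def)
    have qd: "fst (q i) < d" "snd (q i) < d" if "i < l" for i
      using tq(3) that by (auto simp: PiE_iff mem_Times_iff)
    have tn: "t i < n" if "i < l" for i using tq(2) that by auto
    have "(\<lambda>i\<in>?L. snd (?u (p i))) = t" using tq(2) up by (auto simp: fun_eq_iff PiE_def extensional_def)
    moreover have "(\<lambda>i\<in>?L. (fst (?u (p i)), fst (?u (m i)))) = q"
      using tq(3) up um by (auto simp: fun_eq_iff PiE_def extensional_def)
    ultimately show "dec (case a of (t, q) \<Rightarrow> enc t q) = a"
      using tq(1) by (simp add: dec_def)
    have con: "snd (?u (circ_eps l x)) = snd (?u x)" if x: "x \<in> ?P" for x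
    proof -
      have neg: "snd (?u (circ_eps l (m i))) = snd (?u (m i))" if "i < l" for i
        using um[OF that] up[of "Suc i mod l"] l by (simp add: em[OF that])
      show ?thesis
      proof (cases "x \<in> m ` ?L")
        case True
        then show ?thesis using neg by blast
      next
        case False
        then have "x > 0" using x P by (auto simp: p_def)
        then have "circ_eps l x \<le> 0" "circ_eps l x \<in> ?P" using x l e(2)[OF x] by (auto simp: circ_eps_def pm_def)
        then have "circ_eps l x \<notin> p ` ?L" "circ_eps l x \<in> p ` ?L \<union> m ` ?L"
          using P by (auto simp: p_def image_iff)
        then obtain i where i: "i < l" "circ_eps l x = m i" by blast
        have "circ_eps l (m i) = x" using i(2) e(4)[of x] by simp
        then show ?thesis using neg[OF i(1)] i(2) by simp
      qed
    qed
    have mem: "?u \<in> ?P \<rightarrow>\<^sub>E {..<d} \<times> {..<n}"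
    proof (rule PiE_I)
      fix x assume x: "x \<in> ?P"
      then consider i where "i < l" "x = p i" | i where "i < l" "x = m i" using P by auto
      then show "?u x \<in> {..<d} \<times> {..<n}"
      proof cases
        case 1
        then show ?thesis using up[OF 1(1)] qd tn by simp
      next
        case 2
        then show ?thesis using um[OF 2(1)] qd tn l by simp
      qed
    qed (simp add: enc_def)
    show "(case a of (t, q) \<Rightarrow> enc t q)
        \<in> {u. u \<in> ?P \<rightarrow>\<^sub>E {..<d} \<times> {..<n} \<and> (\<forall>x\<in>?P. snd (u (circ_eps l x)) = snd (u x))}"
      using mem con tq(1) by simp
    have "(\<Prod>x\<in>?P. \<omega> (?u x)) = (\<Prod>i<l. \<omega> (?u (p i))) * (\<Prod>i<l. \<omega> (?u (m i)))"
      by (subst P, subst prod.union_disjoint[OF _ _ disj])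
         (auto simp: prod.reindex[OF inj(1)] prod.reindex[OF inj(2)])
    moreover have "(\<Prod>i<l. \<omega> (?u (p i))) = (\<Prod>i<l. \<omega> (fst (q i), t i))"
      by (rule prod.cong[OF refl]) (simp only: lessThan_iff up)
    moreover have "(\<Prod>i<l. \<omega> (?u (m i))) = (\<Prod>i<l. \<omega> (snd (q i), t (Suc i mod l)))"
      by (rule prod.cong[OF refl]) (simp only: lessThan_iff um)
    moreover have "edge_prod D (circ_delta l) {1..int l} (\<lambda>x. fst (?u x)) = (\<Prod>i<l. D $$ (fst (q i), snd (q i)))"
      unfolding edge_prod_def T prod.reindex[OF inj(1)] comp_def
      by (intro prod.cong refl) (simp only: dp lessThan_iff up um fst_conv)
    ultimately have "edge_prod D (circ_delta l) {1..int l} (\<lambda>x. fst (?u x)) * (\<Prod>x\<in>?P. \<omega> (?u x)) = ?F t q"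
      unfolding prod.distrib by (simp only: mult_ac)
    then show "edge_prod D (circ_delta l) {1..int l} (\<lambda>x. fst ((case a of (t, q) \<Rightarrow> enc t q) x)) *
        (\<Prod>x\<in>?P. \<omega> ((case a of (t, q) \<Rightarrow> enc t q) x)) = (case a of (t, q) \<Rightarrow> ?F t q)"
      using tq(1) by simp
  next
    fix u assume "u \<in> {u. u \<in> ?P \<rightarrow>\<^sub>E {..<d} \<times> {..<n} \<and> (\<forall>x\<in>?P. snd (u (circ_eps l x)) = snd (u x))}"
    then have u: "u \<in> ?P \<rightarrow>\<^sub>E {..<d} \<times> {..<n}" and con: "\<And>x. x \<in> ?P \<Longrightarrow> snd (u (circ_eps l x)) = snd (u x)"
      by auto
    have ud: "u x \<in> {..<d} \<times> {..<n}" if "x \<in> ?P" for x using u that by auto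
    show "dec u \<in> (?L \<rightarrow>\<^sub>E {..<n}) \<times> ?Q"
      using ud pmp by (auto simp: dec_def mem_Times_iff)
    show "(case dec u of (t, q) \<Rightarrow> enc t q) = u"
    proof
      fix x
      show "(case dec u of (t, q) \<Rightarrow> enc t q) x = u x"
      proof (cases "x \<in> ?P")
        case True
        then consider i where "i < l" "x = p i" | i where "i < l" "x = m i" using P by auto
        then show ?thesis
        proof cases
          case 1
          then show ?thesis using pmp[OF 1(1)] by (simp add: dec_def enc_def p_def prod_eq_iff)
        next
          case 2
          have "snd (u (p (Suc i mod l))) = snd (u (m i))"
            using con[OF pmp(2)[OF 2(1)]] em[OF 2(1)] by simp
          then show ?thesis using 2 pmp[OF 2(1)] l by (simp add: dec_def enc_def m_def prod_eq_iff)
        qed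
      next
        case False
        then show ?thesis using u by (auto simp: dec_def enc_def PiE_def extensional_def)
      qed
    qed
  qed
  finally show ?thesis .
qed

section \<open>Families of circles\<close>

text \<open>
  The copies of the circle for the factors of a power \<open>X\<^sup>k\<close> are labelled by a finite set \<open>S\<close> of natural
  numbers, so that subsets of the factors are again such families.
\<close>

definition pts :: "nat \<Rightarrow> nat set \<Rightarrow> (nat \<times> int) set" where
  "pts l S = S \<times> pm l"

definition fam_delta :: "nat \<Rightarrow> nat set \<Rightarrow> nat \<times> int \<Rightarrow> nat \<times> int" where
  "fam_delta l S x = (if fst x \<in> S then (fst x, circ_delta l (snd x)) else x)"

definition fam_eps :: "nat \<Rightarrow> nat set \<Rightarrow> nat \<times> int \<Rightarrow> nat \<times> int" where
  "fam_eps l S x = (if fst x \<in> S then (fst x, circ_eps l (snd x)) else x)"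

definition fam_half :: "nat \<Rightarrow> nat set \<Rightarrow> (nat \<times> int) set" where
  "fam_half l S = S \<times> {1..int l}"

lemma finite_pts: "finite S \<Longrightarrow> finite (pts l S)" and card_pts: "card (pts l S) = card S * (2 * l)"
  by (auto simp: pts_def finite_pm card_cartesian_product card_pm)

lemma fam_delta_pairing: "fam_delta l S \<in> pairings (pts l S)"
proof -
  note d = pairingsD[OF circ_delta_pairing[of l]]
  show ?thesis by (rule pairings_by_involution) (auto simp: fam_delta_def pts_def d)
qed

lemma fam_eps_pairing: "fam_eps l S \<in> pairings (pts l S)"
proof -
  note d = pairingsD[OF circ_eps_pairing[of l]]
  show ?thesis by (rule pairings_by_involution) (auto simp: fam_eps_def pts_def d)
qed

lemma fam_transversal: "transversal (pts l S) (fam_delta l S) (fam_half l S)"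
proof -
  have "fam_delta l S ` fam_half l S = S \<times> circ_delta l ` {1..int l}"
  proof
    show "S \<times> circ_delta l ` {1..int l} \<subseteq> fam_delta l S ` fam_half l S"
    proof
      fix x assume "x \<in> S \<times> circ_delta l ` {1..int l}"
      then obtain i k where "i \<in> S" "k \<in> {1..int l}" "x = fam_delta l S (i, k)"
        by (auto simp: fam_delta_def)
      then show "x \<in> fam_delta l S ` fam_half l S" by (auto simp: fam_half_def)
    qed
  qed (auto simp: fam_delta_def fam_half_def)
  then show ?thesis using circ_transversal[of l] unfolding transversal_def pts_def fam_half_def by auto
qed

text \<open>
  The circles of a family are closed under both pairings, so the polynomial is a product over them.
\<close>

lemma trace_sum_family:
  assumes l: "l \<ge> 1" and D: "D \<in> carrier_mat d d" and S: "finite S"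
  shows "trace_sum n D (pts l S) (fam_delta l S) (fam_eps l S) (fam_half l S) \<omega> = wishart_trace l n D \<omega> ^ card S"
  using S
proof (induction S rule: finite_induct)
  case empty
  have "{u. u \<in> {} \<rightarrow>\<^sub>E {..<dim_row D} \<times> {..<n}} = {\<lambda>_. undefined}" by auto
  then show ?case by (simp add: trace_sum_def pts_def fam_half_def edge_prod_def)
next
  case (insert i S)
  let ?d = "fam_delta l (insert i S)" and ?e = "fam_eps l (insert i S)"
  have un: "pts l (insert i S) = pts l {i} \<union> pts l S" "fam_half l (insert i S) = fam_half l {i} \<union> fam_half l S"
    by (auto simp: pts_def fam_half_def)
  note cd = pairingsD(2)[OF circ_delta_pairing[of l]] pairingsD(2)[OF circ_eps_pairing[of l]]
  have half: "fam_half l S \<subseteq> pts l S" for S by (auto simp: fam_half_def pts_def pm_def)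
  have "trace_sum n D (pts l (insert i S)) ?d ?e (fam_half l (insert i S)) \<omega>
    = trace_sum n D (pts l {i}) ?d ?e (fam_half l {i}) \<omega> * trace_sum n D (pts l S) ?d ?e (fam_half l S) \<omega>"
    unfolding un
  proof (rule trace_sum_Un)
    show "finite (pts l {i})" "finite (pts l S)" using insert finite_pts by auto
    show "pts l {i} \<inter> pts l S = {}" using insert by (auto simp: pts_def)
  qed (use cd half in \<open>auto simp: fam_delta_def fam_eps_def pts_def\<close>)
  also have "trace_sum n D (pts l S) ?d ?e (fam_half l S) = trace_sum n D (pts l S) (fam_delta l S) (fam_eps l S) (fam_half l S)"
    by (rule trace_sum_cong[OF _ _ half]) (auto simp: fam_delta_def fam_eps_def pts_def)
  also have "trace_sum n D (pts l {i}) ?d ?e (fam_half l {i}) \<omega> = wishart_trace l n D \<omega>"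
  proof -
    have b: "bij_betw (Pair i) (pm l) (pts l {i})" by (auto simp: bij_betw_def inj_on_def pts_def)
    have h: "fam_half l {i} = Pair i ` {1..int l}" by (auto simp: fam_half_def)
    show ?thesis unfolding wishart_trace_eq_trace_sum[OF l D] h
      by (rule trace_sum_reindex[OF b finite_pm]) (use cd in \<open>auto simp: fam_delta_def fam_eps_def pm_def\<close>)
  qed
  finally show ?case using insert by simp
qed

lemma ncomp_circles_ge:
  assumes l: "l \<ge> 1" and S: "finite S"
  shows "card S \<le> ncomp2 (pts l S) (fam_delta l S) (fam_eps l S)"
proof -
  let ?P = "pts l S"
  let ?T = "{(x, y) \<in> ?P \<times> ?P. fst x = fst y}"
  let ?E = "graph_on ?P (fam_delta l S) \<union> graph_on ?P (fam_eps l S)"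
  have eq: "equiv ?P ?T" by (rule equivI) (auto simp: refl_on_def sym_def trans_def)
  have sub: "eqcl ?P ?E \<subseteq> ?T"
    using pairingsD(2)[OF fam_delta_pairing] pairingsD(2)[OF fam_eps_pairing]
    by (intro eqcl_least[OF _ eq]) (auto simp: graph_on_def fam_delta_def fam_eps_def)
  have one: "(1::int) \<in> pm l" using l by (auto simp: pm_def)
  have fin: "finite (?P // ?T)" by (rule finite_quotient[OF finite_pts[OF S]]) auto
  have "inj_on (\<lambda>i. ?T `` {(i, 1)}) S"
  proof (rule inj_onI)
    fix i j assume ij: "i \<in> S" "j \<in> S" "?T `` {(i, 1)} = ?T `` {(j, 1)}"
    have "(j, 1) \<in> ?T `` {(j, 1)}" using ij one by (auto simp: pts_def)
    then show "i = j" using ij(3) by auto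
  qed
  moreover have "(\<lambda>i. ?T `` {(i, 1)}) ` S \<subseteq> ?P // ?T" 
  proof (rule image_subsetI)
    fix i assume "i \<in> S"
    then have "(i, 1) \<in> ?P" using one by (simp add: pts_def)
    then show "?T `` {(i, 1)} \<in> ?P // ?T" by (rule quotientI)
  qed
  ultimately have "card S \<le> card (?P // ?T)" using fin by (rule card_inj_on_le)
  also have "\<dots> \<le> ncomp ?P ?E" unfolding ncomp_def
    by (rule finite_refines_card_le[OF finite_quot[OF finite_pts[OF S]] sub equiv_eqcl eq])
  finally show ?thesis .
qed

lemma circle_connected:
  assumes "l \<ge> 1" "i \<in> S" "k \<in> pm l"
  shows "((i, 1), (i, k)) \<in> eqcl (pts l S) (graph_on (pts l S) (fam_delta l S) \<union> graph_on (pts l S) (fam_eps l S))"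
proof -
  let ?P = "pts l S"
  let ?E = "graph_on ?P (fam_delta l S) \<union> graph_on ?P (fam_eps l S)"
  have dl: "((i, k), (i, - k)) \<in> eqcl ?P ?E" if "k \<in> pm l" for k
  proof (rule eqcl_edge)
    show "((i, k), i, - k) \<in> ?E" using that assms(2)
      by (auto simp: graph_on_def pts_def fam_delta_def circ_delta_def image_iff)
  qed (use that assms(2) in \<open>auto simp: pts_def pm_def\<close>)
  have ep: "((i, - k), (i, k + 1)) \<in> eqcl ?P ?E" if "1 \<le> k" "k < int l" for k
  proof (rule eqcl_edge)
    show "((i, - k), i, k + 1) \<in> ?E" using that assms(2)
      by (auto simp: graph_on_def pts_def fam_eps_def circ_eps_def image_iff pm_def)
  qed (use that assms(2) in \<open>auto simp: pts_def pm_def\<close>)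
  have pos: "((i, 1), (i, int (Suc j))) \<in> eqcl ?P ?E" if "j < l" for j
    using that
  proof (induction j)
    case 0
    then show ?case using assms by (auto intro!: eqcl_refl simp: pts_def pm_def)
  next
    case (Suc j)
    have jl: "j < l" using Suc.prems by simp
    have b: "((i, int (Suc j)), (i, - int (Suc j))) \<in> eqcl ?P ?E" using Suc.prems by (intro dl) (auto simp: pm_def)
    have c: "((i, - int (Suc j)), (i, int (Suc j) + 1)) \<in> eqcl ?P ?E" using Suc.prems by (intro ep) auto
    have "int (Suc (Suc j)) = int (Suc j) + 1" by simp
    then show ?case using eqcl_trans[OF eqcl_trans[OF Suc.IH[OF jl] b] c] by (simp only:)
  qed
  show ?thesis
  proof (cases "k > 0")
    case True
    then have "k = int (Suc (nat (k - 1)))" "nat (k - 1) < l" using assms by (auto simp: pm_def)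
    then show ?thesis using pos by metis
  next
    case False
    then have "- k = int (Suc (nat (- k - 1)))" "nat (- k - 1) < l" using assms by (auto simp: pm_def)
    then have "((i, 1), (i, - k)) \<in> eqcl ?P ?E" using pos by metis
    moreover have "((i, - k), (i, k)) \<in> eqcl ?P ?E" using dl[of "- k"] assms by (auto simp: pm_def)
    ultimately show ?thesis by (rule eqcl_trans)
  qed
qed

section \<open>Cumulants as sums over connected pairings\<close>

lemma perm_restrict_pairing:
  assumes "\<tau> \<in> pairings P" "A \<subseteq> P" "\<tau> ` A \<subseteq> A"
  shows "perm_restrict \<tau> A \<in> pairings A"
  using assms pairingsD[OF assms(1)]
  by (intro pairings_by_involution) (auto simp: perm_restrict_def)

lemma pairing_weight_eq_sum:
  assumes "finite P" "\<delta> \<in> pairings P" "\<epsilon> \<in> pairings P" "\<tau> \<in> pairings P" "transversal P \<delta> T"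
    and D: "D \<in> carrier_mat d d" "transpose_mat D = D" "d \<ge> 1"
  shows "pairing_weight n D P \<delta> \<epsilon> \<tau> = (1 / real n) ^ (card P div 2) *
     (\<Sum>u\<in>P \<rightarrow>\<^sub>E {..<d} \<times> {..<n}. if (\<forall>x\<in>P. snd (u (\<epsilon> x)) = snd (u x)) \<and> (\<forall>x\<in>P. u (\<tau> x) = u x)
        then edge_prod D \<delta> T (\<lambda>x. fst (u x)) else 0)"
proof -
  have "dim_row D = d" using D by auto
  then show ?thesis
    unfolding pairing_weight_def sum_filter_PiE[OF assms(1), symmetric] index_sum[OF assms(1-5) D] by simp
qed

text \<open>
  If no pairing joins \<open>A\<close> with \<open>B\<close>, then the index sum factorizes.
\<close>

lemma pairing_weight_Un:
  assumes fin: "finite A" "finite B" and disj: "A \<inter> B = {}"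
    and \<delta>: "\<delta> \<in> pairings (A \<union> B)" "\<delta> ` A \<subseteq> A" "\<delta> ` B \<subseteq> B"
    and \<epsilon>: "\<epsilon> \<in> pairings (A \<union> B)" "\<epsilon> ` A \<subseteq> A" "\<epsilon> ` B \<subseteq> B"
    and \<tau>: "\<tau> \<in> pairings (A \<union> B)" "\<tau> ` A \<subseteq> A" "\<tau> ` B \<subseteq> B"
    and T: "transversal A (perm_restrict \<delta> A) TA" "transversal B (perm_restrict \<delta> B) TB"
    and D: "D \<in> carrier_mat d d" "transpose_mat D = D" "d \<ge> 1"
  shows "pairing_weight n D (A \<union> B) \<delta> \<epsilon> \<tau>
    = pairing_weight n D A (perm_restrict \<delta> A) (perm_restrict \<epsilon> A) (perm_restrict \<tau> A)
    * pairing_weight n D B (perm_restrict \<delta> B) (perm_restrict \<epsilon> B) (perm_restrict \<tau> B)"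
proof -
  let ?C = "\<lambda>P u. (\<forall>x\<in>P. snd (u (\<epsilon> x)) = snd (u x)) \<and> (\<forall>x\<in>P. u (\<tau> x) = u x)"
  let ?f = "\<lambda>P T u. if ?C P u then edge_prod D \<delta> T (\<lambda>x. fst (u x)) else 0"
  have rA: "perm_restrict f A \<in> pairings A" if "f \<in> pairings (A \<union> B)" "f ` A \<subseteq> A" for f
    using that by (intro perm_restrict_pairing[of f "A \<union> B"]) auto
  have rB: "perm_restrict f B \<in> pairings B" if "f \<in> pairings (A \<union> B)" "f ` B \<subseteq> B" for f
    using that by (intro perm_restrict_pairing[of f "A \<union> B"]) auto
  have subT: "TA \<subseteq> A" "TB \<subseteq> B" using transversalD(1)[OF T(1) rA[OF \<delta>(1,2)]] transversalD(1)[OF T(2) rB[OF \<delta>(1,3)]] by auto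
  have TU: "transversal (A \<union> B) \<delta> (TA \<union> TB)"
  proof -
    have "perm_restrict \<delta> A ` TA = \<delta> ` TA" "perm_restrict \<delta> B ` TB = \<delta> ` TB"
      using subT by (auto simp: perm_restrict_def intro!: image_cong)
    then show ?thesis using T disj subT \<delta>(2,3) unfolding transversal_def image_Un by auto
  qed
  have e1: "pairing_weight n D A (perm_restrict \<delta> A) (perm_restrict \<epsilon> A) (perm_restrict \<tau> A)
      = (1 / real n) ^ (card A div 2) * (\<Sum>u\<in>A \<rightarrow>\<^sub>E {..<d} \<times> {..<n}. ?f A TA u)"
  proof -
    have ep: "edge_prod D (perm_restrict \<delta> A) TA = edge_prod D \<delta> TA"
    proof
      fix r show "edge_prod D (perm_restrict \<delta> A) TA r = edge_prod D \<delta> TA r"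
        unfolding edge_prod_def using subT by (intro prod.cong refl) (auto simp: perm_restrict_def)
    qed
    show ?thesis
      unfolding pairing_weight_eq_sum[OF fin(1) rA[OF \<delta>(1,2)] rA[OF \<epsilon>(1,2)] rA[OF \<tau>(1,2)] T(1) D] ep
      by (simp add: perm_restrict_simps(1) cong: ball_cong)
  qed
  have e2: "pairing_weight n D B (perm_restrict \<delta> B) (perm_restrict \<epsilon> B) (perm_restrict \<tau> B)
      = (1 / real n) ^ (card B div 2) * (\<Sum>u\<in>B \<rightarrow>\<^sub>E {..<d} \<times> {..<n}. ?f B TB u)"
  proof -
    have ep: "edge_prod D (perm_restrict \<delta> B) TB = edge_prod D \<delta> TB"
    proof
      fix r show "edge_prod D (perm_restrict \<delta> B) TB r = edge_prod D \<delta> TB r"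
        unfolding edge_prod_def using subT by (intro prod.cong refl) (auto simp: perm_restrict_def)
    qed
    show ?thesis
      unfolding pairing_weight_eq_sum[OF fin(2) rB[OF \<delta>(1,3)] rB[OF \<epsilon>(1,3)] rB[OF \<tau>(1,3)] T(2) D] ep
      by (simp add: perm_restrict_simps(1) cong: ball_cong)
  qed
  have res: "?f P T (restrict u P) = ?f P T u" if "T \<subseteq> P" "\<delta> ` P \<subseteq> P" "\<epsilon> ` P \<subseteq> P" "\<tau> ` P \<subseteq> P" for P T u
  proof -
    have "?C P (restrict u P) = ?C P u" using that by auto
    then show ?thesis unfolding edge_prod_restrict[OF that(1,2)] by simp
  qed
  have split: "?f (A \<union> B) (TA \<union> TB) u = ?f A TA u * ?f B TB u" for u
  proof -
    have "edge_prod D \<delta> (TA \<union> TB) (\<lambda>x. fst (u x)) = edge_prod D \<delta> TA (\<lambda>x. fst (u x)) * edge_prod D \<delta> TB (\<lambda>x. fst (u x))"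
      unfolding edge_prod_def using subT disj finite_subset[OF subT(1) fin(1)] finite_subset[OF subT(2) fin(2)]
      by (intro prod.union_disjoint) auto
    then show ?thesis by (auto simp: ball_Un)
  qed
  have "(\<Sum>u\<in>(A \<union> B) \<rightarrow>\<^sub>E {..<d} \<times> {..<n}. ?f (A \<union> B) (TA \<union> TB) u)
      = (\<Sum>u\<in>A \<rightarrow>\<^sub>E {..<d} \<times> {..<n}. ?f A TA u) * (\<Sum>u\<in>B \<rightarrow>\<^sub>E {..<d} \<times> {..<n}. ?f B TB u)"
    unfolding split
    by (rule sum_PiE_Un[OF disj, where g = "?f A TA" and h = "?f B TB"])
       (rule res[OF subT(1) \<delta>(2) \<epsilon>(2) \<tau>(2)], rule res[OF subT(2) \<delta>(3) \<epsilon>(3) \<tau>(3)])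
  moreover have "card (A \<union> B) div 2 = card A div 2 + card B div 2"
    using ncomp_pairing[OF fin(1) rA[OF \<delta>(1,2)]] ncomp_pairing[OF fin(2) rB[OF \<delta>(1,3)]]
      card_Un_disjoint[OF fin disj] by presburger
  ultimately show ?thesis
    unfolding e1 e2 pairing_weight_eq_sum[OF finite_UnI[OF fin] \<delta>(1) \<epsilon>(1) \<tau>(1) TU D]
    by (simp add: power_add)
qed

definition connected_family :: "nat \<Rightarrow> nat set \<Rightarrow> (nat \<times> int \<Rightarrow> nat \<times> int) \<Rightarrow> bool" where
  "connected_family l S \<tau> \<longleftrightarrow> (\<forall>T\<subseteq>S. T \<noteq> {} \<longrightarrow> \<tau> ` pts l T \<subseteq> pts l T \<longrightarrow> T = S)"

text \<open>
  Since \<open>\<tau>\<close> connects all circles and each circle is connected by \<open>\<delta>\<close> and \<open>\<epsilon>\<close>, the three pairings have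
  one component, while \<open>\<delta> \<union> \<epsilon>\<close> has at least \<open>card S\<close> components. The first bound is then
  \<open>euler_inequality\<close>, the second one is \<open>ncomp_submodular\<close> with \<open>\<delta>\<close> in common.
\<close>

lemma connected_family_bounds:
  assumes l: "l \<ge> 1" and S: "finite S" "S \<noteq> {}" and \<tau>: "\<tau> \<in> pairings (pts l S)" and conn: "connected_family l S \<tau>"
  shows "ncomp2 (pts l S) (fam_delta l S) \<tau>
       + ncomp2 (pts l S) (fam_eps l S) \<tau> + card S \<le> card S * l + 2"
    and "ncomp2 (pts l S) (fam_delta l S) \<tau> + card S \<le> card S * l + 1"
proof -
  let ?P = "pts l S"
  let ?d = "graph_on ?P (fam_delta l S)" and ?e = "graph_on ?P (fam_eps l S)" and ?t = "graph_on ?P \<tau>"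
  let ?E = "?d \<union> ?e \<union> ?t"
  note fin = finite_pts[OF S(1), of l]
  note t = pairingsD[OF \<tau>]
  obtain i0 where i0: "i0 \<in> S" using S by auto
  define T where "T = {i \<in> S. ((i0, 1), (i, 1)) \<in> eqcl ?P ?E}"
  have one: "(1::int) \<in> pm l" using l by (auto simp: pm_def)
  have circ: "((i, 1), (i, k)) \<in> eqcl ?P ?E" if "i \<in> S" "k \<in> pm l" for i k
    using circle_connected[OF l that] eqcl_mono[of "?d \<union> ?e" ?E ?P] by auto
  have "\<tau> ` pts l T \<subseteq> pts l T"
  proof (rule image_subsetI)
    fix x assume x: "x \<in> pts l T"
    obtain i k where ik: "x = (i, k)" by (cases x)
    have i: "i \<in> S" "k \<in> pm l" "((i0, 1), (i, 1)) \<in> eqcl ?P ?E" using x ik by (auto simp: pts_def T_def)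
    have xP: "x \<in> ?P" using i ik by (simp add: pts_def)
    obtain j k' where jk: "\<tau> x = (j, k')" by (cases "\<tau> x")
    have j: "j \<in> S" "k' \<in> pm l" using t(2)[OF xP] jk by (auto simp: pts_def)
    have "(x, \<tau> x) \<in> eqcl ?P ?E" using xP t(2)[OF xP] by (intro eqcl_edge) (auto simp: graph_on_def)
    then have "((i0, 1), (j, k')) \<in> eqcl ?P ?E"
      using eqcl_trans[OF i(3) eqcl_trans[OF circ[OF i(1,2)]]] ik jk by simp
    then have "((i0, 1), (j, 1)) \<in> eqcl ?P ?E" by (rule eqcl_trans[OF _ eqcl_sym[OF circ[OF j]]])
    then show "\<tau> x \<in> pts l T" using j jk by (simp add: pts_def T_def)
  qed
  moreover have "i0 \<in> T" using i0 one by (auto simp: T_def pts_def intro: eqcl_refl)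
  moreover have "T \<subseteq> S" by (auto simp: T_def)
  ultimately have TS: "T = S" using conn unfolding connected_family_def by blast
  have "?P // eqcl ?P ?E \<subseteq> {eqcl ?P ?E `` {(i0, 1)}}"
  proof
    fix X assume "X \<in> ?P // eqcl ?P ?E"
    then obtain x where x: "x \<in> ?P" "X = eqcl ?P ?E `` {x}" by (rule quotientE)
    obtain i k where ik: "x = (i, k)" by (cases x)
    have i: "i \<in> S" "k \<in> pm l" using x ik by (auto simp: pts_def)
    then have "((i0, 1), (i, 1)) \<in> eqcl ?P ?E" using TS by (auto simp: T_def)
    then have "((i0, 1), x) \<in> eqcl ?P ?E" using eqcl_trans circ[OF i] ik by metis
    then have "eqcl ?P ?E `` {(i0, 1)} = X" unfolding x(2) by (rule equiv_class_eq[OF equiv_eqcl])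
    then show "X \<in> {eqcl ?P ?E `` {(i0, 1)}}" by simp
  qed
  then have "ncomp ?P ?E \<le> card {eqcl ?P ?E `` {(i0, 1)}}"
    unfolding ncomp_def by (rule card_mono[rotated]) simp
  then have one_comp: "ncomp ?P ?E \<le> 1" by simp
  note circles = ncomp_circles_ge[OF l S(1)]
  define m where "m = card S * l"
  have cP: "card ?P = 2 * m" by (simp add: card_pts m_def)
  show "ncomp ?P (?d \<union> ?t) + ncomp ?P (?e \<union> ?t) + card S \<le> card S * l + 2"
  proof -
    have arith: "2 * (a + b + c) \<le> k + 4 * e \<Longrightarrow> e \<le> 1 \<Longrightarrow> s \<le> c \<Longrightarrow> k = 2 * m \<Longrightarrow> a + b + s \<le> m + 2"
      for a b c e k s :: nat by presburger
    show ?thesis unfolding m_def[symmetric]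
      by (rule arith[OF euler_inequality[OF fin fam_delta_pairing fam_eps_pairing \<tau>] one_comp circles cP])
  qed
  have "ncomp ?P (?d \<union> ?t) + ncomp ?P (?d \<union> ?e) \<le> ncomp ?P ?d + ncomp ?P (?d \<union> ?t \<union> ?e)"
    using graph_on_subset[OF t(1)] graph_on_subset[OF pairingsD(1)[OF fam_delta_pairing]]
      graph_on_subset[OF pairingsD(1)[OF fam_eps_pairing]] fin
    by (intro ncomp_submodular) (auto intro: finite_subset[OF _ finite_SigmaI])
  moreover have "2 * ncomp ?P ?d = card ?P" by (rule ncomp_pairing[OF fin fam_delta_pairing])
  moreover have "?d \<union> ?t \<union> ?e = ?E" by auto
  ultimately show "ncomp ?P (?d \<union> ?t) + card S \<le> card S * l + 1"
    unfolding m_def[symmetric] using one_comp circles cP by simp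
qed

text \<open>
  The parameter \<open>(d/n, D)\<close> and the power \<open>l\<close>; amplification is used through interpretations.
\<close>

locale wishart_param =
  fixes l n d :: nat and D :: "real mat"
  assumes l1: "l \<ge> 1" and n1: "n \<ge> 1" and d1: "d \<ge> 1"
    and D: "D \<in> carrier_mat d d" and sym: "transpose_mat D = D"
begin

definition fam_weight :: "nat set \<Rightarrow> (nat \<times> int \<Rightarrow> nat \<times> int) \<Rightarrow> real" where
  "fam_weight S \<tau> = pairing_weight n D (pts l S) (fam_delta l S) (fam_eps l S) \<tau>"

definition conn_sum :: "nat set \<Rightarrow> real" where
  "conn_sum S = (\<Sum>\<tau> | \<tau> \<in> pairings (pts l S) \<and> connected_family l S \<tau>. fam_weight S \<tau>)"

definition all_sum :: "nat set \<Rightarrow> real" where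
  "all_sum S = (\<Sum>\<tau>\<in>pairings (pts l S). fam_weight S \<tau>)"

definition mom :: "nat \<Rightarrow> real" where
  "mom k = (\<integral>\<omega>. wishart_trace l n D \<omega> ^ k \<partial>gaussian_space d n)"

text \<open>
  By \<open>moment_cumulant\<close> these are the cumulants of \<open>X\<close>; the labels of the circles do not
  matter (\<open>conn_sum_and_recursion\<close>).
\<close>

definition cum :: "nat \<Rightarrow> real" where
  "cum k = conn_sum {..<k}"

lemma has_integral_wishart_power:
  assumes "finite S"
  shows "has_bochner_integral (gaussian_space d n) (\<lambda>\<omega>. wishart_trace l n D \<omega> ^ card S) (all_sum S)"
  using genus_expansion[OF n1 finite_pts[OF assms, of l] fam_delta_pairing fam_eps_pairing fam_transversal D sym d1]
  unfolding trace_sum_family[OF l1 D assms, abs_def] all_sum_def fam_weight_def .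

lemma integrable_wishart_power: "integrable (gaussian_space d n) (\<lambda>\<omega>. wishart_trace l n D \<omega> ^ k)"
  using has_integral_wishart_power[of "{..<k}"] by (simp add: has_bochner_integral_iff)

lemma all_sum_eq_mom: "finite S \<Longrightarrow> all_sum S = mom (card S)"
  unfolding mom_def using has_bochner_integral_integral_eq[OF has_integral_wishart_power] by simp

lemma fam_weight_split:
  assumes S: "finite S" "T \<subseteq> S" and \<tau>: "\<tau> \<in> pairings (pts l S)" and cl: "\<tau> ` pts l T \<subseteq> pts l T"
    "\<tau> ` pts l (S - T) \<subseteq> pts l (S - T)"
  shows "fam_weight S \<tau> = fam_weight T (perm_restrict \<tau> (pts l T)) * fam_weight (S - T) (perm_restrict \<tau> (pts l (S - T)))"
proof -
  let ?A = "pts l T" and ?B = "pts l (S - T)"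
  have P: "pts l S = ?A \<union> ?B" using S by (auto simp: pts_def)
  have rd: "perm_restrict (fam_delta l S) (pts l U) = fam_delta l U"
    "perm_restrict (fam_eps l S) (pts l U) = fam_eps l U" if "U \<subseteq> S" for U
    using that by (auto simp: fun_eq_iff perm_restrict_def fam_delta_def fam_eps_def pts_def circ_delta_def circ_eps_def)
  have im: "fam_delta l S ` pts l U \<subseteq> pts l U" "fam_eps l S ` pts l U \<subseteq> pts l U" if "U \<subseteq> S" for U
    using that pairingsD(2)[OF circ_delta_pairing[of l]] pairingsD(2)[OF circ_eps_pairing[of l]]
    by (auto simp: fam_delta_def fam_eps_def pts_def)
  have fs: "finite T" "finite (S - T)" using S finite_subset by auto
  have ST: "S - T \<subseteq> S" by auto
  have "pairing_weight n D (?A \<union> ?B) (fam_delta l S) (fam_eps l S) \<tau>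
    = pairing_weight n D ?A (perm_restrict (fam_delta l S) ?A) (perm_restrict (fam_eps l S) ?A) (perm_restrict \<tau> ?A)
    * pairing_weight n D ?B (perm_restrict (fam_delta l S) ?B) (perm_restrict (fam_eps l S) ?B) (perm_restrict \<tau> ?B)"
  proof (rule pairing_weight_Un[where TA = "fam_half l T" and TB = "fam_half l (S - T)", OF _ _ _ _ _ _ _ _ _ _ cl _ _ D sym d1])
    show "finite ?A" "finite ?B" using finite_pts fs by auto
    show "?A \<inter> ?B = {}" by (auto simp: pts_def)
    show "fam_delta l S \<in> pairings (?A \<union> ?B)" "fam_eps l S \<in> pairings (?A \<union> ?B)" "\<tau> \<in> pairings (?A \<union> ?B)"
      using \<tau> fam_delta_pairing[of l S] fam_eps_pairing[of l S] unfolding P by auto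
    show "transversal ?A (perm_restrict (fam_delta l S) ?A) (fam_half l T)"
      "transversal ?B (perm_restrict (fam_delta l S) ?B) (fam_half l (S - T))"
      unfolding rd[OF S(2)] rd[OF ST] by (rule fam_transversal)+
  qed (use im S in auto)
  then show ?thesis unfolding fam_weight_def P[symmetric] rd[OF S(2)] rd[OF ST] .
qed

lemma closed_complement:
  assumes "\<tau> \<in> pairings (pts l S)" "T \<subseteq> S" "\<tau> ` pts l T \<subseteq> pts l T"
  shows "\<tau> ` pts l (S - T) \<subseteq> pts l (S - T)"
proof (rule image_subsetI)
  note t = pairingsD[OF assms(1)]
  fix x assume x: "x \<in> pts l (S - T)"
  then have "\<tau> x \<in> pts l S" using t(2)[of x] by (auto simp: pts_def)
  moreover have "\<tau> x \<notin> pts l T"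
  proof
    assume "\<tau> x \<in> pts l T"
    then have "\<tau> (\<tau> x) \<in> pts l T" using assms(3) by blast
    then show False using t(4) x by (auto simp: pts_def)
  qed
  ultimately show "\<tau> x \<in> pts l (S - T)" by (auto simp: pts_def)
qed

text \<open>
  A pairing for which \<open>T\<close> is a union of components is a pairing on \<open>T\<close> together with one on \<open>S - T\<close>, and the weight
  is multiplicative.
\<close>

lemma restricted_sum:
  assumes S: "finite S" and T: "T \<subseteq> S" "i0 \<in> T"
  shows "(\<Sum>\<tau> | \<tau> \<in> pairings (pts l S) \<and> \<tau> ` pts l T \<subseteq> pts l T \<and> connected_family l T (perm_restrict \<tau> (pts l T)). fam_weight S \<tau>)
    = conn_sum T * all_sum (S - T)"
proof -
  let ?A = "pts l T" and ?B = "pts l (S - T)"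
  have P: "pts l S = ?A \<union> ?B" and disj: "?A \<inter> ?B = {}" using T by (auto simp: pts_def)
  let ?X = "{\<tau> \<in> pairings ?A. connected_family l T \<tau>}"
  let ?L = "{\<tau>. \<tau> \<in> pairings (pts l S) \<and> \<tau> ` ?A \<subseteq> ?A \<and> connected_family l T (perm_restrict \<tau> ?A)}"
  have "conn_sum T * all_sum (S - T) = (\<Sum>(\<tau>1, \<tau>2)\<in>?X \<times> pairings ?B. fam_weight T \<tau>1 * fam_weight (S - T) \<tau>2)"
    unfolding conn_sum_def all_sum_def by (simp add: sum_product sum.cartesian_product)
  also have "\<dots> = (\<Sum>\<tau>\<in>?L. fam_weight S \<tau>)"
  proof (rule sum.reindex_bij_witness[where i = "\<lambda>\<tau>. (perm_restrict \<tau> ?A, perm_restrict \<tau> ?B)"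
        and j = "\<lambda>(\<tau>1, \<tau>2) x. if x \<in> ?A then \<tau>1 x else \<tau>2 x"])
    fix p assume p: "p \<in> ?X \<times> pairings ?B"
    obtain \<tau>1 \<tau>2 where pp: "p = (\<tau>1, \<tau>2)" by (cases p)
    have t1: "\<tau>1 \<in> pairings ?A" "connected_family l T \<tau>1" and t2: "\<tau>2 \<in> pairings ?B" using p pp by auto
    note d1 = pairingsD[OF t1(1)] and d2 = pairingsD[OF t2]
    let ?t = "\<lambda>x. if x \<in> ?A then \<tau>1 x else \<tau>2 x"
    have B2: "\<tau>2 x \<notin> ?A" if "x \<notin> ?A" for x using d2(2)[of x] d2(5)[of x] that disj by (cases "x \<in> ?B") auto
    have tP: "?t \<in> pairings (pts l S)" unfolding P
      by (rule pairings_by_involution) (use d1 d2 B2 disj in auto)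
    have r1: "perm_restrict ?t ?A = \<tau>1" using d1(5) by (auto simp: fun_eq_iff perm_restrict_def)
    have r2: "perm_restrict ?t ?B = \<tau>2" using d2(5) disj by (auto simp: fun_eq_iff perm_restrict_def)
    have cl: "?t ` ?A \<subseteq> ?A" using d1(2) by auto
    show "(perm_restrict ((\<lambda>(\<tau>1, \<tau>2) x. if x \<in> ?A then \<tau>1 x else \<tau>2 x) p) ?A,
        perm_restrict ((\<lambda>(\<tau>1, \<tau>2) x. if x \<in> ?A then \<tau>1 x else \<tau>2 x) p) ?B) = p"
      using r1 r2 pp by simp
    show "(\<lambda>(\<tau>1, \<tau>2) x. if x \<in> ?A then \<tau>1 x else \<tau>2 x) p \<in> ?L"
      unfolding pp prod.case using tP cl r1 t1(2) by simp
    have "fam_weight S ?t = fam_weight T \<tau>1 * fam_weight (S - T) \<tau>2"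
      using fam_weight_split[OF S T(1) tP cl closed_complement[OF tP T(1) cl]] unfolding r1 r2 .
    then show "fam_weight S ((\<lambda>(\<tau>1, \<tau>2) x. if x \<in> ?A then \<tau>1 x else \<tau>2 x) p)
        = (case p of (\<tau>1, \<tau>2) \<Rightarrow> fam_weight T \<tau>1 * fam_weight (S - T) \<tau>2)"
      unfolding pp prod.case .
  next
    fix \<tau> assume t: "\<tau> \<in> ?L"
    then have tP: "\<tau> \<in> pairings (pts l S)" and cl: "\<tau> ` ?A \<subseteq> ?A" and cn: "connected_family l T (perm_restrict \<tau> ?A)" by auto
    note d = pairingsD[OF tP]
    show "(\<lambda>(\<tau>1, \<tau>2) x. if x \<in> ?A then \<tau>1 x else \<tau>2 x) (perm_restrict \<tau> ?A, perm_restrict \<tau> ?B) = \<tau>"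
      using d(5) P by (auto simp: fun_eq_iff perm_restrict_def)
    show "(perm_restrict \<tau> ?A, perm_restrict \<tau> ?B) \<in> ?X \<times> pairings ?B"
      using perm_restrict_pairing[OF tP _ cl] perm_restrict_pairing[OF tP _ closed_complement[OF tP T(1) cl]] P cn by simp
  qed
  finally show ?thesis by simp
qed

text \<open>
  Sorts the pairings by the set \<open>T\<close> of circles in the component of the circle \<open>i0\<close>. That component is the
  least \<open>\<tau>\<close>-closed set of circles that contains \<open>i0\<close>.
\<close>

lemma all_sum_decompose:
  assumes S: "finite S" and i0: "i0 \<in> S"
  shows "all_sum S = (\<Sum>T | T \<subseteq> S \<and> i0 \<in> T. conn_sum T * all_sum (S - T))"
proof -
  \<comment> \<open>The component of \<open>i0\<close>: an intersection of closed sets is closed.\<close>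
  define cc where "cc \<tau> = \<Inter> {T. T \<subseteq> S \<and> i0 \<in> T \<and> \<tau> ` pts l T \<subseteq> pts l T}" for \<tau>
  let ?Ts = "{T. T \<subseteq> S \<and> i0 \<in> T}"
  have cc_min: "cc \<tau> \<subseteq> T" if "T \<subseteq> S" "i0 \<in> T" "\<tau> ` pts l T \<subseteq> pts l T" for \<tau> T
    unfolding cc_def by (rule Inter_lower) (use that in simp)
  have cc1: "cc \<tau> \<subseteq> S" "i0 \<in> cc \<tau>" "\<tau> ` pts l (cc \<tau>) \<subseteq> pts l (cc \<tau>)" if \<tau>: "\<tau> \<in> pairings (pts l S)" for \<tau>
  proof -
    have Sc: "\<tau> ` pts l S \<subseteq> pts l S" using pairingsD(2)[OF \<tau>] by auto
    then show "cc \<tau> \<subseteq> S" "i0 \<in> cc \<tau>" using i0 unfolding cc_def by blast+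
    show "\<tau> ` pts l (cc \<tau>) \<subseteq> pts l (cc \<tau>)"
    proof (rule image_subsetI)
      fix x assume x: "x \<in> pts l (cc \<tau>)"
      have "\<tau> x \<in> pts l T" if T: "T \<subseteq> S" "i0 \<in> T" "\<tau> ` pts l T \<subseteq> pts l T" for T
      proof -
        have "cc \<tau> \<subseteq> T" using T by (rule cc_min)
        then have "x \<in> pts l T" using x by (auto simp: pts_def)
        then show ?thesis using T by blast
      qed
      then have "fst (\<tau> x) \<in> cc \<tau> \<and> snd (\<tau> x) \<in> pm l"
        using i0 Sc unfolding cc_def pts_def by (auto simp: mem_Times_iff)
      then show "\<tau> x \<in> pts l (cc \<tau>)" by (auto simp: pts_def mem_Times_iff)
    qed
  qed
  have iff: "cc \<tau> = T \<longleftrightarrow> \<tau> ` pts l T \<subseteq> pts l T \<and> connected_family l T (perm_restrict \<tau> (pts l T))"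
    if \<tau>: "\<tau> \<in> pairings (pts l S)" and T: "T \<subseteq> S" "i0 \<in> T" for \<tau> T
  proof
    assume c: "cc \<tau> = T"
    have clT: "\<tau> ` pts l T \<subseteq> pts l T" using cc1[OF \<tau>] c by simp
    have "connected_family l T (perm_restrict \<tau> (pts l T))" unfolding connected_family_def
    proof (intro allI impI)
      fix T' assume T': "T' \<subseteq> T" "T' \<noteq> {}" "perm_restrict \<tau> (pts l T) ` pts l T' \<subseteq> pts l T'"
      have sub: "pts l T' \<subseteq> pts l T" using T' by (auto simp: pts_def)
      have clT': "\<tau> ` pts l T' \<subseteq> pts l T'" using T'(3) sub by (auto simp: perm_restrict_def image_subset_iff)
      show "T' = T"
      proof (cases "i0 \<in> T'")
        case True
        have "cc \<tau> \<subseteq> T'" by (rule cc_min[OF _ True clT']) (use T' T in auto)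
        then show ?thesis using c T' by auto
      next
        case False
        have "\<tau> ` pts l (T - T') \<subseteq> pts l (T - T')"
        proof (rule image_subsetI)
          fix x assume x: "x \<in> pts l (T - T')"
          have "x \<in> pts l T" "x \<in> pts l (S - T')" using x T by (auto simp: pts_def)
          moreover have "\<tau> ` pts l (S - T') \<subseteq> pts l (S - T')"
            by (rule closed_complement[OF \<tau> _ clT']) (use T' T in auto)
          ultimately have "\<tau> x \<in> pts l T" "\<tau> x \<in> pts l (S - T')" using clT by blast+
          then show "\<tau> x \<in> pts l (T - T')" by (auto simp: pts_def)
        qed
        then have "cc \<tau> \<subseteq> T - T'" by (rule cc_min[rotated 2]) (use T False in auto)
        then show ?thesis using c T' by blast
      qed
    qed
    then show "\<tau> ` pts l T \<subseteq> pts l T \<and> connected_family l T (perm_restrict \<tau> (pts l T))" using clT by simp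
  next
    assume a: "\<tau> ` pts l T \<subseteq> pts l T \<and> connected_family l T (perm_restrict \<tau> (pts l T))"
    have sub: "cc \<tau> \<subseteq> T" by (rule cc_min[OF T]) (use a in simp)
    then have "perm_restrict \<tau> (pts l T) ` pts l (cc \<tau>) = \<tau> ` pts l (cc \<tau>)"
      by (intro image_cong) (auto simp: perm_restrict_def pts_def)
    then have "perm_restrict \<tau> (pts l T) ` pts l (cc \<tau>) \<subseteq> pts l (cc \<tau>)" using cc1(3)[OF \<tau>] by simp
    then show "cc \<tau> = T" using a sub cc1(2)[OF \<tau>] unfolding connected_family_def by blast
  qed
  have finT: "finite ?Ts" by (rule finite_subset[of _ "Pow S"]) (use S in auto)
  have "all_sum S = (\<Sum>T\<in>?Ts. \<Sum>\<tau> | \<tau> \<in> pairings (pts l S) \<and> cc \<tau> = T. fam_weight S \<tau>)"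
    unfolding all_sum_def
    by (rule sum.group[symmetric, OF finite_pairings[OF finite_pts[OF S]] finT]) (use cc1 in auto)
  also have "\<dots> = (\<Sum>T\<in>?Ts. conn_sum T * all_sum (S - T))"
  proof (rule sum.cong[OF refl])
    fix T assume "T \<in> ?Ts"
    then have T: "T \<subseteq> S" "i0 \<in> T" by auto
    have "{\<tau>. \<tau> \<in> pairings (pts l S) \<and> cc \<tau> = T} = {\<tau>. \<tau> \<in> pairings (pts l S) \<and> \<tau> ` pts l T \<subseteq> pts l T \<and> connected_family l T (perm_restrict \<tau> (pts l T))}"
      using iff[OF _ T] by blast
    then show "(\<Sum>\<tau> | \<tau> \<in> pairings (pts l S) \<and> cc \<tau> = T. fam_weight S \<tau>) = conn_sum T * all_sum (S - T)"
      using restricted_sum[OF S T] by simp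
  qed
  finally show ?thesis .
qed

lemma sum_subsets_containing:
  assumes S: "finite S" "card S = Suc k" and i0: "i0 \<in> S"
  shows "(\<Sum>T | T \<subseteq> S \<and> i0 \<in> T. f (card T)) = (\<Sum>j\<le>k. real (k choose j) * f (Suc j))"
proof -
  let ?S = "S - {i0}"
  have cS: "card ?S = k" and fS: "finite ?S" using assms by auto
  have "(\<Sum>T | T \<subseteq> S \<and> i0 \<in> T. f (card T)) = (\<Sum>T\<in>Pow ?S. f (Suc (card T)))"
  proof (rule sum.reindex_bij_witness[where i = "insert i0" and j = "\<lambda>T. T - {i0}"])
    fix T assume T: "T \<in> {T. T \<subseteq> S \<and> i0 \<in> T}"
    then have "finite T" using S finite_subset by auto
    then have "Suc (card (T - {i0})) = card T" using T by (metis card.remove mem_Collect_eq)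
    then show "f (Suc (card (T - {i0}))) = f (card T)" by simp
  qed (use i0 in auto)
  also have "\<dots> = (\<Sum>j\<le>k. \<Sum>T | T \<in> Pow ?S \<and> card T = j. f (Suc (card T)))"
  proof (rule sum.group[symmetric])
    show "card ` Pow ?S \<subseteq> {..k}" using card_mono[OF fS] cS by auto
  qed (use fS in auto)
  also have "\<dots> = (\<Sum>j\<le>k. real (k choose j) * f (Suc j))"
  proof (rule sum.cong[OF refl])
    fix j
    have "(\<Sum>T | T \<in> Pow ?S \<and> card T = j. f (Suc (card T))) = (\<Sum>T | T \<subseteq> ?S \<and> card T = j. f (Suc j))"
      by (intro sum.cong) auto
    also have "\<dots> = real (card {T. T \<subseteq> ?S \<and> card T = j}) * f (Suc j)" by simp
    also have "card {T. T \<subseteq> ?S \<and> card T = j} = k choose j" using n_subsets[OF fS, of j] cS by simp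
    finally show "(\<Sum>T | T \<in> Pow ?S \<and> card T = j. f (Suc (card T))) = real (k choose j) * f (Suc j)" .
  qed
  finally show ?thesis .
qed

text \<open>
  The sum over all pairings is a moment and depends only on the number of circles. Solving the decomposition for the
  term \<open>T = S\<close> shows by induction the same for the connected sum. So the invariance under
  relabelling of circles comes from the moments, and the sum over \<open>T\<close> can be sorted by cardinality.
\<close>

lemma conn_sum_and_recursion:
  "(\<forall>S. finite S \<longrightarrow> card S = Suc k \<longrightarrow> conn_sum S = cum (Suc k)) \<and>
   mom (Suc k) = (\<Sum>j\<le>k. real (k choose j) * (cum (Suc j) * mom (k - j)))"
proof (induction k rule: less_induct)
  case (less k)
  let ?R = "\<Sum>j\<le>k. real (k choose j) * (cum (Suc j) * mom (k - j))"
  have key: "mom (Suc k) = conn_sum S - cum (Suc k) + ?R" if S: "finite S" "card S = Suc k" for S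
  proof -
    have mom0: "mom 0 = 1"
      using prob_space.prob_space[OF prob_space_gaussian[OF n1, of d]] by (simp add: mom_def)
    obtain i0 where i0: "i0 \<in> S" using S by (metis card.empty equals0I nat.distinct(1))
    let ?Ts = "{T. T \<subseteq> S \<and> i0 \<in> T}"
    have finT: "finite ?Ts" by (rule finite_subset[of _ "Pow S"]) (use S in auto)
    have ST: "S \<in> ?Ts" using i0 by auto
    have small: "conn_sum T * all_sum (S - T) = cum (card T) * mom (Suc k - card T)" if T: "T \<in> ?Ts - {S}" for T
    proof -
      have T': "T \<subset> S" "i0 \<in> T" "finite T" using T S finite_subset[of T S] by auto
      have c: "card T < Suc k" using psubset_card_mono[OF S(1) T'(1)] S(2) by simp
      obtain m where m: "card T = Suc m" using T' by (metis card_Suc_Diff1)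
      have "conn_sum T = cum (card T)" using less.IH[of m] c m T' by simp
      moreover have "card (S - T) = Suc k - card T" using card_Diff_subset[OF T'(3)] T'(1) S(2) by auto
      ultimately show ?thesis using all_sum_eq_mom[of "S - T"] S by simp
    qed
    have "mom (Suc k) = all_sum S" using all_sum_eq_mom[OF S(1)] S(2) by simp
    also have "\<dots> = conn_sum S * all_sum (S - S) + (\<Sum>T\<in>?Ts - {S}. conn_sum T * all_sum (S - T))"
      unfolding all_sum_decompose[OF S(1) i0] by (rule sum.remove[OF finT ST])
    also have "\<dots> = conn_sum S + (\<Sum>T\<in>?Ts - {S}. cum (card T) * mom (Suc k - card T))"
      using sum.cong[OF refl small, of "?Ts - {S}"] all_sum_eq_mom[of "{}"] mom0 by simp
    also have "(\<Sum>T\<in>?Ts - {S}. cum (card T) * mom (Suc k - card T))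
        = (\<Sum>T\<in>?Ts. cum (card T) * mom (Suc k - card T)) - cum (Suc k)"
      using sum.remove[OF finT ST, of "\<lambda>T. cum (card T) * mom (Suc k - card T)"] S(2) mom0 by simp
    also have "(\<Sum>T\<in>?Ts. cum (card T) * mom (Suc k - card T)) = ?R"
      using sum_subsets_containing[OF S i0, of "\<lambda>c. cum c * mom (Suc k - c)"] by simp
    finally show ?thesis by simp
  qed
  have "mom (Suc k) = ?R" using key[of "{..<Suc k}"] by (simp add: cum_def)
  then show ?case using key by auto
qed

theorem moment_cumulant:
  "mom (Suc k) = (\<Sum>j\<le>k. real (k choose j) * cum (Suc j) * mom (k - j))"
  using conn_sum_and_recursion[of k] by (simp add: mult.assoc)

lemma mom_0: "mom 0 = 1"
  using prob_space.prob_space[OF prob_space_gaussian[OF n1, of d]] by (simp add: mom_def)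

end

section \<open>Premaps\<close>

text \<open>
  A surjection that respects the edges induces a surjection on components.
\<close>

lemma ncomp_map_le:
  assumes fin: "finite P" and im: "c ` P = P'" and E: "\<And>x y. (x, y) \<in> E \<Longrightarrow> x \<in> P \<and> y \<in> P \<and> (c x, c y) \<in> eqcl P' E'"
  shows "ncomp P' E' \<le> ncomp P E"
proof -
  let ?R = "eqcl P E" and ?S = "eqcl P' E'"
  have "?R \<subseteq> {(x, y) \<in> P \<times> P. (c x, c y) \<in> ?S}"
  proof (rule eqcl_least)
    show "E \<subseteq> {(x, y) \<in> P \<times> P. (c x, c y) \<in> ?S}" using E by auto
    show "equiv P {(x, y) \<in> P \<times> P. (c x, c y) \<in> ?S}"
      using im by (intro equivI) (auto simp: refl_on_def sym_def trans_def intro: eqcl_refl eqcl_sym eqcl_trans)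
  qed
  then have RS: "(c x, c y) \<in> ?S" if "(x, y) \<in> ?R" for x y using that by auto
  have "P' // ?S \<subseteq> (\<lambda>C. ?S `` (c ` C)) ` (P // ?R)"
  proof
    fix X assume "X \<in> P' // ?S"
    then obtain y where y: "y \<in> P'" "X = ?S `` {y}" by (rule quotientE)
    then obtain x where x: "x \<in> P" "y = c x" using im by auto
    have "?S `` (c ` (?R `` {x})) = ?S `` {y}"
    proof (intro subset_antisym subsetI)
      fix z assume "z \<in> ?S `` (c ` (?R `` {x}))"
      then obtain w where w: "(x, w) \<in> ?R" "(c w, z) \<in> ?S" by auto
      show "z \<in> ?S `` {y}" using eqcl_trans[OF RS[OF w(1)] w(2)] x(2) by simp
    next
      fix z assume "z \<in> ?S `` {y}"
      then show "z \<in> ?S `` (c ` (?R `` {x}))" using x eqcl_refl[OF x(1), of E] by auto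
    qed
    then show "X \<in> (\<lambda>C. ?S `` (c ` C)) ` (P // ?R)" using y x by (auto intro!: image_eqI[OF _ quotientI])
  qed
  then have "card (P' // ?S) \<le> card ((\<lambda>C. ?S `` (c ` C)) ` (P // ?R))"
    by (intro card_mono finite_imageI finite_quot[OF fin])
  also have "\<dots> \<le> card (P // ?R)" by (rule card_image_le[OF finite_quot[OF fin]])
  finally show ?thesis by (simp add: ncomp_def)
qed

lemma ncomp_conjugate:
  assumes fin: "finite P" and c: "c permutes P" and f: "f permutes P" "g permutes P" "f' permutes P" "g' permutes P"
    and eq: "\<And>x. c (f x) = f' (c x)" "\<And>x. c (g x) = g' (c x)"
  shows "ncomp2 P f' g' = ncomp2 P f g"
proof (rule antisym)
  let ?E = "graph_on P f \<union> graph_on P g" and ?E' = "graph_on P f' \<union> graph_on P g'"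
  let ?i = "inv_into UNIV c"
  note pin = permutes_in_image[OF c] permutes_in_image[OF f(1)] permutes_in_image[OF f(2)]
    permutes_in_image[OF f(3)] permutes_in_image[OF f(4)] permutes_in_image[OF permutes_inv[OF c]]
  have inv: "c (?i x) = x" "?i (c x) = x" for x using permutes_inverses[OF c] by auto
  have eq': "?i (f' x) = f (?i x)" "?i (g' x) = g (?i x)" for x
    using eq[of "?i x"] inv by metis+
  show "ncomp P ?E' \<le> ncomp P ?E"
  proof (rule ncomp_map_le[OF fin permutes_image[OF c]])
    fix x y assume "(x, y) \<in> ?E"
    then have xy: "x \<in> P" "y = f x \<or> y = g x" by (auto simp: graph_on_def)
    then have "(c x, c y) \<in> ?E'" using eq pin by (auto simp: graph_on_def)
    then show "x \<in> P \<and> y \<in> P \<and> (c x, c y) \<in> eqcl P ?E'" using xy pin by (auto intro!: eqcl_edge)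
  qed
  show "ncomp P ?E \<le> ncomp P ?E'"
  proof (rule ncomp_map_le[OF fin permutes_image[OF permutes_inv[OF c]]])
    fix x y assume "(x, y) \<in> ?E'"
    then have xy: "x \<in> P" "y = f' x \<or> y = g' x" by (auto simp: graph_on_def)
    then have e: "(?i x, ?i y) \<in> ?E" using eq' pin by (auto simp: graph_on_def)
    have yP: "y \<in> P" using xy pin(4,5) by auto
    have "(?i x, ?i y) \<in> eqcl P ?E" using xy yP pin(6) by (intro eqcl_edge[OF e]) simp_all
    then show "x \<in> P \<and> y \<in> P \<and> (?i x, ?i y) \<in> eqcl P ?E" using xy yP by simp
  qed
qed

lemma circle_ncomp:
  assumes l: "l \<ge> 1"
  shows "ncomp2 (pm l) (circ_delta l) (circ_eps l) = 1"
proof (rule antisym)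
  let ?P = "pts l {0}"
  let ?E = "graph_on ?P (fam_delta l {0}) \<union> graph_on ?P (fam_eps l {0})"
  let ?F = "graph_on (pm l) (circ_delta l) \<union> graph_on (pm l) (circ_eps l)"
  note cd = pairingsD(2)[OF circ_delta_pairing[of l]] pairingsD(2)[OF circ_eps_pairing[of l]]
  have "ncomp (pm l) ?F \<le> ncomp ?P ?E"
  proof (rule ncomp_map_le[where c = snd])
    show "finite ?P" by (rule finite_pts) simp
    show "snd ` ?P = pm l" by (auto simp: pts_def)
    fix x y assume "(x, y) \<in> ?E"
    then have xy: "x \<in> ?P" "y \<in> ?P" "(snd x, snd y) \<in> ?F"
      using cd by (auto simp: graph_on_def pts_def fam_delta_def fam_eps_def)
    then show "x \<in> ?P \<and> y \<in> ?P \<and> (snd x, snd y) \<in> eqcl (pm l) ?F"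
      by (auto intro!: eqcl_edge simp: pts_def)
  qed
  also have "?P // eqcl ?P ?E \<subseteq> {eqcl ?P ?E `` {(0, 1)}}"
  proof
    fix X assume "X \<in> ?P // eqcl ?P ?E"
    then obtain x where x: "x \<in> ?P" "X = eqcl ?P ?E `` {x}" by (rule quotientE)
    then have "((0, 1), x) \<in> eqcl ?P ?E" using circle_connected[OF l, of 0 "{0}" "snd x"] by (auto simp: pts_def)
    then have "eqcl ?P ?E `` {(0, 1)} = X" unfolding x(2) by (rule equiv_class_eq[OF equiv_eqcl])
    then show "X \<in> {eqcl ?P ?E `` {(0, 1)}}" by simp
  qed
  then have "ncomp ?P ?E \<le> card {eqcl ?P ?E `` {(0, 1)}}" unfolding ncomp_def by (rule card_mono[rotated]) simp
  finally show "ncomp (pm l) ?F \<le> 1" by simp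
  have "eqcl (pm l) ?F `` {1} \<in> pm l // eqcl (pm l) ?F" by (rule quotientI) (use l in \<open>simp add: pm_def\<close>)
  then show "1 \<le> ncomp (pm l) ?F" using finite_quot[OF finite_pm] unfolding ncomp_def
    by (metis One_nat_def Suc_leI card_gt_0_iff empty_iff)
qed

lemma inverse_of_product:
  assumes "\<delta> \<in> pairings P" "\<tau> \<in> pairings P"
  shows "inv_into UNIV (\<delta> \<circ> \<tau>) = \<tau> \<circ> \<delta>"
  using pairingsD(4)[OF assms(1)] pairingsD(4)[OF assms(2)]
  by (intro inv_unique_comp) (auto simp: fun_eq_iff)

text \<open>
  The condition \<open>\<pi>(k) = -\<pi>\<inverse>(-k)\<close> says that \<open>\<delta> \<circ> \<pi>\<close> is an involution, and the condition on
  cycles excludes its fixed points; conversely it holds by \<open>pairing_not_in_orbit\<close>.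
\<close>

lemma bij_betw_pairings_premaps:
  "bij_betw (\<lambda>\<tau>. circ_delta l \<circ> \<tau>) (pairings (pm l)) (premaps l)"
proof (rule bij_betw_byWitness[where f' = "\<lambda>\<pi>. circ_delta l \<circ> \<pi>"])
  let ?d = "circ_delta l"
  note d = pairingsD[OF circ_delta_pairing[of l]]
  have dm: "?d k = - k" if "k \<in> pm l" for k using that by (simp add: circ_delta_def)
  have um: "- k \<in> pm l \<longleftrightarrow> k \<in> pm l" for k by (auto simp: pm_def)
  show "\<forall>\<tau>\<in>pairings (pm l). ?d \<circ> (?d \<circ> \<tau>) = \<tau>" "\<forall>\<pi>\<in>premaps l. ?d \<circ> (?d \<circ> \<pi>) = \<pi>"
    using d(4) by (auto simp: fun_eq_iff)
  show "(\<lambda>\<tau>. ?d \<circ> \<tau>) ` pairings (pm l) \<subseteq> premaps l"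
  proof (rule image_subsetI)
    fix \<tau> assume \<tau>: "\<tau> \<in> pairings (pm l)"
    note t = pairingsD[OF \<tau>]
    let ?p = "?d \<circ> \<tau>"
    have pp: "?p permutes pm l" using d(1) t(1) by (intro permutes_compose)
    have perm: "permutation ?p" using pp finite_pm permutation_permutes by blast
    have "?p k = - inv_into UNIV ?p (- k)" if k: "k \<in> pm l" for k
      unfolding inverse_of_product[OF circ_delta_pairing \<tau>] using dm[of "- k"] dm[OF t(2)[OF k]] um k by simp
    moreover have False if c: "c \<in> cycle_sets (pm l) ?p" "k \<in> c" "- k \<in> c" for c k
    proof -
      obtain x where x: "x \<in> pm l" "c = orbit ?p x" using c(1) by (auto simp: cycle_sets_def)
      have kP: "k \<in> pm l" using c(2) x permutes_orbit_subset[OF pp x(1)] by auto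
      have "orbit ?p k = c" using c(2) x cyclic_on_orbit'[OF perm] orbit_cyclic_eq3 by metis
      then show False using pairing_not_in_orbit[OF circ_delta_pairing \<tau> kP] c(3) dm[OF kP] by simp
    qed
    ultimately show "?p \<in> premaps l" using pp unfolding premaps_def by blast
  qed
  show "(\<lambda>\<pi>. ?d \<circ> \<pi>) ` premaps l \<subseteq> pairings (pm l)"
  proof (rule image_subsetI)
    fix \<pi> assume \<pi>: "\<pi> \<in> premaps l"
    have pp: "\<pi> permutes pm l" and inv: "\<And>k. k \<in> pm l \<Longrightarrow> \<pi> k = - inv_into UNIV \<pi> (- k)"
      and cyc: "\<And>c k. c \<in> cycle_sets (pm l) \<pi> \<Longrightarrow> k \<in> c \<Longrightarrow> - k \<in> c \<Longrightarrow> False"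
      using \<pi> unfolding premaps_def by blast+
    have perm: "permutation \<pi>" using pp finite_pm permutation_permutes by blast
    have pin: "\<pi> k \<in> pm l" if "k \<in> pm l" for k using that pp by (simp add: permutes_in_image)
    show "?d \<circ> \<pi> \<in> pairings (pm l)"
    proof (rule pairings_by_involution)
      fix k assume k: "k \<in> pm l"
      show "(?d \<circ> \<pi>) k \<in> pm l" using k pin d(2) by simp
      show "(?d \<circ> \<pi>) k \<noteq> k"
      proof
        assume "(?d \<circ> \<pi>) k = k"
        then have "\<pi> k = - k" using dm[OF pin[OF k]] by simp
        then have "- k \<in> orbit \<pi> k" by (metis orbit.base)
        moreover have "k \<in> orbit \<pi> k" using perm by (rule permutation_self_in_orbit)
        ultimately show False using cyc[of "orbit \<pi> k" k] k by (auto simp: cycle_sets_def)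
      qed
      have "\<pi> (- \<pi> k) = - inv_into UNIV \<pi> (\<pi> k)" using inv[of "- \<pi> k"] um pin[OF k] by simp
      also have "\<dots> = - k" using permutes_inverses(2)[OF pp] by simp
      finally show "(?d \<circ> \<pi>) ((?d \<circ> \<pi>) k) = k" using dm[OF pin[OF k]] dm[of "- k"] um k by simp
    next
      fix k assume "k \<notin> pm l"
      then show "(?d \<circ> \<pi>) k = k" using pp d(5) by (simp add: permutes_def)
    qed
  qed
qed

lemma orbit_delta_image:
  assumes fin: "finite P" and \<delta>: "\<delta> \<in> pairings P" and \<tau>: "\<tau> \<in> pairings P"
  shows "\<delta> ` orbit (\<delta> \<circ> \<tau>) x = orbit (\<delta> \<circ> \<tau>) (\<delta> x)"
proof -
  have "\<delta> \<circ> \<tau> permutes P" using pairingsD(1)[OF \<delta>] pairingsD(1)[OF \<tau>] by (intro permutes_compose)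
  then have perm: "permutation (\<delta> \<circ> \<tau>)" using fin permutation_permutes by blast
  have "\<delta> ` orbit (\<delta> \<circ> \<tau>) x = orbit (\<tau> \<circ> \<delta>) (\<delta> x)"
    by (rule orbit_inverse[OF permutation_self_in_orbit[OF perm]]) (simp add: pairingsD(4)[OF \<delta>] pairingsD(4)[OF \<tau>])
  also have "\<dots> = orbit (\<delta> \<circ> \<tau>) (\<delta> x)"
    using orbit_inv_eq[OF perm] inverse_of_product[OF \<delta> \<tau>] by simp
  finally show ?thesis .
qed

text \<open>
  The cycles that \<open>\<delta>\<close> interchanges contain the same absolute values, and \<open>k\<close> and \<open>-k\<close> are never on one
  cycle. So the least absolute value is attained once in each of the two cycles, with opposite signs, and
  exactly one of them is particular.
\<close>

lemma half_set_transversal: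
  assumes \<tau>: "\<tau> \<in> pairings (pm l)"
  defines "\<pi> \<equiv> circ_delta l \<circ> \<tau>"
  shows "transversal (pm l) (circ_delta l) (half_set l \<pi>)" "\<pi> ` half_set l \<pi> \<subseteq> half_set l \<pi>"
proof -
  let ?d = "circ_delta l"
  note d = pairingsD[OF circ_delta_pairing[of l]] and t = pairingsD[OF \<tau>]
  have dm: "?d k = - k" if "k \<in> pm l" for k using that by (simp add: circ_delta_def)
  have pp: "\<pi> permutes pm l" unfolding \<pi>_def using d(1) t(1) by (intro permutes_compose)
  have perm: "permutation \<pi>" using pp finite_pm permutation_permutes by blast
  have self: "x \<in> orbit \<pi> x" for x using perm by (rule permutation_self_in_orbit)
  have eqo: "orbit \<pi> y = orbit \<pi> x" if "y \<in> orbit \<pi> x" for x y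
    using that cyclic_on_orbit'[OF perm] orbit_cyclic_eq3 by metis
  have sub: "orbit \<pi> x \<subseteq> pm l" if "x \<in> pm l" for x using permutes_orbit_subset[OF pp that] .
  have half: "half_set l \<pi> = {x \<in> pm l. particular (orbit \<pi> x)}"
  proof (intro subset_antisym subsetI)
    fix x assume "x \<in> half_set l \<pi>"
    then obtain y where "y \<in> pm l" "particular (orbit \<pi> y)" "x \<in> orbit \<pi> y"
      by (auto simp: half_set_def cycle_sets_def)
    then show "x \<in> {x \<in> pm l. particular (orbit \<pi> x)}" using eqo[of x y] sub[of y] by auto
  next
    fix x assume "x \<in> {x \<in> pm l. particular (orbit \<pi> x)}"
    then show "x \<in> half_set l \<pi>" using self by (auto simp: half_set_def cycle_sets_def)
  qed
  have od: "orbit \<pi> (?d x) = ?d ` orbit \<pi> x" for x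
    unfolding \<pi>_def by (rule orbit_delta_image[OF finite_pm circ_delta_pairing \<tau>, symmetric])
  have one: "particular (orbit \<pi> x) \<or> particular (orbit \<pi> (?d x))" if x: "x \<in> pm l" for x
  proof -
    let ?O = "orbit \<pi> x"
    have fin: "finite ?O" using sub[OF x] finite_pm finite_subset by auto
    obtain k where k: "k \<in> ?O" "\<And>j. j \<in> ?O \<Longrightarrow> \<bar>k\<bar> \<le> \<bar>j\<bar>"
      using ex_is_arg_min_if_finite[OF fin, of abs] self[of x] unfolding is_arg_min_linorder by auto
    have kP: "k \<in> pm l" using k sub[OF x] by auto
    have ab: "\<bar>?d j\<bar> = \<bar>j\<bar>" for j by (simp add: circ_delta_def)
    show ?thesis
    proof (cases "k > 0")
      case True
      then show ?thesis using k unfolding particular_def by blast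
    next
      case False
      then have "?d k > 0" using dm[OF kP] kP by (auto simp: pm_def)
      moreover have "\<forall>j\<in>orbit \<pi> (?d x). \<bar>?d k\<bar> \<le> \<bar>j\<bar>" unfolding od using k(2) ab by auto
      moreover have "?d k \<in> orbit \<pi> (?d x)" unfolding od using k(1) by blast
      ultimately show ?thesis unfolding particular_def by blast
    qed
  qed
  have notboth: False if x: "x \<in> pm l" and p: "particular (orbit \<pi> x)" "particular (orbit \<pi> (?d x))" for x
  proof -
    have ab: "\<bar>?d j\<bar> = \<bar>j\<bar>" for j by (simp add: circ_delta_def)
    obtain k where k: "k \<in> orbit \<pi> x" "k > 0" "\<forall>j\<in>orbit \<pi> x. \<bar>k\<bar> \<le> \<bar>j\<bar>" using p(1) unfolding particular_def by blast
    obtain k' where k': "k' \<in> orbit \<pi> (?d x)" "k' > 0" "\<forall>j\<in>orbit \<pi> (?d x). \<bar>k'\<bar> \<le> \<bar>j\<bar>" using p(2) unfolding particular_def by blast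
    obtain m where m: "m \<in> orbit \<pi> x" "k' = ?d m" using k'(1) unfolding od by auto
    have "?d k \<in> orbit \<pi> (?d x)" unfolding od using k(1) by blast
    then have "\<bar>k'\<bar> \<le> \<bar>k\<bar>" using k'(3) ab by metis
    moreover have "\<bar>k\<bar> \<le> \<bar>k'\<bar>" using k(3) m ab by metis
    ultimately have "k = k'" using k(2) k'(2) by simp
    then have "?d k = m" using m(2) d(4) by simp
    then have "?d k \<in> orbit \<pi> k" using m(1) eqo[OF k(1)] by simp
    moreover have "k \<in> pm l" using k(1) sub[OF x] by auto
    ultimately show False using pairing_not_in_orbit[OF circ_delta_pairing \<tau>, of k] unfolding \<pi>_def by blast
  qed
  show "transversal (pm l) ?d (half_set l \<pi>)" unfolding transversal_def
  proof
    show "half_set l \<pi> \<union> ?d ` half_set l \<pi> = pm l"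
    proof (intro subset_antisym subsetI)
      fix x assume x: "x \<in> pm l"
      show "x \<in> half_set l \<pi> \<union> ?d ` half_set l \<pi>"
      proof (cases "particular (orbit \<pi> x)")
        case False
        then have "?d x \<in> half_set l \<pi>" using one[OF x] x d(2) unfolding half by simp
        then have "?d (?d x) \<in> ?d ` half_set l \<pi>" by blast
        then show ?thesis using d(4) by simp
      qed (use x half in auto)
    qed (use half d(2) in auto)
    show "half_set l \<pi> \<inter> ?d ` half_set l \<pi> = {}"
    proof (rule ccontr)
      assume "half_set l \<pi> \<inter> ?d ` half_set l \<pi> \<noteq> {}"
      then obtain x where "x \<in> half_set l \<pi>" "?d x \<in> half_set l \<pi>" by auto
      then show False using notboth[of x] unfolding half by auto
    qed
  qed
  show "\<pi> ` half_set l \<pi> \<subseteq> half_set l \<pi>"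
  proof (rule image_subsetI)
    fix x assume x: "x \<in> half_set l \<pi>"
    have "orbit \<pi> (\<pi> x) = orbit \<pi> x" by (rule permutation_orbit_step[OF perm])
    then show "\<pi> x \<in> half_set l \<pi>" using x pp unfolding half by (simp add: permutes_in_image)
  qed
qed

lemma half_cycles:
  assumes \<tau>: "\<tau> \<in> pairings (pm l)"
  defines "\<pi> \<equiv> circ_delta l \<circ> \<tau>"
  shows "cycle_sets (half_set l \<pi>) (half_perm l \<pi>) = orbit \<pi> ` half_set l \<pi>"
    and "num_half l \<pi> = ncomp2 (pm l) (circ_delta l) \<tau>"
    and "\<lbrakk>D \<in> carrier_mat d d; transpose_mat D = D; d \<ge> 1\<rbrakk> \<Longrightarrow>
      trace_perm (half_set l \<pi>) (half_perm l \<pi>) D = norm_trace (pm l) (circ_delta l) \<tau> D"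
proof -
  note h = half_set_transversal[OF \<tau>, folded \<pi>_def]
  show c: "cycle_sets (half_set l \<pi>) (half_perm l \<pi>) = orbit \<pi> ` half_set l \<pi>"
    unfolding cycle_sets_def
  proof (rule image_cong[OF refl])
    fix x assume x: "x \<in> half_set l \<pi>"
    show "orbit (half_perm l \<pi>) x = orbit \<pi> x"
      by (rule orbit_cong0[OF x]) (use h(2) in \<open>auto simp: half_perm_def perm_restrict_def\<close>)
  qed
  show "num_half l \<pi> = ncomp2 (pm l) (circ_delta l) \<tau>"
    unfolding num_half_def num_cycles_def c
    using card_cycles_transversal[OF finite_pm circ_delta_pairing \<tau> h[unfolded \<pi>_def]] unfolding \<pi>_def .
  show "trace_perm (half_set l \<pi>) (half_perm l \<pi>) D = norm_trace (pm l) (circ_delta l) \<tau> D"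
    if D: "D \<in> carrier_mat d d" "transpose_mat D = D" "d \<ge> 1"
    unfolding trace_perm_def c
    using norm_trace_transversal[OF finite_pm circ_delta_pairing \<tau> h[unfolded \<pi>_def] D] unfolding \<pi>_def .
qed

lemma full_cycle_apply:
  assumes "l \<ge> 1"
  shows "full_cycle l k = (if 1 \<le> k \<and> k < int l then k + 1 else if k = int l then 1 else k)"
proof -
  let ?cs = "[1..int l]"
  have cyc: "cycle ?cs" by simp
  have len: "length ?cs = l" by simp
  have rot: "map (full_cycle l) ?cs = rotate1 ?cs"
    using cyclic_rotation[OF cyc, of 1] by (simp add: full_cycle_def)
  have nth: "?cs ! i = int i + 1" if "i < l" for i using that by (simp add: nth_upto)
  have step: "full_cycle l (int i + 1) = (if Suc i < l then int i + 2 else 1)" if i: "i < l" for i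
  proof -
    have "full_cycle l (?cs ! i) = rotate1 ?cs ! i" using rot i len by (metis nth_map)
    also have "\<dots> = ?cs ! (Suc i mod l)" using nth_rotate1[of i ?cs] i len by simp
    finally show ?thesis using i nth[OF i] nth[of "Suc i mod l"] assms
      by (cases "Suc i < l") (auto simp: not_less le_Suc_eq)
  qed
  show ?thesis
  proof (cases "1 \<le> k \<and> k \<le> int l")
    case True
    then have "k = int (nat (k - 1)) + 1" "nat (k - 1) < l" by auto
    then show ?thesis using step[of "nat (k - 1)"] True by auto
  next
    case False
    then have "k \<notin> set ?cs" by auto
    then have "full_cycle l k = k" unfolding full_cycle_def by (rule id_outside_supp)
    then show ?thesis using False assms by auto
  qed
qed

text \<open>
  All three permutations in the definition of the Euler characteristic are premaps, so \<open>half_cycles\<close> turns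
  their halves into component counts. With \<open>\<gamma>\<^sub>+ \<gamma>\<^sub>-\<inverse> = \<epsilon>\<delta>\<close>, the first one belongs to the pairings
  \<open>\<delta>, \<delta>\<epsilon>\<delta>\<close>, conjugate to \<open>\<delta>, \<epsilon>\<close>, which is one circle. The third one belongs to \<open>\<delta>\<close> and
  \<open>\<gamma>\<^sub>+\<inverse>\<tau>\<gamma>\<^sub>+\<close>, which \<open>\<gamma>\<^sub>+\<close> conjugates to \<open>\<epsilon>\<close> and \<open>\<tau>\<close>.
\<close>

theorem euler_char_eq:
  assumes l: "l \<ge> 1" and \<tau>: "\<tau> \<in> pairings (pm l)"
  shows "euler_char l (full_cycle l) (circ_delta l \<circ> \<tau>)
    = 1 + int (ncomp2 (pm l) (circ_delta l) \<tau>)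
      + int (ncomp2 (pm l) (circ_eps l) \<tau>) - int l"
proof -
  let ?d = "circ_delta l" and ?e = "circ_eps l" and ?P = "pm l"
  let ?G = "perm_plus (full_cycle l)" and ?M = "perm_minus (full_cycle l)"
  note d = pairingsD[OF circ_delta_pairing[of l]] and e = pairingsD[OF circ_eps_pairing[of l]] and t = pairingsD[OF \<tau>]
  note fc = full_cycle_apply[OF l]
  have M: "?M = ?d \<circ> ?G \<circ> ?d"
  proof
    fix k show "?M k = (?d \<circ> ?G \<circ> ?d) k"
      by (auto simp: perm_minus_def perm_plus_def circ_delta_def fc pm_def)
  qed
  \<comment> \<open>Equivalent to \<open>\<gamma>\<^sub>+ \<gamma>\<^sub>-\<inverse> = \<epsilon>\<delta>\<close>, given that \<open>\<gamma>\<^sub>-\<close> is \<open>\<delta>\<gamma>\<^sub>+\<delta>\<close>.\<close>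
  have Ge: "?G = ?e \<circ> ?G \<circ> ?d"
  proof
    fix k show "?G k = (?e \<circ> ?G \<circ> ?d) k"
      using l by (auto simp: perm_plus_def circ_delta_def circ_eps_def fc pm_def)
  qed
  have Gp: "?G permutes ?P"
  proof (rule bij_imp_permutes)
    have "inj_on ?G ?P" by (auto simp: inj_on_def perm_plus_def fc pm_def split: if_splits)
    moreover have "?G ` ?P \<subseteq> ?P" using l by (auto simp: perm_plus_def fc pm_def)
    ultimately show "bij_betw ?G ?P ?P" using endo_inj_surj[OF finite_pm] by (simp add: bij_betw_def)
    show "?G k = k" if "k \<notin> ?P" for k using that l by (auto simp: perm_plus_def fc pm_def)
  qed
  let ?Gi = "inv_into UNIV ?G"
  have Gi: "?G (?Gi x) = x" "?Gi (?G x) = x" for x using permutes_inverses[OF Gp] by auto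
  have Mi: "inv_into UNIV ?M = ?d \<circ> ?Gi \<circ> ?d"
    by (rule inv_unique_comp) (auto simp: M fun_eq_iff Gi d(4))
  have ded: "?d \<circ> ?e \<circ> ?d \<in> pairings ?P"
    by (rule pairings_by_involution) (use d e in \<open>auto simp: d(4) e(4)\<close>, metis d(4) e(3) d(6))
  have c1: "?G \<circ> inv_into UNIV ?M = ?d \<circ> (?d \<circ> ?e \<circ> ?d)"
  proof
    fix k
    have "?G (?d (?Gi (?d k))) = ?e (?G (?d (?d (?Gi (?d k)))))" using Ge by (metis comp_apply)
    then show "(?G \<circ> inv_into UNIV ?M) k = (?d \<circ> (?d \<circ> ?e \<circ> ?d)) k" by (simp add: Mi Gi d(4))
  qed
  have "num_half l (?G \<circ> inv_into UNIV ?M) = ncomp2 ?P ?d (?d \<circ> ?e \<circ> ?d)"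
    unfolding c1 by (rule half_cycles(2)[OF ded])
  also have "\<dots> = ncomp2 ?P ?d ?e"
    by (rule ncomp_conjugate[OF finite_pm d(1) d(1) e(1) d(1) pairingsD(1)[OF ded]]) (simp_all add: d(4))
  finally have n1: "num_half l (?G \<circ> inv_into UNIV ?M) = 1" using circle_ncomp[OF l] by simp
  have gtg: "?Gi \<circ> \<tau> \<circ> ?G \<in> pairings ?P"
  proof (rule pairings_by_involution)
    note Gip = permutes_inv[OF Gp]
    fix x
    show "(?Gi \<circ> \<tau> \<circ> ?G) x \<in> ?P" if "x \<in> ?P" using that t(6) permutes_in_image[OF Gp] permutes_in_image[OF Gip] by simp
    show "(?Gi \<circ> \<tau> \<circ> ?G) x \<noteq> x" if "x \<in> ?P"
    proof
      assume "(?Gi \<circ> \<tau> \<circ> ?G) x = x"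
      then have "\<tau> (?G x) = ?G x" using Gi(1)[of "\<tau> (?G x)"] by simp
      then show False using t(3)[of "?G x"] that permutes_in_image[OF Gp] by simp
    qed
    show "(?Gi \<circ> \<tau> \<circ> ?G) ((?Gi \<circ> \<tau> \<circ> ?G) x) = x" by (simp add: Gi t(4))
    show "(?Gi \<circ> \<tau> \<circ> ?G) x = x" if "x \<notin> ?P" using that t(5) permutes_in_image[OF Gp] by (simp add: Gi)
  qed
  have c3: "inv_into UNIV ?M \<circ> (?d \<circ> \<tau>) \<circ> ?G = ?d \<circ> (?Gi \<circ> \<tau> \<circ> ?G)"
    by (auto simp: Mi fun_eq_iff d(4))
  have "num_half l (inv_into UNIV ?M \<circ> (?d \<circ> \<tau>) \<circ> ?G) = ncomp2 ?P ?d (?Gi \<circ> \<tau> \<circ> ?G)"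
    unfolding c3 by (rule half_cycles(2)[OF gtg])
  also have "\<dots> = ncomp2 ?P ?e \<tau>"
  proof (rule ncomp_conjugate[OF finite_pm Gp d(1) pairingsD(1)[OF gtg] e(1) t(1), symmetric])
    show "?G (?d x) = ?e (?G x)" for x using Ge e(4) by (metis comp_apply)
    show "?G ((?Gi \<circ> \<tau> \<circ> ?G) x) = \<tau> (?G x)" for x by (simp add: Gi)
  qed
  finally show ?thesis unfolding euler_char_def n1 half_cycles(2)[OF \<tau>] by (simp add: comp_assoc)
qed

section \<open>Mean and cumulants: leading terms and bounds\<close>

lemma orbit_subset_closed:
  assumes "\<sigma> ` H \<subseteq> H" "x \<in> H"
  shows "orbit \<sigma> x \<subseteq> H"
proof
  fix y assume "y \<in> orbit \<sigma> x"
  then show "y \<in> H" by induction (use assms in auto)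
qed

lemma norm_trace_bounds:
  assumes fin: "finite P" and \<delta>: "\<delta> \<in> pairings P" and \<tau>: "\<tau> \<in> pairings P"
    and C: "C \<ge> 1" and m: "\<And>k. k \<ge> 1 \<Longrightarrow> 0 \<le> moment k D \<and> moment k D \<le> C ^ k"
  shows "0 \<le> norm_trace P \<delta> \<tau> D" "norm_trace P \<delta> \<tau> D \<le> C ^ card P"
proof -
  let ?H = "cycle_half P \<delta> \<tau>" and ?p = "\<delta> \<circ> \<tau>"
  let ?O = "orbit ?p ` ?H"
  note h = cycle_half[OF fin \<delta> \<tau>]
  have "?p permutes P" using pairingsD(1)[OF \<delta>] pairingsD(1)[OF \<tau>] by (intro permutes_compose)
  then have perm: "permutation ?p" using fin permutation_permutes by blast
  have HP: "?H \<subseteq> P" by (rule transversalD(1)[OF h(1) \<delta>])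
  have oc: "c \<subseteq> ?H" "c \<noteq> {}" if "c \<in> ?O" for c
    using that orbit_subset_closed[OF h(2)] orbit_nonempty[of ?p] by auto
  have finc: "finite c" if "c \<in> ?O" for c
    by (rule finite_subset[OF subset_trans[OF oc(1)[OF that] HP] fin])
  have c1: "card c \<ge> 1" if "c \<in> ?O" for c using oc(2)[OF that] finc[OF that] by (simp add: Suc_leI card_gt_0_iff)
  show "0 \<le> norm_trace P \<delta> \<tau> D" unfolding norm_trace_def
    by (intro prod_nonneg) (use m c1 in blast)
  have "norm_trace P \<delta> \<tau> D \<le> (\<Prod>c\<in>?O. C ^ card c)" unfolding norm_trace_def
    by (intro prod_mono) (use m c1 in blast)
  also have "\<dots> = C ^ (\<Sum>c\<in>?O. card c)" by (simp add: power_sum)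
  also have "(\<Sum>c\<in>?O. card c) = card (\<Union>?O)"
  proof (rule card_Union_disjoint[symmetric])
    show "pairwise disjnt ?O" unfolding pairwise_def disjnt_def using orbits_disjoint[OF perm] by blast
  qed (rule finc)
  also have "C ^ card (\<Union>?O) \<le> C ^ card P"
  proof (rule power_increasing[OF _ C])
    have "\<Union>?O \<subseteq> P" using oc(1) HP by blast
    then show "card (\<Union>?O) \<le> card P" by (rule card_mono[OF fin])
  qed
  finally show "norm_trace P \<delta> \<tau> D \<le> C ^ card P" .
qed

text \<open>
  On a single circle Euler's inequality is a case of submodularity, with \<open>\<tau>\<close> in common: a connected
  bipartite graph has at most one vertex more than it has edges.
\<close>

lemma circle_pairing_bound:
  assumes l: "l \<ge> 1" and \<tau>: "\<tau> \<in> pairings (pm l)"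
  shows "ncomp2 (pm l) (circ_delta l) \<tau>
       + ncomp2 (pm l) (circ_eps l) \<tau> \<le> l + 1"
proof -
  let ?d = "graph_on (pm l) (circ_delta l)" and ?e = "graph_on (pm l) (circ_eps l)" and ?t = "graph_on (pm l) \<tau>"
  have sub: "?d \<subseteq> pm l \<times> pm l" "?e \<subseteq> pm l \<times> pm l" "?t \<subseteq> pm l \<times> pm l"
    using pairingsD(1)[OF circ_delta_pairing] pairingsD(1)[OF circ_eps_pairing] pairingsD(1)[OF \<tau>]
    by (auto dest: graph_on_subset)
  have "ncomp (pm l) (?t \<union> ?d) + ncomp (pm l) (?t \<union> ?e) \<le> ncomp (pm l) ?t + ncomp (pm l) (?t \<union> ?d \<union> ?e)"
    by (rule ncomp_submodular[OF finite_pm _ sub(1,3,2)]) (use finite_pm in \<open>auto simp: graph_on_def\<close>)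
  moreover have "2 * ncomp (pm l) ?t = 2 * l" using ncomp_pairing[OF finite_pm \<tau>] card_pm[of l] by simp
  moreover have "ncomp (pm l) (?t \<union> ?d \<union> ?e) \<le> ncomp (pm l) (?d \<union> ?e)"
    using edges_subset_eqcl[of "?t \<union> ?d \<union> ?e" "pm l"] sub by (intro ncomp_antimono[OF finite_pm]) auto
  ultimately show ?thesis using circle_ncomp[OF l] by (simp add: Un_commute)
qed

context wishart_param
begin

abbreviation lam :: real where "lam \<equiv> real d / real n"

definition row_comps :: "nat set \<Rightarrow> (nat \<times> int \<Rightarrow> nat \<times> int) \<Rightarrow> nat" where
  "row_comps S \<tau> = ncomp2 (pts l S) (fam_delta l S) \<tau>"

definition col_comps :: "nat set \<Rightarrow> (nat \<times> int \<Rightarrow> nat \<times> int) \<Rightarrow> nat" where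
  "col_comps S \<tau> = ncomp2 (pts l S) (fam_eps l S) \<tau>"

lemma fam_weight_eq:
  "fam_weight S \<tau> = real n ^ (row_comps S \<tau> + col_comps S \<tau>) / real n ^ (card S * l)
     * (lam ^ row_comps S \<tau> * norm_trace (pts l S) (fam_delta l S) \<tau> D)"
proof -
  have "card (pts l S) div 2 = card S * l" by (simp add: card_pts)
  moreover have "dim_row D = d" using D by auto
  ultimately show ?thesis using n1
    unfolding fam_weight_def pairing_weight_def row_comps_def col_comps_def
    by (simp add: power_add power_divide field_simps)
qed

definition row_comps1 :: "(int \<Rightarrow> int) \<Rightarrow> nat" where
  "row_comps1 \<tau> = ncomp2 (pm l) (circ_delta l) \<tau>"

definition col_comps1 :: "(int \<Rightarrow> int) \<Rightarrow> nat" where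
  "col_comps1 \<tau> = ncomp2 (pm l) (circ_eps l) \<tau>"

definition wt1 :: "(int \<Rightarrow> int) \<Rightarrow> real" where
  "wt1 \<tau> = lam ^ row_comps1 \<tau> * norm_trace (pm l) (circ_delta l) \<tau> D"

lemma mom_1: "mom 1 = (\<Sum>\<tau>\<in>pairings (pm l). real n ^ (row_comps1 \<tau> + col_comps1 \<tau>) / real n ^ l * wt1 \<tau>)"
proof -
  have "mom 1 = (\<Sum>\<tau>\<in>pairings (pm l). pairing_weight n D (pm l) (circ_delta l) (circ_eps l) \<tau>)"
    using has_bochner_integral_integral_eq[OF genus_expansion[OF n1 finite_pm circ_delta_pairing circ_eps_pairing circ_transversal D sym d1]]
    unfolding mom_def wishart_trace_eq_trace_sum[OF l1 D, abs_def] by simp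
  also have "\<dots> = (\<Sum>\<tau>\<in>pairings (pm l). real n ^ (row_comps1 \<tau> + col_comps1 \<tau>) / real n ^ l * wt1 \<tau>)"
  proof (rule sum.cong[OF refl])
    fix \<tau>
    have "card (pm l) div 2 = l" by (simp add: card_pm)
    moreover have "dim_row D = d" using D by auto
    ultimately show "pairing_weight n D (pm l) (circ_delta l) (circ_eps l) \<tau> = real n ^ (row_comps1 \<tau> + col_comps1 \<tau>) / real n ^ l * wt1 \<tau>"
      using n1 unfolding pairing_weight_def row_comps1_def col_comps1_def wt1_def
      by (simp add: power_add power_divide field_simps)
  qed
  finally show ?thesis .
qed

lemma premap_sum_eq:
  "premap_sum x l n D = (\<Sum>\<tau>\<in>pairings (pm l). if 1 + int (row_comps1 \<tau>) + int (col_comps1 \<tau>) - int l = x then wt1 \<tau> else 0)"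
proof -
  let ?f = "\<lambda>\<pi>. if euler_char l (full_cycle l) \<pi> = x
     then lam ^ num_half l \<pi> * trace_perm (half_set l \<pi>) (half_perm l \<pi>) D else 0"
  have dr: "dim_row D = d" using D by auto
  have bij: "bij_betw (\<lambda>\<tau>. circ_delta l \<circ> \<tau>) (pairings (pm l)) (premaps l)" by (rule bij_betw_pairings_premaps)
  then have fin: "finite (premaps l)" using finite_pairings[OF finite_pm] bij_betw_finite by blast
  have "premap_sum x l n D = (\<Sum>\<pi>\<in>premaps l. ?f \<pi>)"
    unfolding premap_sum_def dr using fin by (simp add: sum.inter_filter[symmetric])
  also have "\<dots> = (\<Sum>\<tau>\<in>pairings (pm l). ?f (circ_delta l \<circ> \<tau>))"
    by (rule sum.reindex_bij_betw[OF bij, symmetric])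
  also have "\<dots> = (\<Sum>\<tau>\<in>pairings (pm l). if 1 + int (row_comps1 \<tau>) + int (col_comps1 \<tau>) - int l = x then wt1 \<tau> else 0)"
  proof (rule sum.cong[OF refl])
    fix \<tau> assume t: "\<tau> \<in> pairings (pm l)"
    show "?f (circ_delta l \<circ> \<tau>) = (if 1 + int (row_comps1 \<tau>) + int (col_comps1 \<tau>) - int l = x then wt1 \<tau> else 0)"
      unfolding euler_char_eq[OF l1 t] half_cycles(2)[OF t] half_cycles(3)[OF t D sym d1] row_comps1_def col_comps1_def wt1_def ..
  qed
  finally show ?thesis .
qed

text \<open>
  The exponents of \<open>n\<close> in the mean are at most \<open>1\<close>; the FDE mean consists of the terms with exponents
  \<open>1\<close> and \<open>0\<close>.
\<close>

lemma mean_difference: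
  "mom 1 - fde_mean l n D = (\<Sum>\<tau>\<in>pairings (pm l). if row_comps1 \<tau> + col_comps1 \<tau> < l then real n ^ (row_comps1 \<tau> + col_comps1 \<tau>) / real n ^ l * wt1 \<tau> else 0)"
proof -
  have "mom 1 - fde_mean l n D = (\<Sum>\<tau>\<in>pairings (pm l). real n ^ (row_comps1 \<tau> + col_comps1 \<tau>) / real n ^ l * wt1 \<tau>
      - (real n * (if 1 + int (row_comps1 \<tau>) + int (col_comps1 \<tau>) - int l = 2 then wt1 \<tau> else 0)
         + (if 1 + int (row_comps1 \<tau>) + int (col_comps1 \<tau>) - int l = 1 then wt1 \<tau> else 0)))"
    unfolding fde_mean_def premap_sum_eq mom_1 by (simp only: sum_distrib_left sum.distrib sum_subtractf)
  also have "\<dots> = (\<Sum>\<tau>\<in>pairings (pm l). if row_comps1 \<tau> + col_comps1 \<tau> < l then real n ^ (row_comps1 \<tau> + col_comps1 \<tau>) / real n ^ l * wt1 \<tau> else 0)"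
  proof (rule sum.cong[OF refl])
    fix \<tau> assume t: "\<tau> \<in> pairings (pm l)"
    let ?c = "row_comps1 \<tau> + col_comps1 \<tau>"
    have "?c \<le> l + 1" using circle_pairing_bound[OF l1 t] by (simp add: row_comps1_def col_comps1_def)
    then consider "?c = l + 1" | "?c = l" | "?c < l" by linarith
    then show "real n ^ ?c / real n ^ l * wt1 \<tau> - (real n * (if 1 + int (row_comps1 \<tau>) + int (col_comps1 \<tau>) - int l = 2 then wt1 \<tau> else 0)
         + (if 1 + int (row_comps1 \<tau>) + int (col_comps1 \<tau>) - int l = 1 then wt1 \<tau> else 0))
      = (if ?c < l then real n ^ ?c / real n ^ l * wt1 \<tau> else 0)"
    proof cases
      case 1
      then have "1 + int (row_comps1 \<tau>) + int (col_comps1 \<tau>) - int l = 2" by linarith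
      then show ?thesis using 1 n1 by simp
    next
      case 2
      then have "1 + int (row_comps1 \<tau>) + int (col_comps1 \<tau>) - int l = 1" by linarith
      then show ?thesis using 2 n1 by simp
    next
      case 3
      then have "1 + int (row_comps1 \<tau>) + int (col_comps1 \<tau>) - int l < 1" by linarith
      then show ?thesis using 3 by simp
    qed
  qed
  finally show ?thesis .
qed

lemma cum_1: "cum 1 = mom 1" and cum_2: "cum 2 = mom 2 - (mom 1)\<^sup>2"
proof -
  show 1: "cum 1 = mom 1" using moment_cumulant[of 0] mom_0 by simp
  have "{..1::nat} = {0, 1}" by auto
  then show "cum 2 = mom 2 - (mom 1)\<^sup>2"
    using moment_cumulant[of 1] mom_0 1 by (simp add: power2_eq_square numeral_2_eq_2)
qed

lemma prob: "prob_space (gaussian_space d n)" by (rule prob_space_gaussian[OF n1])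

lemma variance_eq_cum: "wishart_trace_variance l n D = cum 2"
proof -
  have dr: "dim_row D = d" using D by auto
  show ?thesis unfolding wishart_trace_variance_def dr cum_2
    using prob_space.variance_eq[OF prob, of "wishart_trace l n D"] integrable_wishart_power[of 1] integrable_wishart_power[of 2]
    by (simp add: mom_def)
qed

text \<open>
  Let \<open>Y\<close> be \<open>n\<close> times the squared norm of \<open>Z\<close>. Its mean is \<open>m = dn\<close> and its variance \<open>2m\<close>, and its covariance
  with \<open>X\<close> is \<open>2l\<close> times the mean \<open>a\<close> of \<open>X\<close>. The bound is the Cauchy-Schwarz inequality for
  this covariance, in the form that the regression residual of \<open>X\<close> on \<open>Y\<close> has a nonnegative second
  moment.
\<close>

lemma cum_2_ge: "2 * real l ^ 2 * (mom 1)\<^sup>2 / (real d * real n) \<le> cum 2"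
proof -
  interpret prob_space "gaussian_space d n" by (rule prob)
  let ?M = "gaussian_space d n"
  define X where "X = wishart_trace l n D"
  define Y where "Y \<omega> = (\<Sum>q\<in>{..<d} \<times> {..<n}. n * (\<omega> q)\<^sup>2)" for \<omega> :: "nat \<times> nat \<Rightarrow> real"
  define a where "a = mom 1"
  have hX: "has_bochner_integral ?M X a"
    unfolding X_def a_def has_bochner_integral_iff using integrable_wishart_power[of 1] by (simp add: mom_def)
  have hX2: "has_bochner_integral ?M (\<lambda>\<omega>. (X \<omega>)\<^sup>2) (mom 2)"
    unfolding X_def has_bochner_integral_iff using integrable_wishart_power[of 2] by (simp add: mom_def)
  have hYX: "has_bochner_integral ?M (\<lambda>\<omega>. Y \<omega> * X \<omega>) ((d * n + 2 * l) * a)"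
    using trace_sum_times_norm[OF n1 finite_pm[of l], where D = D and d = d and \<delta> = "circ_delta l"
        and \<epsilon> = "circ_eps l" and T = "{1..int l}"] D
    unfolding X_def Y_def a_def mom_def wishart_trace_eq_trace_sum[OF l1 D, abs_def] by (simp add: card_pm)
  have hY: "has_bochner_integral ?M Y (d * n)"
    using gaussian_product_times_norm[OF n1, of "{} :: nat set" "\<lambda>_. (0, 0)" d] prob_space
    by (simp add: Y_def[abs_def])
  have hYq: "has_bochner_integral ?M (\<lambda>\<omega>. Y \<omega> * (n * (\<omega> q)\<^sup>2)) ((d * n + 2) * (\<integral>\<omega>. n * (\<omega> q)\<^sup>2 \<partial>?M))"
    "integrable ?M (\<lambda>\<omega>. n * (\<omega> q)\<^sup>2)" if q: "q \<in> {..<d} \<times> {..<n}" for q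
  proof -
    have p: "(\<Prod>x\<in>{0::nat, 1}. \<omega> q) = (\<omega> q)\<^sup>2" for \<omega> :: "nat \<times> nat \<Rightarrow> real" by (simp add: power2_eq_square)
    have "has_bochner_integral ?M (\<lambda>\<omega>. Y \<omega> * (\<omega> q)\<^sup>2) ((d * n + 2) * (\<integral>\<omega>. (\<omega> q)\<^sup>2 \<partial>?M))"
      using gaussian_product_times_norm[OF n1, of "{0::nat, 1}" "\<lambda>_. q" d] q unfolding Y_def p by simp
    from has_bochner_integral_mult_right[OF this, of "real n"]
    show "has_bochner_integral ?M (\<lambda>\<omega>. Y \<omega> * (n * (\<omega> q)\<^sup>2)) ((d * n + 2) * (\<integral>\<omega>. n * (\<omega> q)\<^sup>2 \<partial>?M))"
      by (simp add: mult_ac)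
    have "integrable ?M (\<lambda>\<omega>. (\<omega> q)\<^sup>2)"
      using gaussian_product[OF n1, of "{0::nat, 1}" "\<lambda>_. q" d] q unfolding p by (auto simp: has_bochner_integral_iff)
    then show "integrable ?M (\<lambda>\<omega>. n * (\<omega> q)\<^sup>2)" by simp
  qed
  have S: "(\<Sum>q\<in>{..<d} \<times> {..<n}. \<integral>\<omega>. n * (\<omega> q)\<^sup>2 \<partial>?M) = d * n"
    using has_bochner_integral_integral_eq[OF hY] Bochner_Integration.integral_sum[OF hYq(2), of "{..<d} \<times> {..<n}"]
    unfolding Y_def by simp
  have "has_bochner_integral ?M (\<lambda>\<omega>. \<Sum>q\<in>{..<d} \<times> {..<n}. Y \<omega> * (n * (\<omega> q)\<^sup>2))
      (\<Sum>q\<in>{..<d} \<times> {..<n}. (d * n + 2) * (\<integral>\<omega>. n * (\<omega> q)\<^sup>2 \<partial>?M))"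
    by (intro has_bochner_integral_sum hYq)
  moreover have "(\<Sum>q\<in>{..<d} \<times> {..<n}. Y \<omega> * (n * (\<omega> q)\<^sup>2)) = (Y \<omega>)\<^sup>2" for \<omega> :: "nat \<times> nat \<Rightarrow> real"
    by (simp add: Y_def sum_distrib_left[symmetric] power2_eq_square)
  moreover have "(\<Sum>q\<in>{..<d} \<times> {..<n}. (d * n + 2) * (\<integral>\<omega>. n * (\<omega> q)\<^sup>2 \<partial>?M)) = (d * n + 2) * real (d * n)"
    unfolding sum_distrib_left[symmetric] S ..
  ultimately have hY2: "has_bochner_integral ?M (\<lambda>\<omega>. (Y \<omega>)\<^sup>2) ((d * n + 2) * real (d * n))"
    by simp
  define m where "m = real d * real n"
  have m0: "m > 0" using d1 n1 by (simp add: m_def)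
  have hYX': "has_bochner_integral ?M (\<lambda>\<omega>. Y \<omega> * X \<omega>) ((m + 2 * l) * a)"
    and hY': "has_bochner_integral ?M Y m"
    and hY2': "has_bochner_integral ?M (\<lambda>\<omega>. (Y \<omega>)\<^sup>2) ((m + 2) * m)"
    using hYX hY hY2 by (simp_all add: m_def add.commute)
  have hc: "has_bochner_integral ?M (\<lambda>_. c) c" for c :: real
    using prob_space by (simp add: has_bochner_integral_iff)
  \<comment> \<open>The regression coefficient of \<open>X\<close> on \<open>Y\<close>: the covariance \<open>2 l a\<close> over the variance \<open>2 m\<close>.\<close>
  define t where "t = l * a / m"
  have "has_bochner_integral ?M (\<lambda>\<omega>. (X \<omega>)\<^sup>2 + t\<^sup>2 * (Y \<omega>)\<^sup>2 + (a - t * m)\<^sup>2 - 2 * t * (Y \<omega> * X \<omega>)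
       - 2 * (a - t * m) * X \<omega> + 2 * t * (a - t * m) * Y \<omega>)
     (mom 2 + t\<^sup>2 * ((m + 2) * m) + (a - t * m)\<^sup>2 - 2 * t * ((m + 2 * l) * a)
       - 2 * (a - t * m) * a + 2 * t * (a - t * m) * m)"
    by (intro has_bochner_integral_add has_bochner_integral_diff has_bochner_integral_mult_right hX hX2 hYX' hY' hY2' hc)
  then have "(\<integral>\<omega>. (X \<omega>)\<^sup>2 + t\<^sup>2 * (Y \<omega>)\<^sup>2 + (a - t * m)\<^sup>2 - 2 * t * (Y \<omega> * X \<omega>)
       - 2 * (a - t * m) * X \<omega> + 2 * t * (a - t * m) * Y \<omega> \<partial>?M)
     = mom 2 + t\<^sup>2 * ((m + 2) * m) + (a - t * m)\<^sup>2 - 2 * t * ((m + 2 * l) * a)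
       - 2 * (a - t * m) * a + 2 * t * (a - t * m) * m"
    by (rule has_bochner_integral_integral_eq)
  moreover have "0 \<le> (\<integral>\<omega>. (X \<omega>)\<^sup>2 + t\<^sup>2 * (Y \<omega>)\<^sup>2 + (a - t * m)\<^sup>2 - 2 * t * (Y \<omega> * X \<omega>)
       - 2 * (a - t * m) * X \<omega> + 2 * t * (a - t * m) * Y \<omega> \<partial>?M)"
  proof (rule Bochner_Integration.integral_nonneg)
    fix \<omega>
    have "(X \<omega>)\<^sup>2 + t\<^sup>2 * (Y \<omega>)\<^sup>2 + (a - t * m)\<^sup>2 - 2 * t * (Y \<omega> * X \<omega>)
       - 2 * (a - t * m) * X \<omega> + 2 * t * (a - t * m) * Y \<omega> = (X \<omega> - t * Y \<omega> - (a - t * m))\<^sup>2"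
      by (simp add: power2_eq_square algebra_simps)
    then show "0 \<le> (X \<omega>)\<^sup>2 + t\<^sup>2 * (Y \<omega>)\<^sup>2 + (a - t * m)\<^sup>2 - 2 * t * (Y \<omega> * X \<omega>)
       - 2 * (a - t * m) * X \<omega> + 2 * t * (a - t * m) * Y \<omega>" by simp
  qed
  ultimately have "0 \<le> mom 2 + t\<^sup>2 * ((m + 2) * m) + (a - t * m)\<^sup>2 - 2 * t * ((m + 2 * l) * a)
       - 2 * (a - t * m) * a + 2 * t * (a - t * m) * m" by simp
  also have "\<dots> = mom 2 - a\<^sup>2 + 2 * t\<^sup>2 * m - 4 * t * l * a"
    by (simp add: power2_eq_square algebra_simps)
  also have "\<dots> = mom 2 - a\<^sup>2 - 2 * l ^ 2 * a\<^sup>2 / m"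
    using m0 by (simp add: t_def power2_eq_square field_simps)
  finally show ?thesis by (simp add: cum_2 a_def m_def)
qed

text \<open>
  The part of order \<open>n\<^sup>0\<close> of the second cumulant.
\<close>

definition var_limit :: real where
  "var_limit = (\<Sum>\<tau> | \<tau> \<in> pairings (pts l {..<2}) \<and> connected_family l {..<2} \<tau>.
     if row_comps {..<2} \<tau> + col_comps {..<2} \<tau> = 2 * l
     then lam ^ row_comps {..<2} \<tau> * norm_trace (pts l {..<2}) (fam_delta l {..<2}) \<tau> D else 0)"

lemma connected_bounds:
  assumes "\<tau> \<in> pairings (pts l {..<j})" "connected_family l {..<j} \<tau>" "j \<ge> 1"
  shows "row_comps {..<j} \<tau> + col_comps {..<j} \<tau> + j \<le> j * l + 2" "row_comps {..<j} \<tau> + j \<le> j * l + 1"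
  using connected_family_bounds[OF l1 _ _ assms(1,2)] assms(3) unfolding row_comps_def col_comps_def
  by (auto simp: lessThan_empty_iff)

lemma cum_eq: "cum j = (\<Sum>\<tau> | \<tau> \<in> pairings (pts l {..<j}) \<and> connected_family l {..<j} \<tau>.
    real n ^ (row_comps {..<j} \<tau> + col_comps {..<j} \<tau>) / real n ^ (j * l)
     * (lam ^ row_comps {..<j} \<tau> * norm_trace (pts l {..<j}) (fam_delta l {..<j}) \<tau> D))"
  unfolding cum_def conn_sum_def fam_weight_eq by simp

end

section \<open>Amplification\<close>

lemma kronecker_one_index:
  assumes "A \<in> carrier_mat d d" "r < d * a" "c < d * a"
  shows "kronecker A (1\<^sub>m a) $$ (r, c) = (if r mod a = c mod a then A $$ (r div a, c div a) else 0)"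
proof -
  have "a > 0" using assms by (cases a) auto
  then show ?thesis using assms by (simp add: kronecker_def less_mult_imp_div_less)
qed

lemma kronecker_one_carrier: "A \<in> carrier_mat d d \<Longrightarrow> kronecker A (1\<^sub>m a) \<in> carrier_mat (d * a) (d * a)"
  by (auto simp: kronecker_def)

lemma sum_div_mod: "(\<Sum>q<d * a. f (q div a) (q mod a)) = (\<Sum>i<d. \<Sum>j<a. f i (j::nat))"
proof -
  have "(\<Sum>i<d. \<Sum>j<a. f i j) = (\<Sum>(i, j)\<in>{..<d} \<times> {..<a}. f i j)" by (simp add: sum.cartesian_product)
  also have "\<dots> = (\<Sum>q<d * a. f (q div a) (q mod a))"
  proof (rule sum.reindex_bij_witness[where i = "\<lambda>q. (q div a, q mod a)" and j = "\<lambda>(i, j). i * a + j"])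
    fix p assume p: "p \<in> {..<d} \<times> {..<a}"
    obtain i j where ij: "p = (i, j)" "i < d" "j < a" using p by auto
    have "i * a + j < Suc i * a" using ij by simp
    also have "\<dots> \<le> d * a" using ij by (intro mult_le_mono1) simp
    finally show "(case p of (i, j) \<Rightarrow> i * a + j) \<in> {..<d * a}" using ij by simp
    show "((case p of (i, j) \<Rightarrow> i * a + j) div a, (case p of (i, j) \<Rightarrow> i * a + j) mod a) = p"
      "f ((case p of (i, j) \<Rightarrow> i * a + j) div a) ((case p of (i, j) \<Rightarrow> i * a + j) mod a) = (case p of (i, j) \<Rightarrow> f i j)"
      using ij by auto
  next
    fix q assume q: "q \<in> {..<d * a}"
    then have "a > 0" by (cases a) auto
    then show "(q div a, q mod a) \<in> {..<d} \<times> {..<a}" using q by (auto simp: less_mult_imp_div_less)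
  qed auto
  finally show ?thesis by simp
qed

lemma kronecker_one_power:
  assumes A: "A \<in> carrier_mat d d"
  shows "kronecker A (1\<^sub>m a) ^\<^sub>m k = kronecker (A ^\<^sub>m k) (1\<^sub>m a)"
proof (induction k)
  case 0
  have "kronecker (1\<^sub>m d) (1\<^sub>m a) = 1\<^sub>m (d * a)"
  proof (rule eq_matI)
    fix r c assume "r < dim_row (1\<^sub>m (d * a))" "c < dim_col (1\<^sub>m (d * a))"
    then have rc: "r < d * a" "c < d * a" by auto
    have "r = c \<longleftrightarrow> r mod a = c mod a \<and> r div a = c div a" by (metis div_mult_mod_eq)
    then show "kronecker (1\<^sub>m d) (1\<^sub>m a) $$ (r, c) = 1\<^sub>m (d * a) $$ (r, c)"
      using rc by (subst kronecker_one_index[of _ d]) (auto simp: less_mult_imp_div_less)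
  qed (auto simp: kronecker_def)
  then show ?case using A by (simp add: kronecker_def)
next
  case (Suc k)
  let ?K = "\<lambda>B. kronecker B (1\<^sub>m a)"
  have Ak: "A ^\<^sub>m k \<in> carrier_mat d d" using A by (rule pow_carrier_mat)
  note K = kronecker_one_carrier[OF A, of a] kronecker_one_carrier[OF Ak, of a]
  have "?K (A ^\<^sub>m k) * ?K A = ?K (A ^\<^sub>m k * A)"
  proof (rule eq_matI)
    fix r c assume "r < dim_row (?K (A ^\<^sub>m k * A))" "c < dim_col (?K (A ^\<^sub>m k * A))"
    then have rc: "r < d * a" "c < d * a" using A Ak by (auto simp: kronecker_def)
    then have a0: "a > 0" by (cases a) auto
    have rd: "r div a < d" "c div a < d" "r mod a < a" "c mod a < a" using rc a0 by (auto simp: less_mult_imp_div_less)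
    have "(?K (A ^\<^sub>m k) * ?K A) $$ (r, c) = (\<Sum>q<d * a. ?K (A ^\<^sub>m k) $$ (r, q) * ?K A $$ (q, c))"
      using K rc by (simp add: scalar_prod_def atLeast0LessThan)
    also have "\<dots> = (\<Sum>q<d * a. (if r mod a = q mod a then (A ^\<^sub>m k) $$ (r div a, q div a) else 0)
        * (if q mod a = c mod a then A $$ (q div a, c div a) else 0))"
      using rc by (intro sum.cong refl) (simp add: kronecker_one_index[OF A] kronecker_one_index[OF Ak])
    also have "\<dots> = (\<Sum>i<d. \<Sum>j<a. (if r mod a = j then (A ^\<^sub>m k) $$ (r div a, i) else 0)
        * (if j = c mod a then A $$ (i, c div a) else 0))"
      by (rule sum_div_mod)
    also have "\<dots> = (\<Sum>i<d. if r mod a = c mod a then (A ^\<^sub>m k) $$ (r div a, i) * A $$ (i, c div a) else 0)"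
    proof (rule sum.cong[OF refl])
      fix i
      have "(\<Sum>j<a. (if r mod a = j then (A ^\<^sub>m k) $$ (r div a, i) else 0) * (if j = c mod a then A $$ (i, c div a) else 0))
          = (\<Sum>j<a. if j = c mod a then (if r mod a = j then (A ^\<^sub>m k) $$ (r div a, i) else 0) * A $$ (i, c div a) else 0)"
        by (intro sum.cong refl) auto
      also have "\<dots> = (if r mod a = c mod a then (A ^\<^sub>m k) $$ (r div a, i) * A $$ (i, c div a) else 0)"
        using rd by simp
      finally show "(\<Sum>j<a. (if r mod a = j then (A ^\<^sub>m k) $$ (r div a, i) else 0) * (if j = c mod a then A $$ (i, c div a) else 0))
          = (if r mod a = c mod a then (A ^\<^sub>m k) $$ (r div a, i) * A $$ (i, c div a) else 0)" .
    qed
    also have "\<dots> = ?K (A ^\<^sub>m k * A) $$ (r, c)"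
      using rd A Ak rc by (subst kronecker_one_index[of _ d]) (auto simp: scalar_prod_def atLeast0LessThan)
    finally show "(?K (A ^\<^sub>m k) * ?K A) $$ (r, c) = ?K (A ^\<^sub>m k * A) $$ (r, c)" .
  qed (use A Ak in \<open>auto simp: kronecker_def\<close>)
  then show ?case using Suc by simp
qed

lemma moment_kronecker_one:
  assumes A: "A \<in> carrier_mat d d" and a: "a \<ge> 1"
  shows "moment k (kronecker A (1\<^sub>m a)) = moment k A"
proof -
  let ?B = "A ^\<^sub>m k"
  have B: "?B \<in> carrier_mat d d" using A by (rule pow_carrier_mat)
  have "mat_trace (kronecker ?B (1\<^sub>m a)) = (\<Sum>q<d * a. ?B $$ (q div a, q div a))"
    using kronecker_one_carrier[OF B, of a] unfolding mat_trace_def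
    by (auto intro!: sum.cong simp: kronecker_one_index[OF B])
  also have "\<dots> = (\<Sum>i<d. \<Sum>j<a. ?B $$ (i, i))" by (rule sum_div_mod)
  also have "\<dots> = real a * mat_trace ?B" using B by (auto simp: mat_trace_def sum_distrib_left)
  finally have "mat_trace (kronecker A (1\<^sub>m a) ^\<^sub>m k) = real a * mat_trace ?B"
    unfolding kronecker_one_power[OF A] .
  moreover have "dim_row (kronecker A (1\<^sub>m a)) = d * a" using kronecker_one_carrier[OF A, of a] by auto
  ultimately show ?thesis using a A unfolding moment_def by auto
qed

lemma transpose_kronecker_one:
  assumes A: "A \<in> carrier_mat d d" "transpose_mat A = A"
  shows "transpose_mat (kronecker A (1\<^sub>m a)) = kronecker A (1\<^sub>m a)"
proof (rule eq_matI)
  fix r c assume "r < dim_row (kronecker A (1\<^sub>m a))" "c < dim_col (kronecker A (1\<^sub>m a))"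
  then have rc: "r < d * a" "c < d * a" using A by (auto simp: kronecker_def)
  then have "A $$ (c div a, r div a) = A $$ (r div a, c div a)"
    by (intro symmetric_entry[OF A]) (auto simp: less_mult_imp_div_less)
  then show "transpose_mat (kronecker A (1\<^sub>m a)) $$ (r, c) = kronecker A (1\<^sub>m a) $$ (r, c)"
    using rc kronecker_one_carrier[OF A(1), of a] by (simp add: kronecker_one_index[OF A(1)])
qed (use kronecker_one_carrier[OF A(1), of a] in auto)

lemma norm_trace_kronecker_one:
  assumes "A \<in> carrier_mat d d" "a \<ge> 1"
  shows "norm_trace P \<delta> \<tau> (kronecker A (1\<^sub>m a)) = norm_trace P \<delta> \<tau> A"
  unfolding norm_trace_def moment_kronecker_one[OF assms] ..

context wishart_param
begin

lemma amplified: "a \<ge> 1 \<Longrightarrow> wishart_param l (a * n) (d * a) (kronecker D (1\<^sub>m a))"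
  using l1 n1 d1 kronecker_one_carrier[OF D] transpose_kronecker_one[OF D sym]
  by unfold_locales auto

text \<open>
  Amplification keeps \<open>\<lambda>\<close> and the moments of \<open>D\<close>, so only the explicit powers of \<open>n\<close> in the
  second cumulant change. Their exponents are at most \<open>0\<close> by \<open>connected_bounds\<close>.
\<close>

lemma fde_variance_lim:
  "(\<lambda>a. wishart_trace_variance l (a * n) (kronecker D (1\<^sub>m a))) \<longlonglongrightarrow> var_limit"
  "fde_variance l n D = var_limit"
proof -
  let ?T = "{\<tau> \<in> pairings (pts l {..<2}). connected_family l {..<2} \<tau>}"
  let ?w = "\<lambda>\<tau>. lam ^ row_comps {..<2} \<tau> * norm_trace (pts l {..<2}) (fam_delta l {..<2}) \<tau> D"
  let ?c = "\<lambda>\<tau>. row_comps {..<2} \<tau> + col_comps {..<2} \<tau>"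
  let ?V = "\<lambda>a. \<Sum>\<tau>\<in>?T. real (a * n) ^ ?c \<tau> / real (a * n) ^ (2 * l) * ?w \<tau>"
  have "eventually (\<lambda>a. ?V a = wishart_trace_variance l (a * n) (kronecker D (1\<^sub>m a))) sequentially"
    using eventually_ge_at_top[of 1]
  proof eventually_elim
    case (elim a)
    interpret A: wishart_param l "a * n" "d * a" "kronecker D (1\<^sub>m a)" using elim by (rule amplified)
    have "real (d * a) / real (a * n) = lam" using elim by simp
    then show ?case
      unfolding A.variance_eq_cum A.cum_eq norm_trace_kronecker_one[OF D elim] A.row_comps_def A.col_comps_def
        row_comps_def col_comps_def by simp
  qed
  moreover have "?V \<longlonglongrightarrow> var_limit" unfolding var_limit_def
  proof (rule tendsto_sum)
    fix \<tau> assume "\<tau> \<in> {\<tau> \<in> pairings (pts l {..<2}). connected_family l {..<2} \<tau>}"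
    then have le: "?c \<tau> \<le> 2 * l" using connected_bounds(1)[of \<tau> 2] by auto
    show "(\<lambda>a. real (a * n) ^ ?c \<tau> / real (a * n) ^ (2 * l) * ?w \<tau>) \<longlonglongrightarrow> (if ?c \<tau> = 2 * l then ?w \<tau> else 0)"
    proof (cases "?c \<tau> = 2 * l")
      case True
      have "eventually (\<lambda>a. ?w \<tau> = real (a * n) ^ ?c \<tau> / real (a * n) ^ (2 * l) * ?w \<tau>) sequentially"
        using eventually_ge_at_top[of 1] by eventually_elim (use n1 True in simp)
      then show ?thesis unfolding if_P[OF True] by (rule Lim_transform_eventually[OF tendsto_const])
    next
      case False
      then obtain j where j: "2 * l = ?c \<tau> + Suc j" using le by (metis le_neq_implies_less less_imp_Suc_add add_Suc_right)
      have "filterlim (\<lambda>a. a * n) at_top sequentially"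
        by (rule filterlim_at_top_mono[OF filterlim_ident]) (use n1 in \<open>auto intro!: always_eventually\<close>)
      then have x: "filterlim (\<lambda>a. real (a * n)) at_top sequentially"
        by (rule filterlim_compose[OF filterlim_real_sequentially])
      have "(\<lambda>a. inverse (real (a * n))) \<longlonglongrightarrow> 0" by (rule tendsto_inverse_0_at_top[OF x])
      then have "(\<lambda>a. inverse (real (a * n)) ^ Suc j) \<longlonglongrightarrow> 0 ^ Suc j" by (rule tendsto_power)
      then have z: "(\<lambda>a. inverse (real (a * n)) ^ Suc j * ?w \<tau>) \<longlonglongrightarrow> 0"
        using tendsto_mult_left_zero by fastforce
      have "eventually (\<lambda>a. inverse (real (a * n)) ^ Suc j * ?w \<tau> = real (a * n) ^ ?c \<tau> / real (a * n) ^ (2 * l) * ?w \<tau>) sequentially"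
        using eventually_ge_at_top[of 1]
      proof eventually_elim
        case (elim a)
        then have "real (a * n) \<noteq> 0" using n1 by simp
        then have "real (a * n) ^ ?c \<tau> / real (a * n) ^ (2 * l) = inverse (real (a * n)) ^ Suc j"
          unfolding j power_add by (simp add: field_simps)
        then show ?case by simp
      qed
      with z show ?thesis unfolding if_not_P[OF False] by (rule Lim_transform_eventually)
    qed
  qed
  ultimately show lim: "(\<lambda>a. wishart_trace_variance l (a * n) (kronecker D (1\<^sub>m a))) \<longlonglongrightarrow> var_limit"
    by (rule Lim_transform_eventually[rotated])
  show "fde_variance l n D = var_limit" unfolding fde_variance_def by (rule limI[OF lim])
qed

end

section \<open>Quantitative bounds\<close>

text \<open>
  The bounds below depend on \<open>D\<close> only through \<open>C\<close>; hence they are uniform in the size of the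
  image.
\<close>

locale bounded_param = wishart_param +
  fixes C :: real
  assumes C1: "C \<ge> 1" and mom_bounds: "\<And>k. k \<ge> 1 \<Longrightarrow> 0 \<le> moment k D \<and> moment k D \<le> C ^ k"
    and nd: "n \<le> d"
begin

lemma lam_ge_1: "lam \<ge> 1" using nd n1 by simp

lemma mean_error: "\<bar>mom 1 - fde_mean l n D\<bar> \<le> real (card (pairings (pm l))) * (C ^ (2 * l) * lam ^ (l - 1) / n)"
proof -
  have "\<bar>mom 1 - fde_mean l n D\<bar> \<le> (\<Sum>\<tau>\<in>pairings (pm l). C ^ (2 * l) * lam ^ (l - 1) / n)"
    unfolding mean_difference
  proof (rule order_trans[OF sum_abs], rule sum_mono)
    fix \<tau> assume t: "\<tau> \<in> pairings (pm l)"
    let ?c = "row_comps1 \<tau> + col_comps1 \<tau>"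
    note N = norm_trace_bounds[OF finite_pm circ_delta_pairing t C1 mom_bounds]
    have rhs: "0 \<le> C ^ (2 * l) * lam ^ (l - 1) / n" using C1 by simp
    show "\<bar>if ?c < l then real n ^ ?c / real n ^ l * wt1 \<tau> else 0\<bar> \<le> C ^ (2 * l) * lam ^ (l - 1) / n"
    proof (cases "?c < l")
      case True
      have "real n ^ (?c + 1) \<le> real n ^ l" using True n1 by (intro power_increasing) auto
      then have a: "real n ^ ?c / real n ^ l \<le> 1 / n" using n1 by (simp add: field_simps)
      have "lam ^ row_comps1 \<tau> \<le> lam ^ (l - 1)" using True lam_ge_1 by (intro power_increasing) auto
      then have b: "wt1 \<tau> \<le> lam ^ (l - 1) * C ^ (2 * l)" "0 \<le> wt1 \<tau>"
        unfolding wt1_def using N lam_ge_1 by (auto intro!: mult_mono simp: card_pm)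
      have "real n ^ ?c / real n ^ l * wt1 \<tau> \<le> 1 / n * (lam ^ (l - 1) * C ^ (2 * l))"
        by (rule mult_mono[OF a b(1) _ b(2)]) simp
      moreover have "0 \<le> real n ^ ?c / real n ^ l * wt1 \<tau>" using b by simp
      ultimately show ?thesis using True by (simp add: mult.commute)
    qed (use rhs in simp)
  qed
  then show ?thesis by simp
qed

lemma cum_bound:
  assumes j: "j \<ge> 1"
  shows "\<bar>cum j\<bar> \<le> real (card (pairings (pts l {..<j}))) * (C ^ (j * (2 * l)) * (real n ^ 2 / real n ^ j) * lam ^ (j * l + 1 - j))"
proof -
  let ?T = "{\<tau> \<in> pairings (pts l {..<j}). connected_family l {..<j} \<tau>}"
  let ?b = "C ^ (j * (2 * l)) * (real n ^ 2 / real n ^ j) * lam ^ (j * l + 1 - j)"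
  have b0: "0 \<le> ?b" using C1 by simp
  have finP: "finite (pts l {..<j})" by (rule finite_pts) simp
  have "\<bar>cum j\<bar> \<le> (\<Sum>\<tau>\<in>?T. ?b)"
    unfolding cum_eq
  proof (rule order_trans[OF sum_abs], rule sum_mono)
    fix \<tau> assume "\<tau> \<in> {\<tau> \<in> pairings (pts l {..<j}). connected_family l {..<j} \<tau>}"
    then have t: "\<tau> \<in> pairings (pts l {..<j})" "connected_family l {..<j} \<tau>" by auto
    let ?c = "row_comps {..<j} \<tau> + col_comps {..<j} \<tau>"
    let ?N = "norm_trace (pts l {..<j}) (fam_delta l {..<j}) \<tau> D"
    note N = norm_trace_bounds[OF finP fam_delta_pairing t(1) C1 mom_bounds]
    note cb = connected_bounds[OF t j]
    have "real n ^ (?c + j) \<le> real n ^ (j * l + 2)" using cb(1) n1 by (intro power_increasing) auto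
    then have a: "real n ^ ?c / real n ^ (j * l) \<le> real n ^ 2 / real n ^ j"
      using n1 by (simp add: power_add divide_simps mult_ac power2_eq_square)
    have "lam ^ row_comps {..<j} \<tau> \<le> lam ^ (j * l + 1 - j)" using cb(2) lam_ge_1 by (intro power_increasing) auto
    then have b: "lam ^ row_comps {..<j} \<tau> * ?N \<le> lam ^ (j * l + 1 - j) * C ^ (j * (2 * l))" "0 \<le> lam ^ row_comps {..<j} \<tau> * ?N"
      using N lam_ge_1 by (auto intro!: mult_mono simp: card_pts)
    have "real n ^ ?c / real n ^ (j * l) * (lam ^ row_comps {..<j} \<tau> * ?N) \<le> real n ^ 2 / real n ^ j * (lam ^ (j * l + 1 - j) * C ^ (j * (2 * l)))"
      by (rule mult_mono[OF a b(1) _ b(2)]) simp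
    moreover have "0 \<le> real n ^ ?c / real n ^ (j * l) * (lam ^ row_comps {..<j} \<tau> * ?N)" using b by simp
    ultimately show "\<bar>real n ^ ?c / real n ^ (j * l) * (lam ^ row_comps {..<j} \<tau> * ?N)\<bar> \<le> ?b" by (simp add: mult_ac)
  qed
  also have "\<dots> = real (card ?T) * ?b" by simp
  also have "\<dots> \<le> real (card (pairings (pts l {..<j}))) * ?b"
    using b0 finite_pairings[OF finP] by (intro mult_right_mono) (auto intro!: card_mono)
  finally show ?thesis .
qed

lemma variance_error:
  "\<bar>cum 2 - fde_variance l n D\<bar> \<le> real (card (pairings (pts l {..<2}))) * (C ^ (4 * l) * lam ^ (2 * l - 1) / n)"
proof -
  let ?T = "{\<tau> \<in> pairings (pts l {..<2}). connected_family l {..<2} \<tau>}"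
  let ?b = "C ^ (4 * l) * lam ^ (2 * l - 1) / n"
  let ?w = "\<lambda>\<tau>. lam ^ row_comps {..<2} \<tau> * norm_trace (pts l {..<2}) (fam_delta l {..<2}) \<tau> D"
  let ?c = "\<lambda>\<tau>. row_comps {..<2} \<tau> + col_comps {..<2} \<tau>"
  have b0: "0 \<le> ?b" using C1 by simp
  have finP: "finite (pts l {..<2})" by (rule finite_pts) simp
  have "\<bar>cum 2 - fde_variance l n D\<bar> \<le> (\<Sum>\<tau>\<in>?T. ?b)"
    unfolding cum_eq fde_variance_lim(2) var_limit_def sum_subtractf[symmetric]
  proof (rule order_trans[OF sum_abs], rule sum_mono)
    fix \<tau> assume "\<tau> \<in> {\<tau> \<in> pairings (pts l {..<2}). connected_family l {..<2} \<tau>}"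
    then have t: "\<tau> \<in> pairings (pts l {..<2})" "connected_family l {..<2} \<tau>" by auto
    note N = norm_trace_bounds[OF finP fam_delta_pairing t(1) C1 mom_bounds]
    have cb: "?c \<tau> \<le> 2 * l" "row_comps {..<2} \<tau> \<le> 2 * l - 1" using connected_bounds[OF t] by auto
    show "\<bar>real n ^ ?c \<tau> / real n ^ (2 * l) * ?w \<tau> - (if ?c \<tau> = 2 * l then ?w \<tau> else 0)\<bar> \<le> ?b"
    proof (cases "?c \<tau> = 2 * l")
      case True
      then show ?thesis using b0 n1 by simp
    next
      case False
      have "real n ^ (?c \<tau> + 1) \<le> real n ^ (2 * l)" using False cb(1) n1 by (intro power_increasing) auto
      then have a: "real n ^ ?c \<tau> / real n ^ (2 * l) \<le> 1 / n" using n1 by (simp add: field_simps)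
      have "lam ^ row_comps {..<2} \<tau> \<le> lam ^ (2 * l - 1)" using cb(2) lam_ge_1 by (intro power_increasing) auto
      then have b: "?w \<tau> \<le> lam ^ (2 * l - 1) * C ^ (4 * l)" "0 \<le> ?w \<tau>"
        using N lam_ge_1 by (auto intro!: mult_mono simp: card_pts)
      have "real n ^ ?c \<tau> / real n ^ (2 * l) * ?w \<tau> \<le> 1 / n * (lam ^ (2 * l - 1) * C ^ (4 * l))"
        by (rule mult_mono[OF a b(1) _ b(2)]) simp
      moreover have "0 \<le> real n ^ ?c \<tau> / real n ^ (2 * l) * ?w \<tau>" using b by simp
      ultimately show ?thesis using False by (simp add: mult.commute)
    qed
  qed
  also have "\<dots> = real (card ?T) * ?b" by simp
  also have "\<dots> \<le> real (card (pairings (pts l {..<2}))) * ?b"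
    using b0 finite_pairings[OF finP] by (intro mult_right_mono) (auto intro!: card_mono)
  finally show ?thesis .
qed

text \<open>
  All terms of the genus expansion are nonnegative, and the pairing \<open>\<tau> = \<delta>\<close>, that is the identity premap, gives the left
  side.
\<close>

lemma mom_1_ge: "real n * (lam * moment 1 D) ^ l \<le> mom 1"
proof -
  let ?d = "circ_delta l"
  note d = pairingsD[OF circ_delta_pairing[of l]]
  have id: "?d \<circ> ?d = id" using d(4) by (auto simp: fun_eq_iff)
  have c1: "row_comps1 ?d = l" using ncomp_pairing[OF finite_pm circ_delta_pairing[of l]] card_pm[of l] by (simp add: row_comps1_def)
  have c2: "col_comps1 ?d = 1" using circle_ncomp[OF l1] by (simp add: col_comps1_def Un_commute)
  let ?H = "cycle_half (pm l) ?d ?d"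
  note h = cycle_half[OF finite_pm circ_delta_pairing circ_delta_pairing, of l]
  have orb: "orbit (?d \<circ> ?d) x = {x}" for x :: int unfolding id by (simp add: orbit_eq_singleton_iff)
  have "card (orbit (?d \<circ> ?d) ` ?H) = l"
    using card_cycles_transversal[OF finite_pm circ_delta_pairing circ_delta_pairing h] c1 by (simp add: row_comps1_def)
  moreover have "norm_trace (pm l) ?d ?d D = (\<Prod>c\<in>orbit (?d \<circ> ?d) ` ?H. moment 1 D)"
    unfolding norm_trace_def by (intro prod.cong refl) (auto simp: orb)
  ultimately have N: "norm_trace (pm l) ?d ?d D = moment 1 D ^ l" by simp
  have "real n * (lam * moment 1 D) ^ l = real n ^ (row_comps1 ?d + col_comps1 ?d) / real n ^ l * wt1 ?d"
    using n1 unfolding c1 c2 wt1_def N power_mult_distrib[of lam] by simp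
  also have "\<dots> \<le> mom 1" unfolding mom_1
  proof (rule member_le_sum[OF circ_delta_pairing _ finite_pairings[OF finite_pm]])
    fix \<tau> assume "\<tau> \<in> pairings (pm l) - {circ_delta l}"
    then show "0 \<le> real n ^ (row_comps1 \<tau> + col_comps1 \<tau>) / real n ^ l * wt1 \<tau>"
      using norm_trace_bounds(1)[OF finite_pm circ_delta_pairing, of \<tau> l C D] C1 mom_bounds by (auto simp: wt1_def)
  qed
  finally show ?thesis .
qed

lemma cum_2_lower: "2 * real l ^ 2 * (lam * moment 1 D) ^ (2 * l) / lam \<le> cum 2"
proof -
  have m0: "0 \<le> lam * moment 1 D" using mom_bounds[of 1] by simp
  have sq: "x ^ (2 * l) / lam * (real d * real n) = (real n * x ^ l)\<^sup>2" for x
    using n1 d1 by (simp add: power_mult_distrib power_mult[symmetric] power2_eq_square mult.commute power_add[symmetric] mult_2_right)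
  have "2 * real l ^ 2 * (lam * moment 1 D) ^ (2 * l) / lam = 2 * real l ^ 2 * (real n * (lam * moment 1 D) ^ l)\<^sup>2 / (real d * real n)"
    unfolding sq[symmetric] using n1 d1 by simp
  also have "\<dots> \<le> 2 * real l ^ 2 * (mom 1)\<^sup>2 / (real d * real n)"
    using mom_1_ge m0 by (intro divide_right_mono mult_left_mono power_mono) auto
  also have "\<dots> \<le> cum 2" by (rule cum_2_ge)
  finally show ?thesis .
qed

text \<open>
  The bound \<open>cum_2_lower\<close> does not change under amplification, so it passes to the limit.
\<close>

lemma fde_variance_lower: "2 * real l ^ 2 * (lam * moment 1 D) ^ (2 * l) / lam \<le> fde_variance l n D"
  unfolding fde_variance_lim(2)
proof (rule tendsto_lowerbound[OF fde_variance_lim(1)])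
  show "eventually (\<lambda>a. 2 * real l ^ 2 * (lam * moment 1 D) ^ (2 * l) / lam
      \<le> wishart_trace_variance l (a * n) (kronecker D (1\<^sub>m a))) sequentially"
    using eventually_ge_at_top[of 1]
  proof eventually_elim
    case (elim a)
    interpret A: wishart_param l "a * n" "d * a" "kronecker D (1\<^sub>m a)" using elim by (rule amplified)
    interpret A: bounded_param l "a * n" "d * a" "kronecker D (1\<^sub>m a)" C
      by unfold_locales (use C1 mom_bounds nd moment_kronecker_one[OF D elim] in auto)
    have "real (d * a) / real (a * n) = lam" using elim by simp
    then show ?case using A.cum_2_lower unfolding A.variance_eq_cum moment_kronecker_one[OF D elim] by simp
  qed
qed simp

end

section \<open>The method of moments\<close>

lemma std_normal_moment: "(\<integral>x. x ^ k \<partial>std_normal_distribution) = gauss_moment 1 k"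
  using has_bochner_integral_integral_eq[OF has_integral_gauss_moment[of 1 k]] by simp

text \<open>
  The Taylor polynomials of the characteristic functions converge with the moments. Their remainders of order
  \<open>2K\<close> are bounded by moments of order \<open>2K\<close>, in the limit by \<open>2 (t\<^sup>2 / 2)\<^sup>K / K!\<close>,
  which is small for large \<open>K\<close>. Levy's continuity theorem concludes.
\<close>

theorem moments_imp_weak_conv:
  fixes M :: "nat \<Rightarrow> real measure"
  assumes M: "\<And>i. real_distribution (M i)" and int: "\<And>i k. integrable (M i) (\<lambda>x. x ^ k)"
    and lim: "\<And>k. (\<lambda>i. \<integral>x. x ^ k \<partial>M i) \<longlonglongrightarrow> gauss_moment 1 k"
  shows "weak_conv_m M std_normal_distribution"
proof (rule levy_continuity[OF M])
  show N: "real_distribution std_normal_distribution" by (rule real_dist_normal_dist)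
  fix t :: real
  let ?N = std_normal_distribution
  define S where "S i n = (\<Sum>k\<le>n. ((\<i> * t) ^ k / fact k) * complex_of_real (\<integral>x. x ^ k \<partial>M i))" for i n
  define T where "T n = (\<Sum>k\<le>n. ((\<i> * t) ^ k / fact k) * complex_of_real (gauss_moment 1 k))" for n
  have lim0: "(\<lambda>K. 4 * ((t\<^sup>2 / 2) ^ K / fact K)) \<longlonglongrightarrow> 4 * 0"
  proof (rule tendsto_mult_left)
    have "(\<lambda>K. inverse (fact K) * (t\<^sup>2 / 2) ^ K) = (\<lambda>K. (t\<^sup>2 / 2) ^ K / fact K)"
      by (rule ext) (simp only: divide_inverse mult.commute)
    then show "(\<lambda>K. (t\<^sup>2 / 2) ^ K / fact K) \<longlonglongrightarrow> 0"
      using summable_LIMSEQ_zero[OF summable_exp[of "t\<^sup>2 / 2"]] by (simp only:)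
  qed
  show "(\<lambda>i. char (M i) t) \<longlonglongrightarrow> char ?N t"
  proof (rule tendstoI)
    fix e :: real assume e: "e > 0"
    have "eventually (\<lambda>K. 4 * ((t\<^sup>2 / 2) ^ K / fact K) < e) sequentially"
      using order_tendstoD(2)[OF lim0] e by simp
    \<comment> \<open>The factor \<open>4\<close>: two remainders, each with the factor \<open>2\<close> of the Taylor bound.\<close>
    then obtain K where K: "4 * ((t\<^sup>2 / 2) ^ K / fact K) < e" using eventually_happens by force
    let ?c = "2 * \<bar>t\<bar> ^ (2 * K) / fact (2 * K)"
    let ?f = "\<lambda>i. ?c * (\<integral>x. x ^ (2 * K) \<partial>M i) + cmod (S i (2 * K) - T (2 * K)) + ?c * gauss_moment 1 (2 * K)"
    have even_abs: "\<bar>x\<bar> ^ (2 * K) = x ^ (2 * K)" for x :: real by (simp add: power_even_abs)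
    have bound: "dist (char (M i) t) (char ?N t) \<le> ?f i" for i
    proof -
      have 1: "cmod (char (M i) t - S i (2 * K)) \<le> ?c * (\<integral>x. x ^ (2 * K) \<partial>M i)"
        using real_distribution.char_approx1[OF M[of i] int, where n = "2 * K" and t = t] unfolding S_def even_abs .
      have 2: "cmod (char ?N t - T (2 * K)) \<le> ?c * gauss_moment 1 (2 * K)"
        using real_distribution.char_approx1[OF N integrable_std_normal_distribution_moment, where n = "2 * K" and t = t]
        unfolding T_def even_abs std_normal_moment .
      have "char (M i) t - char ?N t = (char (M i) t - S i (2 * K)) + (S i (2 * K) - T (2 * K)) - (char ?N t - T (2 * K))"
        by simp
      moreover have "cmod (p + q - r) \<le> cmod p + cmod q + cmod r" for p q r
        using norm_triangle_ineq4[of "p + q" r] norm_triangle_ineq[of p q] by linarith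
      ultimately have "dist (char (M i) t) (char ?N t) \<le> cmod (char (M i) t - S i (2 * K))
          + cmod (S i (2 * K) - T (2 * K)) + cmod (char ?N t - T (2 * K))"
        unfolding dist_norm by (simp only:)
      then show ?thesis using 1 2 by linarith
    qed
    have "(\<lambda>i. S i (2 * K)) \<longlonglongrightarrow> T (2 * K)"
      unfolding S_def T_def by (intro tendsto_intros lim)
    then have "(\<lambda>i. cmod (S i (2 * K) - T (2 * K))) \<longlonglongrightarrow> 0"
      using tendsto_norm_zero[OF LIM_zero] by blast
    then have "?f \<longlonglongrightarrow> ?c * gauss_moment 1 (2 * K) + 0 + ?c * gauss_moment 1 (2 * K)"
      by (intro tendsto_intros lim)
    moreover have "?c * gauss_moment 1 (2 * K) + 0 + ?c * gauss_moment 1 (2 * K) < e"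
      using K by (simp add: gauss_moment_even power_mult power_divide) (simp add: mult.commute)
    ultimately have "eventually (\<lambda>i. ?f i < e) sequentially" by (rule order_tendstoD(2))
    then show "eventually (\<lambda>i. dist (char (M i) t) (char ?N t) < e) sequentially"
      by eventually_elim (use bound in \<open>rule le_less_trans\<close>)
  qed
qed

text \<open>
  In the limit only the second cumulant survives, and the recursion becomes that of \<open>gauss_moment\<close>.
\<close>

lemma moments_converge:
  fixes m c :: "nat \<Rightarrow> nat \<Rightarrow> real"
  assumes m0: "\<And>i. m 0 i = 1"
    and rec: "\<And>k i. m (Suc k) i = (\<Sum>j\<le>k. real (k choose j) * c (Suc j) i * m (k - j) i)"
    and c: "\<And>j. c (Suc j) \<longlonglongrightarrow> (if j = 1 then 1 else 0)"
  shows "m k \<longlonglongrightarrow> gauss_moment 1 k"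
proof (induction k rule: less_induct)
  case (less k)
  show ?case
  proof (cases k)
    case 0
    then show ?thesis using m0 by (simp add: fun_eq_iff[of "m 0", simplified])
  next
    case (Suc k')
    have "(\<lambda>i. \<Sum>j\<le>k'. real (k' choose j) * c (Suc j) i * m (k' - j) i)
        \<longlonglongrightarrow> (\<Sum>j\<le>k'. real (k' choose j) * (if j = 1 then 1 else 0) * gauss_moment 1 (k' - j))"
      using less Suc by (intro tendsto_intros c) auto
    moreover have "m k = (\<lambda>i. \<Sum>j\<le>k'. real (k' choose j) * c (Suc j) i * m (k' - j) i)"
      using rec Suc by auto
    moreover have "(\<Sum>j\<le>k'. real (k' choose j) * (if j = 1 then 1 else 0) * gauss_moment 1 (k' - j)) = gauss_moment 1 k"
    proof (cases k')
      case 0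
      then show ?thesis using Suc by simp
    next
      case (Suc k'')
      have "(\<Sum>j\<le>k'. real (k' choose j) * (if j = 1 then 1 else 0) * gauss_moment 1 (k' - j))
          = (\<Sum>j\<le>k'. if j = 1 then real (k' choose j) * gauss_moment 1 (k' - j) else 0)"
        by (intro sum.cong) auto
      also have "\<dots> = real k' * gauss_moment 1 (k' - 1)" using Suc by simp
      finally show ?thesis using Suc \<open>k = Suc k'\<close> by simp
    qed
    ultimately show ?thesis by simp
  qed
qed

definition egf :: "(nat \<Rightarrow> real) \<Rightarrow> real fps" where
  "egf f = Abs_fps (\<lambda>k. f k / fact k)"

lemma egf_mult_nth: "fps_nth (egf f * egf g) k = (\<Sum>j\<le>k. real (k choose j) * f j * g (k - j)) / fact k"
  by (simp add: egf_def fps_mult_nth atMost_atLeast0 sum_divide_distrib binomial_fact field_simps)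

text \<open>
  For exponential generating functions the relation between moments and cumulants is the differential equation
  \<open>M' = K' M\<close>.
\<close>

lemma egf_recursion_iff:
  "(\<forall>k. m (Suc k) = (\<Sum>j\<le>k. real (k choose j) * c (Suc j) * m (k - j)))
     \<longleftrightarrow> fps_deriv (egf m) = egf (\<lambda>j. c (Suc j)) * egf m"
proof -
  have "fps_nth (fps_deriv (egf m)) k = m (Suc k) / fact k" for k
    by (simp add: egf_def fact_Suc del: of_nat_Suc)
  then show ?thesis by (auto simp: fps_eq_iff egf_mult_nth)
qed

text \<open>
  Centering multiplies the generating function by \<open>exp (-a t)\<close>, which in \<open>M' = K' M\<close> changes only the constant
  term of \<open>K'\<close>, the first cumulant.
\<close>

lemma shifted_recursion:
  fixes a :: real
  assumes rec: "\<And>k. m (Suc k) = (\<Sum>j\<le>k. real (k choose j) * c (Suc j) * m (k - j))"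
  defines "\<mu> \<equiv> \<lambda>k. \<Sum>i\<le>k. real (k choose i) * (- a) ^ i * m (k - i)"
  shows "\<mu> (Suc k) = (\<Sum>j\<le>k. real (k choose j) * (if j = 0 then c 1 - a else c (Suc j)) * \<mu> (k - j))"
proof -
  let ?c = "\<lambda>j. if j = 1 then c 1 - a else c j"
  have e: "egf \<mu> = fps_exp (- a) * egf m"
  proof -
    have ex: "fps_exp (- a) = egf (\<lambda>i. (- a) ^ i)" by (simp add: fps_eq_iff egf_def)
    have "fps_nth (egf \<mu>) k = fps_nth (egf (\<lambda>i. (- a) ^ i) * egf m) k" for k
      unfolding egf_mult_nth by (simp add: egf_def \<mu>_def)
    then show ?thesis unfolding ex by (rule fps_ext)
  qed
  have c: "egf (\<lambda>j. ?c (Suc j)) = fps_const (- a) + egf (\<lambda>j. c (Suc j))"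
    by (simp add: fps_eq_iff egf_def)
  have d: "fps_deriv (egf m) = egf (\<lambda>j. c (Suc j)) * egf m"
    using egf_recursion_iff[of m c] rec by blast
  have "fps_deriv (egf \<mu>) = egf (\<lambda>j. ?c (Suc j)) * egf \<mu>"
    unfolding e c by (simp add: d fps_exp_deriv algebra_simps)
  then have "\<mu> (Suc k) = (\<Sum>j\<le>k. real (k choose j) * ?c (Suc j) * \<mu> (k - j))"
    using egf_recursion_iff[of \<mu> ?c] by blast
  also have "\<dots> = (\<Sum>j\<le>k. real (k choose j) * (if j = 0 then c 1 - a else c (Suc j)) * \<mu> (k - j))"
    by (intro sum.cong) auto
  finally show ?thesis .
qed

context wishart_param
begin

text \<open>
  Of the cumulants of \<open>(X - a) / s\<close> only the first one sees \<open>a\<close>; this is proved in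
  \<open>std_mom_recursion\<close>.
\<close>

definition std_mom :: "real \<Rightarrow> real \<Rightarrow> nat \<Rightarrow> real" where
  "std_mom a s k = (\<integral>\<omega>. ((wishart_trace l n D \<omega> - a) / s) ^ k \<partial>gaussian_space d n)"

definition std_cum :: "real \<Rightarrow> real \<Rightarrow> nat \<Rightarrow> real" where
  "std_cum a s j = (if j = 1 then cum 1 - a else cum j) / s ^ j"

lemma std_mom_integral:
  "has_bochner_integral (gaussian_space d n) (\<lambda>\<omega>. ((wishart_trace l n D \<omega> - a) / s) ^ k)
     ((\<Sum>i\<le>k. real (k choose i) * (- a) ^ i * mom (k - i)) / s ^ k)"
proof -
  have "((x - a) / s) ^ k = (\<Sum>i\<le>k. real (k choose i) * (- a) ^ i * x ^ (k - i)) / s ^ k" for x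
    using binomial_ring[of "- a" x k] by (simp add: power_divide)
  moreover have "has_bochner_integral (gaussian_space d n)
      (\<lambda>\<omega>. (\<Sum>i\<le>k. real (k choose i) * (- a) ^ i * wishart_trace l n D \<omega> ^ (k - i)) / s ^ k)
      ((\<Sum>i\<le>k. real (k choose i) * (- a) ^ i * mom (k - i)) / s ^ k)"
    unfolding divide_inverse
    by (intro has_bochner_integral_mult_left has_bochner_integral_sum has_bochner_integral_mult_right)
       (simp add: has_bochner_integral_iff integrable_wishart_power mom_def)
  ultimately show ?thesis by simp
qed

lemma std_mom_eq: "std_mom a s k = (\<Sum>i\<le>k. real (k choose i) * (- a) ^ i * mom (k - i)) / s ^ k"
  unfolding std_mom_def by (rule has_bochner_integral_integral_eq[OF std_mom_integral])

lemma std_mom_0: "std_mom a s 0 = 1"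
  by (simp add: std_mom_eq mom_0)

lemma std_mom_recursion:
  assumes "s \<noteq> 0"
  shows "std_mom a s (Suc k) = (\<Sum>j\<le>k. real (k choose j) * std_cum a s (Suc j) * std_mom a s (k - j))"
proof -
  define \<mu> where "\<mu> k = (\<Sum>i\<le>k. real (k choose i) * (- a) ^ i * mom (k - i))" for k
  have "\<mu> (Suc k) = (\<Sum>j\<le>k. real (k choose j) * (if j = 0 then cum 1 - a else cum (Suc j)) * \<mu> (k - j))"
    unfolding \<mu>_def by (rule shifted_recursion[OF moment_cumulant])
  then have "\<mu> (Suc k) / s ^ Suc k = (\<Sum>j\<le>k. real (k choose j) * (if j = 0 then cum 1 - a else cum (Suc j)) * \<mu> (k - j) / s ^ Suc k)"
    by (simp add: sum_divide_distrib)
  also have "\<dots> = (\<Sum>j\<le>k. real (k choose j) * std_cum a s (Suc j) * (\<mu> (k - j) / s ^ (k - j)))"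
  proof (rule sum.cong[OF refl])
    fix j assume "j \<in> {..k}"
    then have "s ^ Suc k = s ^ Suc j * s ^ (k - j)" by (simp add: power_add[symmetric])
    then show "real (k choose j) * (if j = 0 then cum 1 - a else cum (Suc j)) * \<mu> (k - j) / s ^ Suc k
        = real (k choose j) * std_cum a s (Suc j) * (\<mu> (k - j) / s ^ (k - j))"
      by (simp add: std_cum_def)
  qed
  finally show ?thesis by (simp add: std_mom_eq \<mu>_def)
qed

end

text \<open>
  The constants are independent of \<open>n\<close>, \<open>d\<close> and \<open>D\<close>; they refer to the cumulant of order
  \<open>j + 1\<close>, and \<open>v\<close> is the constant in the lower bound \<open>v \<lambda>\<^bsup>2l - 1\<^esup>\<close> for the variance.
\<close>

definition cum_const :: "nat \<Rightarrow> real \<Rightarrow> real \<Rightarrow> nat \<Rightarrow> real" where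
  "cum_const l C v j = (if j = 0 then real (card (pairings (pm l))) * C ^ (2 * l) / sqrt v
     else if j = 1 then real (card (pairings (pts l {..<2}))) * C ^ (4 * l) / v
     else real (card (pairings (pts l {..<Suc j}))) * C ^ (Suc j * (2 * l)) / sqrt v ^ Suc j)"

context bounded_param
begin

lemma variance_ge:
  assumes "0 < m0" "m0 \<le> moment 1 D"
  shows "2 * real l ^ 2 * m0 ^ (2 * l) * lam ^ (2 * l - 1) \<le> fde_variance l n D"
proof -
  have "x ^ (2 * l) / x = x ^ (2 * l - 1)" if "x \<noteq> 0" for x :: real
    using power_diff[OF that, of 1 "2 * l"] l1 by simp
  moreover have "lam \<noteq> 0" using lam_ge_1 by linarith
  ultimately have "lam ^ (2 * l) / lam = lam ^ (2 * l - 1)" by blast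
  then have "2 * real l ^ 2 * m0 ^ (2 * l) * lam ^ (2 * l - 1) = 2 * real l ^ 2 * (lam * m0) ^ (2 * l) / lam"
  proof -
    have "2 * L * M * Y' = 2 * L * (Y * M) / x" if "Y / x = Y'" for L M Y Y' x :: real
      unfolding that[symmetric] by simp
    then show ?thesis using \<open>lam ^ (2 * l) / lam = lam ^ (2 * l - 1)\<close> unfolding power_mult_distrib[of lam m0] .
  qed
  also have "\<dots> \<le> 2 * real l ^ 2 * (lam * moment 1 D) ^ (2 * l) / lam"
    using assms by (intro divide_right_mono mult_left_mono power_mono) auto
  also have "\<dots> \<le> fde_variance l n D" by (rule fde_variance_lower)
  finally show ?thesis .
qed

text \<open>
  In each case the power of \<open>\<lambda>\<close> in the bound for the cumulant is at most that of the standard deviation raised to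
  the order of the cumulant; for order \<open>i\<close> this is \<open>2 (il + 1 - i) \<le> (2l - 1) i\<close>, which holds for
  \<open>i \<ge> 2\<close>. So \<open>\<lambda>\<close> cancels and a factor \<open>1/n\<close> remains.
\<close>

theorem std_cum_error:
  assumes m0: "0 < m0" "m0 \<le> moment 1 D"
  defines "v \<equiv> 2 * real l ^ 2 * m0 ^ (2 * l)"
  shows "\<bar>std_cum (fde_mean l n D) (sqrt (fde_variance l n D)) (Suc j) - (if j = 1 then 1 else 0)\<bar> \<le> cum_const l C v j / n"
    and "0 < fde_variance l n D"
proof -
  let ?V = "fde_variance l n D"
  let ?s = "sqrt ?V"
  have v0: "v > 0" using m0 l1 by (simp add: v_def)
  have Vge: "v * lam ^ (2 * l - 1) \<le> ?V" using variance_ge[OF m0] by (simp add: v_def)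
  have lp: "lam ^ k \<ge> 1" for k using lam_ge_1 by simp
  have lp0: "lam ^ k > 0" for k using lp[of k] by linarith
  show V0: "0 < ?V" using Vge v0 lp0[of "2 * l - 1"] by (smt (verit) mult_pos_pos)
  have s0: "?s > 0" using V0 by simp
  have n0: "real n > 0" using n1 by simp
  have cancel: "K * (c * y / n') / (w * y) = K * c / w / n'" if "y \<noteq> 0" for K c y n' w :: real
    using that by simp
  consider "j = 0" | "j = 1" | "j \<ge> 2" by linarith
  then show "\<bar>std_cum (fde_mean l n D) ?s (Suc j) - (if j = 1 then 1 else 0)\<bar> \<le> cum_const l C v j / n"
  proof cases
    case 1
    have "(sqrt v * lam ^ (l - 1))\<^sup>2 = v * lam ^ (2 * (l - 1))"
      using v0 by (simp add: power_mult_distrib power_mult[symmetric] mult.commute)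
    also have "\<dots> \<le> v * lam ^ (2 * l - 1)" using v0 lam_ge_1 by (intro mult_left_mono power_increasing) auto
    also have "\<dots> \<le> ?V" by (rule Vge)
    finally have s: "sqrt v * lam ^ (l - 1) \<le> ?s" by (rule real_le_rsqrt)
    have "\<bar>std_cum (fde_mean l n D) ?s (Suc j) - (if j = 1 then 1 else 0)\<bar> = \<bar>mom 1 - fde_mean l n D\<bar> / ?s"
      using 1 s0 cum_1 by (simp add: std_cum_def abs_divide)
    also have "\<dots> \<le> real (card (pairings (pm l))) * (C ^ (2 * l) * lam ^ (l - 1) / n) / (sqrt v * lam ^ (l - 1))"
      using C1 v0 lp0[of "l - 1"] by (intro frac_le mean_error s) auto
    also have "\<dots> = real (card (pairings (pm l))) * C ^ (2 * l) / sqrt v / n"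
      by (rule cancel) (metis less_irrefl lp0)
    also have "\<dots> = cum_const l C v j / n" using 1 by (simp add: cum_const_def)
    finally show ?thesis .
  next
    case 2
    have "std_cum (fde_mean l n D) ?s (Suc j) - 1 = (cum 2 - ?V) / ?V"
      using 2 V0 by (simp add: std_cum_def diff_divide_distrib numeral_2_eq_2)
    then have "\<bar>std_cum (fde_mean l n D) ?s (Suc j) - (if j = 1 then 1 else 0)\<bar> = \<bar>cum 2 - ?V\<bar> / ?V"
      using 2 V0 by (simp add: abs_divide)
    also have "\<dots> \<le> real (card (pairings (pts l {..<2}))) * (C ^ (4 * l) * lam ^ (2 * l - 1) / n) / (v * lam ^ (2 * l - 1))"
      using C1 v0 lp0[of "2 * l - 1"] by (intro frac_le variance_error Vge) auto
    also have "\<dots> = real (card (pairings (pts l {..<2}))) * C ^ (4 * l) / v / n"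
      by (rule cancel) (metis less_irrefl lp0)
    also have "\<dots> = cum_const l C v j / n" using 2 by (simp add: cum_const_def)
    finally show ?thesis .
  next
    case 3
    define i where "i = Suc j"
    have i: "i \<ge> 3" using 3 by (simp add: i_def)
    let ?e = "i * l + 1 - i"
    \<comment> \<open>Both sides are squared to avoid half-integer powers of \<open>\<lambda>\<close>.\<close>
    have "2 * ?e \<le> (2 * l - 1) * i"
    proof -
      have "2 * ?e = 2 * (i * l) + 2 - 2 * i" by simp
      also have "\<dots> \<le> 2 * (i * l) - i" using i by linarith
      also have "\<dots> = (2 * l - 1) * i" unfolding diff_mult_distrib by (simp add: mult_ac)
      finally show ?thesis .
    qed
    then have "lam ^ (2 * ?e) \<le> lam ^ ((2 * l - 1) * i)" using lam_ge_1 by (intro power_increasing) auto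
    then have "(sqrt v ^ i * lam ^ ?e)\<^sup>2 \<le> (v * lam ^ (2 * l - 1)) ^ i"
      using v0 by (simp add: power_mult_distrib power_mult[symmetric] mult.commute[of i 2] mult.commute[of _ 2])
         (simp add: power_mult mult_left_mono)
    also have "\<dots> \<le> ?V ^ i" using v0 lp0[of "2 * l - 1"] by (intro power_mono Vge) auto
    also have "\<dots> = (?s ^ i)\<^sup>2" using V0 by (simp add: power_mult[symmetric] mult.commute[of i 2]) (simp add: power_mult)
    finally have s: "sqrt v ^ i * lam ^ ?e \<le> ?s ^ i" using s0 by (intro power2_le_imp_le[of "sqrt v ^ i * lam ^ ?e"]) auto
    have "real n ^ 3 \<le> real n ^ i" using i n1 by (intro power_increasing) auto
    then have nn: "real n ^ 2 / real n ^ i \<le> 1 / n" using n0 by (simp add: divide_simps power2_eq_square power3_eq_cube)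
    let ?K = "real (card (pairings (pts l {..<i}))) * C ^ (i * (2 * l))"
    have "\<bar>std_cum (fde_mean l n D) ?s (Suc j) - (if j = 1 then 1 else 0)\<bar> = \<bar>cum i\<bar> / ?s ^ i"
      using 3 s0 by (simp add: std_cum_def abs_divide i_def)
    also have "\<dots> \<le> real (card (pairings (pts l {..<i}))) * (C ^ (i * (2 * l)) * (real n ^ 2 / real n ^ i) * lam ^ ?e) / (sqrt v ^ i * lam ^ ?e)"
      using C1 v0 lp0[of ?e] i by (intro frac_le cum_bound s) auto
    also have "\<dots> = ?K / sqrt v ^ i * (real n ^ 2 / real n ^ i)"
    proof -
      have "K * (c * q * y) / (w * y) = K * c / w * q" if "y \<noteq> 0" for K c q y w :: real
        using that by simp
      then show ?thesis by this (metis less_irrefl lp0)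
    qed
    also have "\<dots> \<le> ?K / sqrt v ^ i * (1 / n)" using C1 v0 by (intro mult_left_mono nn) auto
    also have "\<dots> = cum_const l C v j / n" using 3 by (simp add: cum_const_def i_def)
    finally show ?thesis .
  qed
qed

end

section \<open>Gram matrices of convolutions\<close>

lemma trace_transpose_mult:
  assumes "A \<in> carrier_mat r c"
  shows "mat_trace (transpose_mat A * A) = (\<Sum>j<c. \<Sum>i<r. (A $$ (i, j))\<^sup>2)"
  using assms unfolding mat_trace_def
  by (auto intro!: sum.cong simp: scalar_prod_def atLeast0LessThan power2_eq_square)

lemma pow_mat_commute:
  assumes "(A :: real mat) \<in> carrier_mat d d"
  shows "A * A ^\<^sub>m k = A ^\<^sub>m k * A"
proof (induction k)
  case 0
  then show ?case using assms by simp
next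
  case (Suc k)
  have Ak: "A ^\<^sub>m k \<in> carrier_mat d d" using assms by (rule pow_carrier_mat)
  have "A * A ^\<^sub>m Suc k = (A * A ^\<^sub>m k) * A" using assms Ak by (simp add: assoc_mult_mat[of A d d _ d A d])
  then show ?case using Suc by simp
qed

lemma transpose_pow_mat:
  assumes "(A :: real mat) \<in> carrier_mat d d" "transpose_mat A = A"
  shows "transpose_mat (A ^\<^sub>m k) = A ^\<^sub>m k"
proof (induction k)
  case 0
  then show ?case by simp
next
  case (Suc k)
  have Ak: "A ^\<^sub>m k \<in> carrier_mat d d" using assms(1) by (rule pow_carrier_mat)
  show ?case using transpose_mult[OF Ak assms(1)] Suc assms(2) pow_mat_commute[OF assms(1), of k] by simp
qed

lemma pow_mat_plus:
  assumes "(A :: real mat) \<in> carrier_mat d d"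
  shows "A ^\<^sub>m (j + k) = A ^\<^sub>m j * A ^\<^sub>m k"
proof (induction k)
  case 0
  then show ?case using pow_carrier_mat[OF assms, of j] assms by simp
next
  case (Suc k)
  then show ?case
    using assoc_mult_mat[OF pow_carrier_mat[OF assms, of j] pow_carrier_mat[OF assms, of k] assms] by simp
qed

text \<open>
  Every power of a Gram matrix is again a Gram matrix: of \<open>D\<^sup>j\<close> for even exponents \<open>2j\<close>, and of \<open>B D\<^sup>j\<close> for
  odd exponents \<open>2j + 1\<close>.
\<close>

lemma gram_moment_nonneg:
  assumes B: "(B :: real mat) \<in> carrier_mat r d"
  shows "0 \<le> moment k (transpose_mat B * B)"
proof -
  let ?D = "transpose_mat B * B"
  have D: "?D \<in> carrier_mat d d" using B by auto
  have sym: "transpose_mat ?D = ?D" using B transpose_mult[of "transpose_mat B" d r B d] by simp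
  have "0 \<le> mat_trace (?D ^\<^sub>m k)"
  proof (cases "even k")
    case True
    then obtain j where j: "k = j + j" by (metis evenE mult_2)
    note Dj = pow_carrier_mat[OF D, of j]
    have "?D ^\<^sub>m k = transpose_mat (?D ^\<^sub>m j) * ?D ^\<^sub>m j"
      unfolding j pow_mat_plus[OF D] transpose_pow_mat[OF D sym] ..
    then show ?thesis using trace_transpose_mult[OF Dj] by (simp add: sum_nonneg)
  next
    case False
    then obtain j where j: "k = j + (1 + j)" by (metis oddE mult_2 add.assoc add.commute)
    note Dj = pow_carrier_mat[OF D, of j]
    have BDj: "B * ?D ^\<^sub>m j \<in> carrier_mat r d" using B Dj by auto
    have BT: "transpose_mat B \<in> carrier_mat d r" using B by auto
    have "?D ^\<^sub>m k = ?D ^\<^sub>m j * (?D * ?D ^\<^sub>m j)"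
      unfolding j pow_mat_plus[OF D, of j] pow_mat_plus[OF D, of 1] using D by simp
    also have "?D * ?D ^\<^sub>m j = transpose_mat B * (B * ?D ^\<^sub>m j)" by (rule assoc_mult_mat[OF BT B Dj])
    also have "?D ^\<^sub>m j * (transpose_mat B * (B * ?D ^\<^sub>m j)) = ?D ^\<^sub>m j * transpose_mat B * (B * ?D ^\<^sub>m j)"
      by (rule assoc_mult_mat[OF Dj BT BDj, symmetric])
    also have "?D ^\<^sub>m j * transpose_mat B = transpose_mat (B * ?D ^\<^sub>m j)"
      using transpose_mult[OF B Dj] transpose_pow_mat[OF D sym] by simp
    finally show ?thesis using trace_transpose_mult[OF BDj] by (simp add: sum_nonneg)
  qed
  then show ?thesis by (simp add: moment_def)
qed

lemma pow_mat_row_sum: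
  assumes A: "(A :: real mat) \<in> carrier_mat d d" and row: "\<And>i. i < d \<Longrightarrow> (\<Sum>j<d. \<bar>A $$ (i, j)\<bar>) \<le> C" and C: "0 \<le> C" and i: "i < d"
  shows "(\<Sum>j<d. \<bar>(A ^\<^sub>m k) $$ (i, j)\<bar>) \<le> C ^ k"
proof (induction k)
  case 0
  have "(\<Sum>j<d. \<bar>(A ^\<^sub>m 0) $$ (i, j)\<bar>) = (\<Sum>j<d. if j = i then 1 else 0)"
    using A i by (intro sum.cong) auto
  then show ?case using i by simp
next
  case (Suc k)
  have Ak: "A ^\<^sub>m k \<in> carrier_mat d d" using A by (rule pow_carrier_mat)
  have "(\<Sum>j<d. \<bar>(A ^\<^sub>m Suc k) $$ (i, j)\<bar>) = (\<Sum>j<d. \<bar>\<Sum>q<d. (A ^\<^sub>m k) $$ (i, q) * A $$ (q, j)\<bar>)"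
    using A Ak i by (intro sum.cong refl) (simp add: scalar_prod_def atLeast0LessThan)
  also have "\<dots> \<le> (\<Sum>j<d. \<Sum>q<d. \<bar>(A ^\<^sub>m k) $$ (i, q)\<bar> * \<bar>A $$ (q, j)\<bar>)"
    by (intro sum_mono order_trans[OF sum_abs]) (simp add: abs_mult)
  also have "\<dots> = (\<Sum>q<d. \<bar>(A ^\<^sub>m k) $$ (i, q)\<bar> * (\<Sum>j<d. \<bar>A $$ (q, j)\<bar>))"
    by (subst sum.swap) (simp add: sum_distrib_left)
  also have "\<dots> \<le> (\<Sum>q<d. \<bar>(A ^\<^sub>m k) $$ (i, q)\<bar> * C)" using row by (intro sum_mono mult_left_mono) auto
  also have "\<dots> = (\<Sum>q<d. \<bar>(A ^\<^sub>m k) $$ (i, q)\<bar>) * C" by (simp add: sum_distrib_right)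
  also have "\<dots> \<le> C ^ k * C" using Suc C by (intro mult_right_mono)
  finally show ?case by (simp add: mult.commute)
qed

lemma moment_le_row_sum:
  assumes A: "A \<in> carrier_mat d d" and row: "\<And>i. i < d \<Longrightarrow> (\<Sum>j<d. \<bar>A $$ (i, j)\<bar>) \<le> C" and C: "0 \<le> C" and d: "d \<ge> 1"
  shows "moment k A \<le> C ^ k"
proof -
  have Ak: "A ^\<^sub>m k \<in> carrier_mat d d" using A by (rule pow_carrier_mat)
  have "mat_trace (A ^\<^sub>m k) = (\<Sum>i<d. (A ^\<^sub>m k) $$ (i, i))" using A Ak by (simp add: mat_trace_def)
  also have "\<dots> \<le> (\<Sum>i<d. C ^ k)"
  proof (rule sum_mono)
    fix i assume i: "i \<in> {..<d}"
    have "(A ^\<^sub>m k) $$ (i, i) \<le> \<bar>(A ^\<^sub>m k) $$ (i, i)\<bar>" by simp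
    also have "\<dots> \<le> (\<Sum>j<d. \<bar>(A ^\<^sub>m k) $$ (i, j)\<bar>)" using i by (intro member_le_sum) auto
    also have "\<dots> \<le> C ^ k" using pow_mat_row_sum[OF A row C] i by simp
    finally show "(A ^\<^sub>m k) $$ (i, i) \<le> C ^ k" .
  qed
  finally show ?thesis using A d by (simp add: moment_def divide_le_eq mult.commute)
qed

lemma sum_window_le:
  "(\<Sum>p<m. if h \<le> p \<and> p < h + q then 1 else 0 :: real) \<le> real q"
  "(\<Sum>h<m. if h \<le> p \<and> p < h + q then 1 else 0 :: real) \<le> real q"
proof -
  have "(\<Sum>p<m. if h \<le> p \<and> p < h + q then 1 else 0 :: real) = real (card {p \<in> {..<m}. h \<le> p \<and> p < h + q})"
    by (subst sum.inter_filter[symmetric]) auto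
  also have "card {p \<in> {..<m}. h \<le> p \<and> p < h + q} \<le> card {h..<h + q}" by (rule card_mono) auto
  finally show "(\<Sum>p<m. if h \<le> p \<and> p < h + q then 1 else 0 :: real) \<le> real q" by simp
  have "(\<Sum>h<m. if h \<le> p \<and> p < h + q then 1 else 0 :: real) = real (card {h \<in> {..<m}. h \<le> p \<and> p < h + q})"
    by (subst sum.inter_filter[symmetric]) auto
  also have "card {h \<in> {..<m}. h \<le> p \<and> p < h + q} \<le> card {p + 1 - q..<p + 1}" by (rule card_mono) auto
  finally show "(\<Sum>h<m. if h \<le> p \<and> p < h + q then 1 else 0 :: real) \<le> real q" by simp
qed

definition filter_norm :: "real mat \<Rightarrow> real" where
  "filter_norm b = (\<Sum>i<dim_row b. \<Sum>j<dim_col b. \<bar>b $$ (i, j)\<bar>)"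

lemma filter_entry_le: "i < dim_row b \<Longrightarrow> j < dim_col b \<Longrightarrow> \<bar>b $$ (i, j)\<bar> \<le> filter_norm b"
proof -
  assume ij: "i < dim_row b" "j < dim_col b"
  have "\<bar>b $$ (i, j)\<bar> \<le> (\<Sum>j<dim_col b. \<bar>b $$ (i, j)\<bar>)" using ij by (intro member_le_sum) auto
  also have "\<dots> \<le> filter_norm b" unfolding filter_norm_def
    using ij by (intro member_le_sum[of i "{..<dim_row b}" "\<lambda>i. \<Sum>j<dim_col b. \<bar>b $$ (i, j)\<bar>"]) (auto intro: sum_nonneg)
  finally show ?thesis .
qed

lemma filter_norm_nonneg: "0 \<le> filter_norm b"
  unfolding filter_norm_def by (intro sum_nonneg) auto

text \<open>
  Each row and each column of \<open>B\<close> has its nonzero entries inside a window of \<open>q\<^sub>1\<close> by \<open>q\<^sub>2\<close> positions, whatever the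
  image size.
\<close>

lemma conv_matrix_sums:
  assumes b: "b \<in> carrier_mat q1 q2"
  defines "He \<equiv> \<lambda>H. H - 1 + q1" and "We \<equiv> \<lambda>W. W - 1 + q2"
  shows "r < H * W \<Longrightarrow> (\<Sum>c<He H * We W. \<bar>conv_matrix b H W $$ (r, c)\<bar>) \<le> filter_norm b * (real q1 * real q2)"
    and "c < He H * We W \<Longrightarrow> (\<Sum>r<H * W. \<bar>conv_matrix b H W $$ (r, c)\<bar>) \<le> filter_norm b * (real q1 * real q2)"
proof -
  let ?B = "conv_matrix b H W"
  let ?i = "\<lambda>h p q. if h \<le> p \<and> p < h + q then 1 else 0 :: real"
  have dims: "dim_row b = q1" "dim_col b = q2" using b by auto
  have entry: "\<bar>?B $$ (r, c)\<bar> \<le> filter_norm b * (?i (r div W) (c div We W) q1 * ?i (r mod W) (c mod We W) q2)"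
    if "r < H * W" "c < He H * We W" for r c
  proof -
    have "?B $$ (r, c) = (if r div W \<le> c div We W \<and> c div We W < r div W + q1 \<and> r mod W \<le> c mod We W \<and> c mod We W < r mod W + q2
        then b $$ (c div We W - r div W, c mod We W - r mod W) else 0)"
      using that unfolding conv_matrix_def dims Let_def He_def We_def by simp
    then show ?thesis using filter_entry_le[of "c div We W - r div W" b "c mod We W - r mod W"] dims filter_norm_nonneg[of b]
      by auto
  qed
  show "(\<Sum>c<He H * We W. \<bar>?B $$ (r, c)\<bar>) \<le> filter_norm b * (real q1 * real q2)" if r: "r < H * W"
  proof -
    have "(\<Sum>c<He H * We W. \<bar>?B $$ (r, c)\<bar>)
        \<le> (\<Sum>c<He H * We W. filter_norm b * (?i (r div W) (c div We W) q1 * ?i (r mod W) (c mod We W) q2))"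
      using entry[OF r] by (intro sum_mono) auto
    also have "\<dots> = filter_norm b * (\<Sum>c<He H * We W. ?i (r div W) (c div We W) q1 * ?i (r mod W) (c mod We W) q2)"
      by (rule sum_distrib_left[symmetric])
    also have "\<dots> = filter_norm b * (\<Sum>p<He H. \<Sum>s<We W. ?i (r div W) p q1 * ?i (r mod W) s q2)"
      unfolding sum_div_mod[where f = "\<lambda>p s. ?i (r div W) p q1 * ?i (r mod W) s q2"] ..
    also have "\<dots> = filter_norm b * ((\<Sum>p<He H. ?i (r div W) p q1) * (\<Sum>s<We W. ?i (r mod W) s q2))"
      unfolding sum_product ..
    also have "\<dots> \<le> filter_norm b * (real q1 * real q2)"
      by (intro mult_left_mono mult_mono sum_window_le filter_norm_nonneg) (auto intro: sum_nonneg)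
    finally show ?thesis .
  qed
  show "(\<Sum>r<H * W. \<bar>?B $$ (r, c)\<bar>) \<le> filter_norm b * (real q1 * real q2)" if c: "c < He H * We W"
  proof -
    have "(\<Sum>r<H * W. \<bar>?B $$ (r, c)\<bar>)
        \<le> (\<Sum>r<H * W. filter_norm b * (?i (r div W) (c div We W) q1 * ?i (r mod W) (c mod We W) q2))"
      using entry[OF _ c] by (intro sum_mono) auto
    also have "\<dots> = filter_norm b * (\<Sum>r<H * W. ?i (r div W) (c div We W) q1 * ?i (r mod W) (c mod We W) q2)"
      by (rule sum_distrib_left[symmetric])
    also have "\<dots> = filter_norm b * (\<Sum>h<H. \<Sum>w<W. ?i h (c div We W) q1 * ?i w (c mod We W) q2)"
      unfolding sum_div_mod[where f = "\<lambda>h w. ?i h (c div We W) q1 * ?i w (c mod We W) q2"] ..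
    also have "\<dots> = filter_norm b * ((\<Sum>h<H. ?i h (c div We W) q1) * (\<Sum>w<W. ?i w (c mod We W) q2))"
      unfolding sum_product ..
    also have "\<dots> \<le> filter_norm b * (real q1 * real q2)"
      by (intro mult_left_mono mult_mono sum_window_le filter_norm_nonneg) (auto intro: sum_nonneg)
    finally show ?thesis .
  qed
qed

lemma conv_matrix_carrier:
  "b \<in> carrier_mat q1 q2 \<Longrightarrow> conv_matrix b H W \<in> carrier_mat (H * W) ((H - 1 + q1) * (W - 1 + q2))"
  by (auto simp: conv_matrix_def Let_def)

lemma conv_gram_row_sum:
  assumes b: "b \<in> carrier_mat q1 q2" and i: "i < (H - 1 + q1) * (W - 1 + q2)"
  shows "(\<Sum>j<(H - 1 + q1) * (W - 1 + q2). \<bar>conv_gram b H W $$ (i, j)\<bar>) \<le> (filter_norm b * (real q1 * real q2))\<^sup>2"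
proof -
  let ?B = "conv_matrix b H W" and ?d = "(H - 1 + q1) * (W - 1 + q2)"
  let ?s = "filter_norm b * (real q1 * real q2)"
  have s0: "0 \<le> ?s" using filter_norm_nonneg[of b] by simp
  have B: "?B \<in> carrier_mat (H * W) ?d" by (rule conv_matrix_carrier[OF b])
  have "(\<Sum>j<?d. \<bar>conv_gram b H W $$ (i, j)\<bar>) = (\<Sum>j<?d. \<bar>\<Sum>r<H * W. ?B $$ (r, i) * ?B $$ (r, j)\<bar>)"
    using B i unfolding conv_gram_def by (intro sum.cong refl) (simp add: scalar_prod_def atLeast0LessThan)
  also have "\<dots> \<le> (\<Sum>j<?d. \<Sum>r<H * W. \<bar>?B $$ (r, i)\<bar> * \<bar>?B $$ (r, j)\<bar>)"
    by (intro sum_mono order_trans[OF sum_abs]) (simp add: abs_mult)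
  also have "\<dots> = (\<Sum>r<H * W. \<bar>?B $$ (r, i)\<bar> * (\<Sum>j<?d. \<bar>?B $$ (r, j)\<bar>))"
    by (subst sum.swap) (simp add: sum_distrib_left)
  also have "\<dots> \<le> (\<Sum>r<H * W. \<bar>?B $$ (r, i)\<bar> * ?s)"
    using conv_matrix_sums(1)[OF b] by (intro sum_mono mult_left_mono) auto
  also have "\<dots> = (\<Sum>r<H * W. \<bar>?B $$ (r, i)\<bar>) * ?s" by (simp add: sum_distrib_right)
  also have "\<dots> \<le> ?s * ?s" using conv_matrix_sums(2)[OF b i] s0 by (intro mult_right_mono) auto
  finally show ?thesis by (simp add: power2_eq_square)
qed

text \<open>
  The trace of \<open>B\<^sup>T B\<close> is the sum of all squared entries. Each of the \<open>H W\<close> rows of \<open>B\<close> contains the filter entry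
  \<open>b\<^sub>1\<^sub>1\<close>, and the number of columns is at most \<open>q\<^sub>1 q\<^sub>2 H W\<close>.
\<close>

lemma conv_gram_moment_1:
  assumes b: "b \<in> carrier_mat q1 q2" and q: "q1 \<ge> 1" "q2 \<ge> 1" and HW: "H \<ge> 1" "W \<ge> 1"
  shows "(b $$ (0, 0))\<^sup>2 / (real q1 * real q2) \<le> moment 1 (conv_gram b H W)"
proof -
  let ?B = "conv_matrix b H W" and ?d = "(H - 1 + q1) * (W - 1 + q2)"
  have B: "?B \<in> carrier_mat (H * W) ?d" by (rule conv_matrix_carrier[OF b])
  have G: "conv_gram b H W \<in> carrier_mat ?d ?d" using B by (auto simp: conv_gram_def)
  have "mat_trace (conv_gram b H W) = (\<Sum>c<?d. \<Sum>r<H * W. (?B $$ (r, c))\<^sup>2)"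
    unfolding conv_gram_def by (rule trace_transpose_mult[OF B])
  also have "\<dots> = (\<Sum>r<H * W. \<Sum>c<?d. (?B $$ (r, c))\<^sup>2)" by (rule sum.swap)
  also have "\<dots> \<ge> (\<Sum>r<H * W. (b $$ (0, 0))\<^sup>2)"
  proof (rule sum_mono)
    fix r assume r: "r \<in> {..<H * W}"
    let ?c = "(r div W + 0) * (W - 1 + q2) + (r mod W + 0)"
    have hw: "r div W < H" "r mod W < W" using r HW by (auto simp: less_mult_imp_div_less)
    have c: "?c < ?d" using conv_matrix_index_less(2)[OF hw, of 0 q1 0 q2] q by simp
    have "b $$ (0, 0) = ?B $$ (r, ?c)" using conv_matrix_entry[OF b hw, of 0 0] q by simp
    then have "(b $$ (0, 0))\<^sup>2 = (?B $$ (r, ?c))\<^sup>2" by simp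
    also have "\<dots> \<le> (\<Sum>c<?d. (?B $$ (r, c))\<^sup>2)" using c by (intro member_le_sum) auto
    finally show "(b $$ (0, 0))\<^sup>2 \<le> (\<Sum>c<?d. (?B $$ (r, c))\<^sup>2)" .
  qed
  finally have tr: "real (H * W) * (b $$ (0, 0))\<^sup>2 \<le> mat_trace (conv_gram b H W)" by simp
  \<comment> \<open>Amounts to \<open>0 \<le> (K - 1) (q - 1)\<close>.\<close>
  have le: "K - 1 + q \<le> K * q" if K: "K \<ge> 1" "q \<ge> 1" for K q :: nat
  proof -
    obtain j i where "K = Suc j" "q = Suc i" using K by (metis Suc_le_D One_nat_def)
    then show ?thesis by simp
  qed
  have "?d \<le> (H * q1) * (W * q2)" using le HW q by (intro mult_le_mono)
  then have dle: "real ?d \<le> real (H * W) * (real q1 * real q2)" by (metis of_nat_le_iff of_nat_mult mult.assoc mult.left_commute)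
  have d0: "real ?d > 0" using q HW by simp
  have q0: "real q1 * real q2 > 0" using q by simp
  have "(b $$ (0, 0))\<^sup>2 / (real q1 * real q2) * real ?d \<le> (b $$ (0, 0))\<^sup>2 / (real q1 * real q2) * (real (H * W) * (real q1 * real q2))"
    using dle q0 by (intro mult_left_mono) auto
  also have "\<dots> = real (H * W) * (b $$ (0, 0))\<^sup>2"
  proof -
    have "x / y * (z * y) = z * x" if "y > 0" for x y z :: real using that by simp
    then show ?thesis using q0 .
  qed
  finally have "(b $$ (0, 0))\<^sup>2 / (real q1 * real q2) * real ?d \<le> mat_trace (conv_gram b H W)" using tr by linarith
  moreover have "moment 1 (conv_gram b H W) = mat_trace (conv_gram b H W) / real ?d"
    using G by (simp add: moment_def)
  ultimately show ?thesis using d0 by (simp add: le_divide_eq)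
qed

lemma conv_gram_bounded_param:
  assumes b: "b \<in> carrier_mat q1 q2" and q: "q1 \<ge> 1" "q2 \<ge> 1" and HW: "H \<ge> 1" "W \<ge> 1"
    and N: "N \<ge> 1" "N \<le> H * W" and l: "l \<ge> 1"
  shows "bounded_param l N ((H - 1 + q1) * (W - 1 + q2)) (conv_gram b H W)
    (max 1 ((filter_norm b * (real q1 * real q2))\<^sup>2))"
proof -
  let ?d = "(H - 1 + q1) * (W - 1 + q2)" and ?C = "max 1 ((filter_norm b * (real q1 * real q2))\<^sup>2)"
  let ?B = "conv_matrix b H W"
  have B: "?B \<in> carrier_mat (H * W) ?d" by (rule conv_matrix_carrier[OF b])
  have G: "conv_gram b H W \<in> carrier_mat ?d ?d" using B by (auto simp: conv_gram_def)
  have d1: "?d \<ge> 1" using mult_le_mono[of 1 "H - 1 + q1" 1 "W - 1 + q2"] q by simp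
  have "H * W \<le> ?d" using q HW by (intro mult_le_mono) auto
  moreover have "transpose_mat (conv_gram b H W) = conv_gram b H W"
    unfolding conv_gram_def using B transpose_mult[of "transpose_mat ?B" ?d "H * W" ?B ?d] by simp
  moreover have "(\<Sum>j<?d. \<bar>conv_gram b H W $$ (i, j)\<bar>) \<le> ?C" if "i < ?d" for i
    using conv_gram_row_sum[OF b that] by simp
  then have "moment k (conv_gram b H W) \<le> ?C ^ k" for k
    using d1 by (intro moment_le_row_sum[OF G]) auto
  moreover have "0 \<le> moment k (conv_gram b H W)" for k
    unfolding conv_gram_def by (rule gram_moment_nonneg[OF B])
  ultimately show ?thesis using G d1 N l by unfold_locales auto
qed

theorem theorem4p5:
  fixes q1 q2 l :: nat and b :: "real mat" and H W N :: "nat \<Rightarrow> nat"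
  assumes "q1 \<ge> 1" and "q2 \<ge> 1"
    and "b \<in> carrier_mat q1 q2" and "b $$ (0, 0) \<noteq> 0"
    and "l \<ge> 1"
    and "\<And>k. H k \<ge> 1" and "\<And>k. W k \<ge> 1" and "\<And>k. N k \<ge> 1"
    and "\<And>k. H k * W k \<ge> N k"
    and "filterlim N at_top sequentially"
    and "filterlim (\<lambda>k. H k * W k) at_top sequentially"
  shows "weak_conv_m
           (\<lambda>k. fde_zscore_law l (N k) (conv_gram b (H k) (W k)) (N k) (conv_gram b (H k) (W k)))
           std_normal_distribution"
proof -
  define d where "d k = (H k - 1 + q1) * (W k - 1 + q2)" for k
  define G where "G k = conv_gram b (H k) (W k)" for k
  define C where "C = max 1 ((filter_norm b * (real q1 * real q2))\<^sup>2)"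
  define m0 where "m0 = (b $$ (0, 0))\<^sup>2 / (real q1 * real q2)"
  define v where "v = 2 * real l ^ 2 * m0 ^ (2 * l)"
  define a where "a k = fde_mean l (N k) (G k)" for k
  define s where "s k = sqrt (fde_variance l (N k) (G k))" for k
  have P: "bounded_param l (N k) (d k) (G k) C" for k
    unfolding d_def G_def C_def by (rule conv_gram_bounded_param) (use assms in auto)
  have Pw: "wishart_param l (N k) (d k) (G k)" for k using P[of k] by (simp add: bounded_param_def)
  have m0: "0 < m0" using assms(1,2,4) by (simp add: m0_def)
  have m1: "m0 \<le> moment 1 (G k)" for k
    unfolding m0_def G_def by (rule conv_gram_moment_1) (use assms in auto)
  have s0: "s k \<noteq> 0" for k
    using bounded_param.std_cum_error(2)[OF P m0 m1, of k] by (simp add: s_def)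
  define m where "m j k = wishart_param.std_mom l (N k) (d k) (G k) (a k) (s k) j" for j k
  define c where "c j k = wishart_param.std_cum l (N k) (G k) (a k) (s k) j" for j k
  have dr: "dim_row (G k) = d k" for k using wishart_param.D[OF Pw[of k]] by auto
  define M where "M k = fde_zscore_law l (N k) (G k) (N k) (G k)" for k
  have law: "M k = distr (gaussian_space (d k) (N k)) borel (\<lambda>\<omega>. (wishart_trace l (N k) (G k) \<omega> - a k) / s k)" for k
    unfolding M_def fde_zscore_law_def fde_zscore_def[abs_def] dr a_def s_def ..
  have meas: "(\<lambda>\<omega>. (wishart_trace l (N k) (G k) \<omega> - a k) / s k) \<in> borel_measurable (gaussian_space (d k) (N k))" for k
    using wishart_param.integrable_wishart_power[OF Pw[of k], of 1] by auto
  have dist: "real_distribution (M k)" for k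
    unfolding law by (rule prob_space.real_distribution_distr[OF wishart_param.prob[OF Pw] meas])
  have int: "integrable (M k) (\<lambda>x. x ^ j)" for k j
    unfolding law using wishart_param.std_mom_integral[OF Pw[of k], of "a k" "s k" j]
    by (simp add: integrable_distr_eq[OF meas] has_bochner_integral_iff)
  have mom: "(\<integral>x. x ^ j \<partial>M k) = m j k" for k j
    unfolding law m_def wishart_param.std_mom_def[OF Pw] by (simp add: integral_distr[OF meas])
  have "weak_conv_m M std_normal_distribution"
  proof (rule moments_imp_weak_conv[OF dist int])
    fix j
    have "m j \<longlonglongrightarrow> gauss_moment 1 j"
    proof (rule moments_converge[where c = c])
      show "m 0 k = 1" for k unfolding m_def by (rule wishart_param.std_mom_0[OF Pw])
      show "m (Suc i) k = (\<Sum>j\<le>i. real (i choose j) * c (Suc j) k * m (i - j) k)" for i k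
        unfolding m_def c_def by (rule wishart_param.std_mom_recursion[OF Pw s0])
      fix i
      have "(\<lambda>k. cum_const l C v i / real (N k)) \<longlonglongrightarrow> 0"
        by (rule tendsto_divide_0[OF tendsto_const])
           (rule filterlim_at_top_imp_at_infinity[OF filterlim_compose[OF filterlim_real_sequentially assms(10)]])
      then have "(\<lambda>k. c (Suc i) k - (if i = 1 then 1 else 0)) \<longlonglongrightarrow> 0"
      proof (rule Lim_null_comparison[rotated])
        show "eventually (\<lambda>k. norm (c (Suc i) k - (if i = 1 then 1 else 0)) \<le> cum_const l C v i / real (N k)) sequentially"
          using bounded_param.std_cum_error(1)[OF P m0 m1, of _ i] unfolding c_def a_def s_def v_def
          by (intro always_eventually) simp
      qed
      then show "c (Suc i) \<longlonglongrightarrow> (if i = 1 then 1 else 0)" by (rule LIM_zero_cancel)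
    qed
    then show "(\<lambda>k. \<integral>x. x ^ j \<partial>M k) \<longlonglongrightarrow> gauss_moment 1 j" unfolding mom .
  qed
  then show ?thesis unfolding M_def[abs_def] G_def .
qed

end
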